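(* Let $(M,g)$ be a Lorentzian 4-manifold and let $k$ be a complete smooth null vector field on $M$ satisfying $\nabla_k k = 0$ and $\mathrm{Ric}(k,k) > 0$ everywhere on $M$. Let $f : M \to \mathbb{R}$ be a smooth function such that $k(f)$ is nowhere vanishing, and let $\omega := d\big(g(e^f k,\cdot)\big)$, which is a symplectic form on $M$. Then $k$ cannot be tangent to a null hypersurface of $M$. Moreover, any null surface $S \subset M$ to which $k$ is tangent is Lagrangian with respect to $\omega$, i.e. $\omega|_S = 0$.
   Context: A Lorentzian metric on a smooth manifold is a smooth symmetric nondegenerate 2-tensor $g$ of signature $(-,+,\dots,+)$. A vector field $k$ is null if at every point $k$ is nonzero and $g(k,k)=0$; it is complete if its flow is defined for all time. $\nabla$ is the Levi-Civita connection of $g$ and $\mathrm{Ric}$ its Ricci tensor, with the sign convention $\mathrm{Ric}(X,Y)=\mathrm{tr}(V\mapsto R(V,X)Y)$, $R(V,X)Y=\nabla_V\nabla_X Y-\nabla_X\nabla_V Y-\nabla_{[V,X]}Y$ (so round spheres have positive Ricci curvature). $g(e^f k,\cdot)$ is the 1-form metrically equivalent to $e^f k$, $d$ is the exterior derivative, and $k(f)=df(k)$. A null hypersurface is a (nonempty) codimension one embedded submanifold whose induced metric is degenerate at every point; a null surface is a two-dimensional embedded submanifold whose induced metric is degenerate at every point. $k$ is tangent to a submanifold $S$ if $k_p \in T_pS$ for every $p \in S$. $\omega|_S$ denotes the pullback of $\omega$ to $S$. *)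

theory Defs
  imports "HOL-Analysis.Analysis"
begin

section \<open>Smooth manifolds\<close>

text \<open>The underlying manifold is a whole type \<open>'a\<close>, Hausdorff and second countable by its type class,
  with a smooth atlas \<open>A\<close> of charts \<open>(U, x)\<close> of dimension \<open>CARD('n)\<close>. Only the values of \<open>x\<close> on \<open>U\<close> matter.\<close>

text \<open>\<open>F\<close> is of class \<open>C\<^sup>r\<close> on the set \<open>U\<close>, which is open wherever the notion is used.\<close>

primrec Cr_on :: "nat \<Rightarrow> 'e::euclidean_space set \<Rightarrow> ('e \<Rightarrow> 'f::euclidean_space) \<Rightarrow> bool" where
  "Cr_on 0 U F = continuous_on U F"
| "Cr_on (Suc r) U F \<longleftrightarrow> (\<forall>y\<in>U. F differentiable (at y)) \<and>
     (\<forall>v. Cr_on r U (\<lambda>y. frechet_derivative F (at y) v))"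

definition C_infinity_on :: "'e::euclidean_space set \<Rightarrow> ('e \<Rightarrow> 'f::euclidean_space) \<Rightarrow> bool" where
  "C_infinity_on U F \<longleftrightarrow> (\<forall>r. Cr_on r U F)"

type_synonym ('a, 'n) chart = "'a set \<times> ('a \<Rightarrow> real ^ 'n)"

definition is_chart :: "('a::topological_space, 'n::finite) chart \<Rightarrow> bool" where
  "is_chart = (\<lambda>(U, x). open U \<and> open (x ` U) \<and> homeomorphism U (x ` U) x (inv_into U x))"

definition smooth_transition :: "('a, 'n::finite) chart \<Rightarrow> ('a, 'n) chart \<Rightarrow> bool" where
  "smooth_transition = (\<lambda>(U, x) (V, y). C_infinity_on (x ` (U \<inter> V)) (y \<circ> inv_into U x))"

definition smooth_atlas :: "('a::topological_space, 'n::finite) chart set \<Rightarrow> bool" where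
  "smooth_atlas A \<longleftrightarrow>
     (\<forall>c\<in>A. is_chart c) \<and> (\<Union>c\<in>A. fst c) = UNIV \<and> (\<forall>c\<in>A. \<forall>d\<in>A. smooth_transition c d)"

definition maximal_atlas :: "('a::topological_space, 'n::finite) chart set \<Rightarrow> ('a, 'n) chart set" where
  "maximal_atlas A = {c. is_chart c \<and> (\<forall>d\<in>A. smooth_transition c d \<and> smooth_transition d c)}"

definition chart_at :: "('a, 'n::finite) chart set \<Rightarrow> 'a \<Rightarrow> ('a, 'n) chart" where
  "chart_at A p = (SOME c. c \<in> A \<and> p \<in> fst c)"

definition smooth_fun :: "('a, 'n::finite) chart set \<Rightarrow> 'a set \<Rightarrow> ('a \<Rightarrow> real) \<Rightarrow> bool" where
  "smooth_fun A W h \<longleftrightarrow> (\<forall>(U, x)\<in>A. C_infinity_on (x ` (U \<inter> W)) (h \<circ> inv_into U x))"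

definition smooth_near :: "('a::topological_space, 'n::finite) chart set \<Rightarrow> 'a \<Rightarrow> ('a \<Rightarrow> real) \<Rightarrow> bool" where
  "smooth_near A p h \<longleftrightarrow> (\<exists>W. open W \<and> p \<in> W \<and> smooth_fun A W h)"

definition smooth_curve ::
  "('a::topological_space, 'n::finite) chart set \<Rightarrow> real set \<Rightarrow> (real \<Rightarrow> 'a) \<Rightarrow> bool" where
  "smooth_curve A I \<gamma> \<longleftrightarrow>
     continuous_on I \<gamma> \<and> (\<forall>(U, x)\<in>A. C_infinity_on (I \<inter> \<gamma> -` U) (x \<circ> \<gamma>))"

section \<open>Tangent vectors and vector fields\<close>

text \<open>A tangent vector at \<open>p\<close> is the directional derivative \<open>h \<mapsto> (h \<circ> \<gamma>)'(0)\<close> along a smooth curve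
  \<open>\<gamma>\<close> through \<open>p\<close>, acting on functions smooth near \<open>p\<close>. It is set to \<open>0\<close> on all other
  functions, so that equality of tangent vectors is equality of functions.\<close>

type_synonym 'a tvec = "('a \<Rightarrow> real) \<Rightarrow> real"
type_synonym 'a vfield = "'a \<Rightarrow> 'a tvec"
type_synonym 'a form1 = "'a \<Rightarrow> 'a tvec \<Rightarrow> real"
type_synonym 'a form2 = "'a \<Rightarrow> 'a tvec \<Rightarrow> 'a tvec \<Rightarrow> real"

definition tzero :: "'a tvec" where
  "tzero = (\<lambda>h. 0)"

definition tadd :: "'a tvec \<Rightarrow> 'a tvec \<Rightarrow> 'a tvec" where
  "tadd v w = (\<lambda>h. v h + w h)"

definition tscale :: "real \<Rightarrow> 'a tvec \<Rightarrow> 'a tvec" where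
  "tscale a v = (\<lambda>h. a * v h)"

definition vf_add :: "'a vfield \<Rightarrow> 'a vfield \<Rightarrow> 'a vfield" where
  "vf_add X Y = (\<lambda>p. tadd (X p) (Y p))"

definition vf_scale :: "('a \<Rightarrow> real) \<Rightarrow> 'a vfield \<Rightarrow> 'a vfield" where
  "vf_scale h X = (\<lambda>p. tscale (h p) (X p))"

definition velocity ::
  "('a::topological_space, 'n::finite) chart set \<Rightarrow> (real \<Rightarrow> 'a) \<Rightarrow> real \<Rightarrow> 'a tvec" where
  "velocity A \<gamma> t = (\<lambda>h. if smooth_near A (\<gamma> t) h then deriv (h \<circ> \<gamma>) t else 0)"

text \<open>The tangent space at \<open>p\<close> of an embedded submanifold \<open>S\<close>: velocities of curves that are smooth
  in the ambient manifold and run in \<open>S\<close>.\<close>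

definition tangent_space ::
  "('a::topological_space, 'n::finite) chart set \<Rightarrow> 'a set \<Rightarrow> 'a \<Rightarrow> 'a tvec set" where
  "tangent_space A S p =
     {velocity A \<gamma> 0 | \<gamma> \<epsilon>. \<epsilon> > 0 \<and> smooth_curve A {-\<epsilon><..<\<epsilon>} \<gamma> \<and> \<gamma> ` {-\<epsilon><..<\<epsilon>} \<subseteq> S \<and> \<gamma> 0 = p}"

abbreviation tangent ::
  "('a::topological_space, 'n::finite) chart set \<Rightarrow> 'a \<Rightarrow> 'a tvec set" where
  "tangent A p \<equiv> tangent_space A UNIV p"

definition smooth_vfield ::
  "('a::topological_space, 'n::finite) chart set \<Rightarrow> 'a set \<Rightarrow> 'a vfield \<Rightarrow> bool" where
  "smooth_vfield A W X \<longleftrightarrow> (\<forall>p\<in>W. X p \<in> tangent A p) \<and>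
     (\<forall>V h. open V \<and> V \<subseteq> W \<and> smooth_fun A V h \<longrightarrow> smooth_fun A V (\<lambda>p. X p h))"

text \<open>The coordinate vector field \<open>\<partial>/\<partial>x\<^sup>i\<close>, meaningful on the chart domain.\<close>

definition coord_field ::
  "('a::topological_space, 'n::finite) chart set \<Rightarrow> ('a, 'n) chart \<Rightarrow> 'n \<Rightarrow> 'a vfield" where
  "coord_field A = (\<lambda>(U, x) i p h.
     if smooth_near A p h then frechet_derivative (h \<circ> inv_into U x) (at (x p)) (axis i 1) else 0)"

definition coord_fun :: "('a, 'n::finite) chart \<Rightarrow> 'n \<Rightarrow> 'a \<Rightarrow> real" where
  "coord_fun = (\<lambda>(U, x) i p. x p $ i)"

definition lie_bracket ::
  "('a::topological_space, 'n::finite) chart set \<Rightarrow> 'a vfield \<Rightarrow> 'a vfield \<Rightarrow> 'a vfield" where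
  "lie_bracket A X Y p =
     (\<lambda>h. if smooth_near A p h then X p (\<lambda>q. Y q h) - Y p (\<lambda>q. X q h) else 0)"

text \<open>The flow is defined for all time: every point lies on an integral curve defined on the whole real line.\<close>

definition complete_vfield ::
  "('a::topological_space, 'n::finite) chart set \<Rightarrow> 'a vfield \<Rightarrow> bool" where
  "complete_vfield A X \<longleftrightarrow>
     (\<forall>p. \<exists>\<gamma>. smooth_curve A UNIV \<gamma> \<and> \<gamma> 0 = p \<and> (\<forall>t. velocity A \<gamma> t = X (\<gamma> t)))"

section \<open>Lorentzian metrics, Levi-Civita connection and Ricci tensor\<close>

definition bilinear_at ::
  "('a::topological_space, 'n::finite) chart set \<Rightarrow> 'a \<Rightarrow> ('a tvec \<Rightarrow> 'a tvec \<Rightarrow> real) \<Rightarrow> bool" where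
  "bilinear_at A p b \<longleftrightarrow>
     (\<forall>u\<in>tangent A p. \<forall>v\<in>tangent A p. \<forall>w\<in>tangent A p. \<forall>a.
        b (tadd (tscale a u) v) w = a * b u w + b v w \<and>
        b w (tadd (tscale a u) v) = a * b w u + b w v)"

definition smooth_tensor2 ::
  "('a::topological_space, 'n::finite) chart set \<Rightarrow> ('a \<Rightarrow> 'a tvec \<Rightarrow> 'a tvec \<Rightarrow> real) \<Rightarrow> bool" where
  "smooth_tensor2 A b \<longleftrightarrow> (\<forall>p. bilinear_at A p (b p)) \<and>
     (\<forall>W X Y. open W \<and> smooth_vfield A W X \<and> smooth_vfield A W Y
        \<longrightarrow> smooth_fun A W (\<lambda>p. b p (X p) (Y p)))"

text \<open>Signature \<open>(-,+,\<dots>,+)\<close>: each tangent space has a basis in which the metric is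
  diagonal with a single entry \<open>-1\<close> and all other entries \<open>1\<close>. This forces nondegeneracy.\<close>

definition lorentzian_metric ::
  "('a::topological_space, 'n::finite) chart set \<Rightarrow> ('a \<Rightarrow> 'a tvec \<Rightarrow> 'a tvec \<Rightarrow> real) \<Rightarrow> bool" where
  "lorentzian_metric A g \<longleftrightarrow> smooth_tensor2 A g \<and>
     (\<forall>p. \<forall>u\<in>tangent A p. \<forall>v\<in>tangent A p. g p u v = g p v u) \<and>
     (\<forall>p. \<exists>e :: 'n \<Rightarrow> 'a tvec. \<exists>i0.
        (\<forall>i. e i \<in> tangent A p) \<and>
        (\<forall>v\<in>tangent A p. \<exists>a. v = (\<lambda>h. \<Sum>i\<in>UNIV. a i * e i h)) \<and>
        (\<forall>i j. g p (e i) (e j) = (if i \<noteq> j then 0 else if i = i0 then -1 else 1)))"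

definition null_vfield :: "('a \<Rightarrow> 'a tvec \<Rightarrow> 'a tvec \<Rightarrow> real) \<Rightarrow> 'a vfield \<Rightarrow> bool" where
  "null_vfield g X \<longleftrightarrow> (\<forall>p. X p \<noteq> tzero \<and> g p (X p) (X p) = 0)"

text \<open>A connection acts on vector fields that are smooth on some open set \<open>W\<close>; outside
  these its values are irrelevant.\<close>

definition affine_connection ::
  "('a::topological_space, 'n::finite) chart set \<Rightarrow> ('a vfield \<Rightarrow> 'a vfield \<Rightarrow> 'a vfield) \<Rightarrow> bool" where
  "affine_connection A nabla \<longleftrightarrow>
     (\<forall>W X X' Y Y' h. open W \<and> smooth_vfield A W X \<and> smooth_vfield A W X' \<and>
        smooth_vfield A W Y \<and> smooth_vfield A W Y' \<and> smooth_fun A W h \<longrightarrow>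
        smooth_vfield A W (nabla X Y) \<and>
        (\<forall>p\<in>W.
           nabla (vf_add (vf_scale h X) X') Y p = tadd (tscale (h p) (nabla X Y p)) (nabla X' Y p) \<and>
           nabla X (vf_add Y Y') p = tadd (nabla X Y p) (nabla X Y' p) \<and>
           nabla X (vf_scale h Y) p = tadd (tscale (X p h) (Y p)) (tscale (h p) (nabla X Y p))))"

definition levi_civita ::
  "('a::topological_space, 'n::finite) chart set \<Rightarrow> ('a \<Rightarrow> 'a tvec \<Rightarrow> 'a tvec \<Rightarrow> real) \<Rightarrow>
     ('a vfield \<Rightarrow> 'a vfield \<Rightarrow> 'a vfield) \<Rightarrow> bool" where
  "levi_civita A g nabla \<longleftrightarrow> affine_connection A nabla \<and>
     (\<forall>W X Y Z. open W \<and> smooth_vfield A W X \<and> smooth_vfield A W Y \<and> smooth_vfield A W Z \<longrightarrow>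
        (\<forall>p\<in>W.
           tadd (nabla X Y p) (tscale (-1) (nabla Y X p)) = lie_bracket A X Y p \<and>
           X p (\<lambda>q. g q (Y q) (Z q)) = g p (nabla X Y p) (Z p) + g p (Y p) (nabla X Z p)))"

definition curvature ::
  "('a::topological_space, 'n::finite) chart set \<Rightarrow> ('a vfield \<Rightarrow> 'a vfield \<Rightarrow> 'a vfield) \<Rightarrow>
     'a vfield \<Rightarrow> 'a vfield \<Rightarrow> 'a vfield \<Rightarrow> 'a vfield" where
  "curvature A nabla V X Y p =
     (\<lambda>h. nabla V (nabla X Y) p h - nabla X (nabla V Y) p h - nabla (lie_bracket A V X) Y p h)"

text \<open>The trace of \<open>V \<mapsto> R(V,X)Y\<close>, taken in the coordinate basis of a chart around \<open>p\<close>; being a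
  trace, it does not depend on the chosen chart.\<close>

definition ricci ::
  "('a::topological_space, 'n::finite) chart set \<Rightarrow> ('a vfield \<Rightarrow> 'a vfield \<Rightarrow> 'a vfield) \<Rightarrow>
     'a vfield \<Rightarrow> 'a vfield \<Rightarrow> 'a \<Rightarrow> real" where
  "ricci A nabla X Y p = (let c = chart_at A p in
     \<Sum>i\<in>UNIV. curvature A nabla (coord_field A c i) X Y p (coord_fun c i))"

section \<open>Differential forms\<close>

text \<open>\<open>(d\<alpha>)\<^sub>i\<^sub>j = \<partial>\<^sub>i \<alpha>\<^sub>j - \<partial>\<^sub>j \<alpha>\<^sub>i\<close> and \<open>(d\<omega>)\<^sub>i\<^sub>j\<^sub>k = \<partial>\<^sub>i \<omega>\<^sub>j\<^sub>k + \<partial>\<^sub>j \<omega>\<^sub>k\<^sub>i + \<partial>\<^sub>k \<omega>\<^sub>i\<^sub>j\<close>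
  in a chart around the point; the result does not depend on the chart.\<close>

definition ext_deriv1 ::
  "('a::topological_space, 'n::finite) chart set \<Rightarrow> 'a form1 \<Rightarrow> 'a form2" where
  "ext_deriv1 A \<alpha> p u v = (let c = chart_at A p; D = coord_field A c in
     \<Sum>i\<in>UNIV. \<Sum>j\<in>UNIV.
       (D i p (\<lambda>q. \<alpha> q (D j q)) - D j p (\<lambda>q. \<alpha> q (D i q))) * u (coord_fun c i) * v (coord_fun c j))"

definition ext_deriv2 ::
  "('a::topological_space, 'n::finite) chart set \<Rightarrow> 'a form2 \<Rightarrow>
     'a \<Rightarrow> 'a tvec \<Rightarrow> 'a tvec \<Rightarrow> 'a tvec \<Rightarrow> real" where
  "ext_deriv2 A \<omega> p u v w = (let c = chart_at A p; D = coord_field A c in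
     \<Sum>i\<in>UNIV. \<Sum>j\<in>UNIV. \<Sum>k\<in>UNIV.
       (D i p (\<lambda>q. \<omega> q (D j q) (D k q)) + D j p (\<lambda>q. \<omega> q (D k q) (D i q))
          + D k p (\<lambda>q. \<omega> q (D i q) (D j q)))
       * u (coord_fun c i) * v (coord_fun c j) * w (coord_fun c k))"

definition symplectic_form ::
  "('a::topological_space, 'n::finite) chart set \<Rightarrow> 'a form2 \<Rightarrow> bool" where
  "symplectic_form A \<omega> \<longleftrightarrow> smooth_tensor2 A \<omega> \<and>
     (\<forall>p. \<forall>u\<in>tangent A p. \<omega> p u u = 0) \<and>
     (\<forall>p. \<forall>u\<in>tangent A p. \<forall>v\<in>tangent A p. \<forall>w\<in>tangent A p. ext_deriv2 A \<omega> p u v w = 0) \<and>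
     (\<forall>p. \<forall>u\<in>tangent A p. u \<noteq> tzero \<longrightarrow> (\<exists>v\<in>tangent A p. \<omega> p u v \<noteq> 0))"

section \<open>Submanifolds\<close>

text \<open>Embedded submanifolds of dimension \<open>m\<close>, by slice charts: \<open>J\<close> is the set of
  coordinates that vanish on \<open>S\<close>. The empty set is allowed.\<close>

definition embedded_submanifold ::
  "('a::topological_space, 'n::finite) chart set \<Rightarrow> nat \<Rightarrow> 'a set \<Rightarrow> bool" where
  "embedded_submanifold A m S \<longleftrightarrow>
     (\<forall>p\<in>S. \<exists>(U, x)\<in>maximal_atlas A. \<exists>J :: 'n set. p \<in> U \<and> card (- J) = m \<and>
        (\<forall>q\<in>U. q \<in> S \<longleftrightarrow> (\<forall>i\<in>J. x q $ i = 0)))"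

definition induced_degenerate ::
  "('a::topological_space, 'n::finite) chart set \<Rightarrow> ('a \<Rightarrow> 'a tvec \<Rightarrow> 'a tvec \<Rightarrow> real) \<Rightarrow> 'a set \<Rightarrow> bool" where
  "induced_degenerate A g S \<longleftrightarrow>
     (\<forall>p\<in>S. \<exists>v\<in>tangent_space A S p. v \<noteq> tzero \<and> (\<forall>w\<in>tangent_space A S p. g p v w = 0))"

definition null_hypersurface ::
  "('a::topological_space, 'n::finite) chart set \<Rightarrow> ('a \<Rightarrow> 'a tvec \<Rightarrow> 'a tvec \<Rightarrow> real) \<Rightarrow> 'a set \<Rightarrow> bool" where
  "null_hypersurface A g H \<longleftrightarrow>
     H \<noteq> {} \<and> embedded_submanifold A (CARD('n) - 1) H \<and> induced_degenerate A g H"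

definition null_surface ::
  "('a::topological_space, 'n::finite) chart set \<Rightarrow> ('a \<Rightarrow> 'a tvec \<Rightarrow> 'a tvec \<Rightarrow> real) \<Rightarrow> 'a set \<Rightarrow> bool" where
  "null_surface A g S \<longleftrightarrow> embedded_submanifold A 2 S \<and> induced_degenerate A g S"

definition tangent_to ::
  "('a::topological_space, 'n::finite) chart set \<Rightarrow> 'a vfield \<Rightarrow> 'a set \<Rightarrow> bool" where
  "tangent_to A X S \<longleftrightarrow> (\<forall>p\<in>S. X p \<in> tangent_space A S p)"

text \<open>Since \<open>tangent_space A S p\<close> consists of ambient tangent vectors, the pullback of \<open>\<omega>\<close> to
  \<open>S\<close> is its restriction to these spaces.\<close>

definition lagrangian ::
  "('a::topological_space, 'n::finite) chart set \<Rightarrow> 'a form2 \<Rightarrow> 'a set \<Rightarrow> bool" where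
  "lagrangian A \<omega> S \<longleftrightarrow> (\<exists>m. CARD('n) = 2 * m \<and> embedded_submanifold A m S) \<and>
     (\<forall>p\<in>S. \<forall>u\<in>tangent_space A S p. \<forall>v\<in>tangent_space A S p. \<omega> p u v = 0)"

end

theory Submission
  imports Defs
begin

text \<open>
  Write \<open>k\<^sup>\<flat> = g(k,\<cdot>)\<close> and \<open>B = \<nabla>k\<close>. Because \<open>k\<close> is null and geodesic, \<open>i\<^sub>k dk\<^sup>\<flat> = 0\<close>, so
  \<open>\<omega> = e\<^sup>f (df \<and> k\<^sup>\<flat> + dk\<^sup>\<flat>)\<close> satisfies \<open>i\<^sub>k \<omega> = e\<^sup>f k(f) k\<^sup>\<flat>\<close>. Everything rests on the twist, the
  three-form \<open>k\<^sup>\<flat> \<and> dk\<^sup>\<flat>\<close>, being nowhere zero.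

  The twist cannot vanish at a point. Cartan's formula gives \<open>L\<^sub>k k\<^sup>\<flat> = 0\<close> and \<open>L\<^sub>k dk\<^sup>\<flat> = 0\<close>; in coordinates
  the twist therefore solves a linear homogeneous ODE along each integral curve of \<open>k\<close> (\<open>k_twist\<close>), and if
  it vanishes at one point of the curve it vanishes on all of it (\<open>twist_free_propagates\<close>). On such a curve
  \<open>B\<close> is, up to a term with values in the line of \<open>k\<close>, a self-adjoint endomorphism of the Euclidean plane
  \<open>k\<^sup>\<bottom>/k\<close>, whence \<open>(tr B)\<^sup>2 \<le> 2 tr B\<^sup>2\<close> (\<open>twist_free_trace_inequality\<close>). The Raychaudhuri equation
  \<open>k(tr B) = - tr B\<^sup>2 - Ric(k,k)\<close> (\<open>raychaudhuri\<close>) then makes the expansion \<open>\<theta> = tr B\<close> satisfy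
  \<open>\<theta>' < - \<theta>\<^sup>2 / 2\<close> for all time, as \<open>k\<close> is complete and \<open>Ric(k,k) > 0\<close>. No function on the whole line does so
  (\<open>riccati_no_global_solution\<close>). This is \<open>twisting\<close>.

  Nondegeneracy of \<open>\<omega>\<close> follows by linear algebra: a nonzero kernel vector of \<open>\<omega>\<close> is independent of \<open>k\<close>, and together
  they annihilate \<open>k\<^sup>\<flat> \<and> dk\<^sup>\<flat>\<close>; but a nonzero three-form in dimension four has a one-dimensional kernel
  (\<open>degenerate_imp_twist_free\<close>).

  Finally let \<open>k\<close> be tangent to a submanifold with degenerate induced metric. The degenerate direction is
  null and orthogonal to \<open>k\<close>, hence parallel to \<open>k\<close>, so \<open>k\<^sup>\<flat>\<close> vanishes on the tangent spaces
  (\<open>degenerate_orthogonal_k\<close>). On a hypersurface the pullback of \<open>\<omega> = d(e\<^sup>f k\<^sup>\<flat>)\<close> would then be zero, but a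
  three-dimensional subspace is too large to be isotropic for a symplectic form in dimension four. On a surface
  the tangent plane contains \<open>k\<close>, and \<open>i\<^sub>k \<omega>\<close>, a multiple of \<open>k\<^sup>\<flat>\<close>, vanishes on it, so the plane is Lagrangian.

  All computations are done in charts of the maximal atlas. The point where coordinates and invariant notions
  meet is that tangent vectors, defined as velocities of curves, are exactly the derivations
  \<open>w\<^sup>i \<partial>\<^sub>i\<close> (\<open>dvec_tangent\<close>, \<open>tangent_dvec\<close>), and that the connection is a local operator (\<open>nabla_local\<close>).
\<close>



section \<open>Calculus of \<open>C\<^sup>r\<close> maps\<close>

lemma Cr_on_cong:
  assumes "open U" "\<And>y. y \<in> U \<Longrightarrow> F y = G y"
  shows "Cr_on r U F \<longleftrightarrow> Cr_on r U G"
  using assms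
proof (induction r arbitrary: F G)
  case 0
  then show ?case by (simp cong: continuous_on_cong)
next
  case (Suc r)
  have tr: "H differentiable (at y) \<Longrightarrow> (\<And>z. z \<in> U \<Longrightarrow> H z = K z) \<Longrightarrow>
      (K has_derivative frechet_derivative H (at y)) (at y)" if "y \<in> U" for y and H K :: "'a \<Rightarrow> 'b"
    using that Suc.prems(1) has_derivative_transform_within_open[of H "frechet_derivative H (at y)" y UNIV U K]
    by (auto simp: frechet_derivative_works)
  have d: "F differentiable (at y) \<longleftrightarrow> G differentiable (at y)" if "y \<in> U" for y
    using tr[OF that, of F G] tr[OF that, of G F] Suc.prems(2) unfolding differentiable_def by metis
  have e: "frechet_derivative F (at y) v = frechet_derivative G (at y) v"
    if "y \<in> U" "F differentiable (at y)" for y v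
    using frechet_derivative_at[OF tr[OF that(1,2)], of G] Suc.prems(2) by simp
  show ?case
  proof (cases "\<forall>y\<in>U. F differentiable (at y)")
    case True
    then have "Cr_on r U (\<lambda>y. frechet_derivative F (at y) v) \<longleftrightarrow> Cr_on r U (\<lambda>y. frechet_derivative G (at y) v)" for v
      by (intro Suc.IH Suc.prems(1)) (simp add: e)
    then show ?thesis using True d by simp
  next
    case False
    then show ?thesis using d by auto
  qed
qed

lemma Cr_on_subset: "Cr_on r U F \<Longrightarrow> V \<subseteq> U \<Longrightarrow> Cr_on r V F"
  by (induction r arbitrary: F) (auto intro: continuous_on_subset)

lemma Cr_on_local:
  assumes "\<And>y. y \<in> U \<Longrightarrow> \<exists>V. open V \<and> y \<in> V \<and> Cr_on r V F"
  shows "Cr_on r U F"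
  using assms
proof (induction r arbitrary: F)
  case 0
  have "isCont F y" if "y \<in> U" for y
    using 0[OF that] by (auto simp: continuous_on_eq_continuous_at)
  then have "\<forall>y\<in>U. isCont F y" by blast
  then show ?case by (simp add: continuous_at_imp_continuous_on)
next
  case (Suc r)
  have "F differentiable (at y)" if "y \<in> U" for y
    using Suc.prems[OF that] by auto
  moreover have "Cr_on r U (\<lambda>y. frechet_derivative F (at y) v)" for v
  proof (rule Suc.IH)
    fix y assume "y \<in> U"
    then show "\<exists>V. open V \<and> y \<in> V \<and> Cr_on r V (\<lambda>y. frechet_derivative F (at y) v)"
      using Suc.prems[of y] by auto
  qed
  ultimately show ?case by simp
qed

lemma Cr_on_Suc_imp: "Cr_on (Suc r) U F \<Longrightarrow> Cr_on r U F"
proof (induction r arbitrary: F)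
  case 0
  then show ?case
    by (auto intro!: continuous_at_imp_continuous_on differentiable_imp_continuous_within)
next
  case (Suc r)
  then show ?case by (metis Cr_on.simps(2))
qed

lemma Cr_on_SucI:
  assumes "open U" "\<And>y. y \<in> U \<Longrightarrow> (F has_derivative D y) (at y)" "\<And>v. Cr_on r U (\<lambda>y. D y v)"
  shows "Cr_on (Suc r) U F"
proof -
  have "frechet_derivative F (at y) = D y" if "y \<in> U" for y
    using frechet_derivative_at[OF assms(2)[OF that]] by simp
  then have "Cr_on r U (\<lambda>y. frechet_derivative F (at y) v)" for v
    using assms(3)[of v] Cr_on_cong[OF assms(1), of "\<lambda>y. frechet_derivative F (at y) v" "\<lambda>y. D y v" r]
    by simp
  then show ?thesis using assms(2) by (auto simp: differentiable_def)
qed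

lemma Cr_on_const [simp]: "Cr_on r U (\<lambda>y. c)"
  by (induction r arbitrary: c) auto

lemma Cr_on_bounded_linear:
  assumes "bounded_linear L"
  shows "Cr_on r U L"
proof (cases r)
  case 0
  then show ?thesis using assms by (simp add: linear_continuous_on)
next
  case (Suc r')
  have "(L has_derivative L) (at y)" for y
    using assms by (rule bounded_linear_imp_has_derivative)
  then have "L differentiable (at y)" "frechet_derivative L (at y) = L" for y
    by (auto simp: differentiable_def frechet_derivative_at[symmetric])
  then show ?thesis using Suc by simp
qed

lemma Cr_on_bounded_linear_compose:
  assumes "bounded_linear L" "Cr_on r U F" "open U"
  shows "Cr_on r U (\<lambda>y. L (F y))"
  using assms(2)
proof (induction r arbitrary: F)
  case 0
  then show ?case by (simp add: bounded_linear.continuous_on[OF assms(1)])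
next
  case (Suc r)
  have d: "((\<lambda>y. L (F y)) has_derivative (\<lambda>v. L (frechet_derivative F (at y) v))) (at y)" if "y \<in> U" for y
    using Suc.prems that by (auto intro!: bounded_linear.has_derivative[OF assms(1)] simp: frechet_derivative_works)
  show ?case
    by (rule Cr_on_SucI[OF assms(3) d]) (use Suc in auto)
qed

lemma Cr_on_add:
  assumes "Cr_on r U F" "Cr_on r U G" "open U"
  shows "Cr_on r U (\<lambda>y. F y + G y)"
  using assms(1,2)
proof (induction r arbitrary: F G)
  case 0
  then show ?case by (auto intro: continuous_intros)
next
  case (Suc r)
  have d: "((\<lambda>y. F y + G y) has_derivative (\<lambda>v. frechet_derivative F (at y) v + frechet_derivative G (at y) v)) (at y)"
    if "y \<in> U" for y
    using Suc.prems that by (auto intro!: has_derivative_add simp: frechet_derivative_works)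
  show ?case
    by (rule Cr_on_SucI[OF assms(3) d]) (use Suc in auto)
qed

lemma Cr_on_sum:
  assumes "finite I" "\<And>i. i \<in> I \<Longrightarrow> Cr_on r U (F i)" "open U"
  shows "Cr_on r U (\<lambda>y. \<Sum>i\<in>I. F i y)"
  using assms by (induction I rule: finite_induct) (auto intro: Cr_on_add)

lemma Cr_on_bilinear:
  assumes "bounded_bilinear B" "Cr_on r U F" "Cr_on r U G" "open U"
  shows "Cr_on r U (\<lambda>y. B (F y) (G y))"
  using assms(2,3)
proof (induction r arbitrary: F G)
  case 0
  then show ?case by (auto intro: bounded_bilinear.continuous_on[OF assms(1)])
next
  case (Suc r)
  let ?D = "\<lambda>y v. B (F y) (frechet_derivative G (at y) v) + B (frechet_derivative F (at y) v) (G y)"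
  have d: "((\<lambda>y. B (F y) (G y)) has_derivative ?D y) (at y)" if "y \<in> U" for y
    using Suc.prems that by (auto intro!: bounded_bilinear.FDERIV[OF assms(1)] simp: frechet_derivative_works)
  show ?case
    by (rule Cr_on_SucI[OF assms(4) d])
      (use Suc.IH Suc.prems Cr_on_Suc_imp[OF Suc.prems(1)] Cr_on_Suc_imp[OF Suc.prems(2)] assms(4)
        in \<open>auto intro!: Cr_on_add\<close>)
qed

lemma frechet_derivative_sum_Basis:
  fixes G :: "'e::euclidean_space \<Rightarrow> 'f::euclidean_space"
  assumes "G differentiable (at z)"
  shows "frechet_derivative G (at z) v = (\<Sum>b\<in>Basis. (v \<bullet> b) *\<^sub>R frechet_derivative G (at z) b)"
proof -
  have "linear (frechet_derivative G (at z))" using assms by (rule linear_frechet_derivative)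
  then have "frechet_derivative G (at z) (\<Sum>b\<in>Basis. (v \<bullet> b) *\<^sub>R b)
      = (\<Sum>b\<in>Basis. (v \<bullet> b) *\<^sub>R frechet_derivative G (at z) b)"
    by (simp add: linear_sum linear_scale)
  then show ?thesis by (simp add: euclidean_representation)
qed

text \<open>By the chain rule each directional derivative of a composition is a sum of products of lower
  order data; expanding the inner derivative in a basis keeps every factor of the form that the
  definition of \<open>Cr_on\<close> provides.\<close>

lemma Cr_on_compose:
  fixes F :: "'d::euclidean_space \<Rightarrow> 'e::euclidean_space" and G :: "'e \<Rightarrow> 'f::euclidean_space"
  assumes "open U" "open V" "F ` U \<subseteq> V" "Cr_on r U F" "Cr_on r V G"
  shows "Cr_on r U (\<lambda>y. G (F y))"
  using assms(4,5)
proof (induction r arbitrary: G)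
  case 0
  then show ?case using assms(3) continuous_on_compose2[of V G U F] by simp
next
  case (Suc r)
  let ?D = "\<lambda>y v. \<Sum>b\<in>Basis. (frechet_derivative F (at y) v \<bullet> b) *\<^sub>R frechet_derivative G (at (F y)) b"
  have d: "((\<lambda>y. G (F y)) has_derivative ?D y) (at y)" if "y \<in> U" for y
  proof -
    have FG: "F differentiable (at y)" "G differentiable (at (F y))"
      using Suc.prems that assms(3) by auto
    have "((\<lambda>y. G (F y)) has_derivative (\<lambda>v. frechet_derivative G (at (F y)) (frechet_derivative F (at y) v))) (at y)"
      using has_derivative_compose FG[unfolded frechet_derivative_works] by blast
    moreover have "(\<lambda>v. frechet_derivative G (at (F y)) (frechet_derivative F (at y) v)) = ?D y"
      by (rule ext) (rule frechet_derivative_sum_Basis[OF FG(2)])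
    ultimately show ?thesis by simp
  qed
  have "Cr_on r U (\<lambda>y. frechet_derivative G (at (F y)) b)" for b
    using Suc.IH[of "\<lambda>z. frechet_derivative G (at z) b"] Suc.prems Cr_on_Suc_imp[OF Suc.prems(1)] by simp
  then have "Cr_on r U (\<lambda>y. ?D y v)" for v
    using Suc.prems assms(1)
    by (auto intro!: Cr_on_sum Cr_on_bilinear[OF bounded_bilinear_scaleR]
        Cr_on_bounded_linear_compose[OF bounded_linear_inner_left])
  with d show ?case using Cr_on_SucI[OF assms(1), of "\<lambda>y. G (F y)" ?D r] by blast
qed

lemma Cr_on_exp:
  "Cr_on r UNIV (exp :: real \<Rightarrow> real)"
proof (induction r)
  case 0
  then show ?case by (simp add: continuous_on_exp)
next
  case (Suc r)
  have d: "((exp :: real \<Rightarrow> real) has_derivative (\<lambda>v. exp y * v)) (at y)" for y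
    by (metis DERIV_exp has_field_derivative_def)
  show ?case
    by (rule Cr_on_SucI[OF open_UNIV d], rule Cr_on_bilinear[OF bounded_bilinear_mult])
      (simp_all add: Suc)
qed

lemma C_infinity_on_cong:
  assumes "open U" "\<And>y. y \<in> U \<Longrightarrow> F y = G y"
  shows "C_infinity_on U F \<longleftrightarrow> C_infinity_on U G"
  using Cr_on_cong[OF assms] by (simp add: C_infinity_on_def)

lemma C_infinity_on_subset: "C_infinity_on U F \<Longrightarrow> V \<subseteq> U \<Longrightarrow> C_infinity_on V F"
  by (auto simp: C_infinity_on_def intro: Cr_on_subset)

lemma C_infinity_on_local:
  assumes "\<And>y. y \<in> U \<Longrightarrow> \<exists>V. open V \<and> y \<in> V \<and> C_infinity_on V F"
  shows "C_infinity_on U F"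
  using assms unfolding C_infinity_on_def by (meson Cr_on_local)

lemma C_infinity_on_differentiable:
  "C_infinity_on U F \<Longrightarrow> y \<in> U \<Longrightarrow> F differentiable (at y)"
  by (auto simp: C_infinity_on_def dest!: spec[of _ "Suc 0"])

lemma C_infinity_on_frechet_derivative:
  "C_infinity_on U F \<Longrightarrow> C_infinity_on U (\<lambda>y. frechet_derivative F (at y) v)"
  unfolding C_infinity_on_def
proof
  fix r assume "\<forall>r. Cr_on r U F"
  then have "Cr_on (Suc r) U F" ..
  then show "Cr_on r U (\<lambda>y. frechet_derivative F (at y) v)" by simp
qed

lemma C_infinity_on_compose:
  fixes F :: "'d::euclidean_space \<Rightarrow> 'e::euclidean_space" and G :: "'e \<Rightarrow> 'f::euclidean_space"
  assumes "open U" "open V" "F ` U \<subseteq> V" "C_infinity_on U F" "C_infinity_on V G"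
  shows "C_infinity_on U (\<lambda>y. G (F y))"
  using assms by (auto simp: C_infinity_on_def intro: Cr_on_compose)

lemma C_infinity_on_const [simp]: "C_infinity_on U (\<lambda>y. c)"
  by (simp add: C_infinity_on_def)

lemma C_infinity_on_add:
  "C_infinity_on U F \<Longrightarrow> C_infinity_on U G \<Longrightarrow> open U \<Longrightarrow> C_infinity_on U (\<lambda>y. F y + G y)"
  by (simp add: C_infinity_on_def Cr_on_add)

lemma C_infinity_on_mult:
  fixes F G :: "'e::euclidean_space \<Rightarrow> real"
  shows "C_infinity_on U F \<Longrightarrow> C_infinity_on U G \<Longrightarrow> open U \<Longrightarrow> C_infinity_on U (\<lambda>y. F y * G y)"
  by (simp add: C_infinity_on_def Cr_on_bilinear[OF bounded_bilinear_mult])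

lemma C_infinity_on_bounded_linear: "bounded_linear L \<Longrightarrow> C_infinity_on U L"
  by (simp add: C_infinity_on_def Cr_on_bounded_linear)

lemma C_infinity_on_exp: "C_infinity_on UNIV (exp :: real \<Rightarrow> real)"
  by (simp add: C_infinity_on_def Cr_on_exp)


section \<open>Charts and smooth functions\<close>

abbreviation chart_inv :: "('a, 'n::finite) chart \<Rightarrow> real ^ 'n \<Rightarrow> 'a" where
  "chart_inv c \<equiv> inv_into (fst c) (snd c)"

lemma is_chartD:
  assumes "is_chart c"
  shows chart_open: "open (fst c)"
    and chart_inv_coord: "\<And>q. q \<in> fst c \<Longrightarrow> chart_inv c (snd c q) = q"
    and coord_chart_inv: "\<And>z. z \<in> snd c ` fst c \<Longrightarrow> snd c (chart_inv c z) = z"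
    and chart_inv_in: "\<And>z. z \<in> snd c ` fst c \<Longrightarrow> chart_inv c z \<in> fst c"
    and chart_inv_continuous: "continuous_on (snd c ` fst c) (chart_inv c)"
proof -
  obtain U x where c: "c = (U, x)" by (cases c)
  have h: "open U" "homeomorphism U (x ` U) x (inv_into U x)"
    using assms unfolding c is_chart_def by auto
  show "open (fst c)" using h c by simp
  show "\<And>q. q \<in> fst c \<Longrightarrow> chart_inv c (snd c q) = q"
    using homeomorphism_apply1[OF h(2)] c by simp
  show "\<And>z. z \<in> snd c ` fst c \<Longrightarrow> snd c (chart_inv c z) = z"
    by (simp add: f_inv_into_f)
  show "\<And>z. z \<in> snd c ` fst c \<Longrightarrow> chart_inv c z \<in> fst c"
    by (simp add: inv_into_into)
  show "continuous_on (snd c ` fst c) (chart_inv c)" using homeomorphism_cont2[OF h(2)] c by simp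
qed

lemma chart_image_open:
  assumes "is_chart c" "open V"
  shows "open (snd c ` (fst c \<inter> V))"
proof -
  obtain U x where c: "c = (U, x)" by (cases c)
  have h: "open U" "open (x ` U)" "homeomorphism U (x ` U) x (inv_into U x)"
    using assms unfolding c is_chart_def by auto
  have "openin (top_of_set U) (U \<inter> V)" using assms(2) by auto
  then have "openin (top_of_set (x ` U)) (x ` (U \<inter> V))"
    using homeomorphism_imp_open_map[OF h(3)] by blast
  then show ?thesis using h(2) c by (simp add: openin_open_eq)
qed

lemma coord_field_eq:
  "coord_field A c i p h =
     (if smooth_near A p h then frechet_derivative (h \<circ> chart_inv c) (at (snd c p)) (axis i 1) else 0)"
  by (cases c) (simp add: coord_field_def)

lemma coord_fun_eq: "coord_fun c i = (\<lambda>p. snd c p $ i)"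
  by (cases c) (auto simp: coord_fun_def fun_eq_iff)

lemma smooth_transition_eq:
  "smooth_transition c d \<longleftrightarrow> C_infinity_on (snd c ` (fst c \<inter> fst d)) (snd d \<circ> chart_inv c)"
  by (cases c; cases d) (simp add: smooth_transition_def)

lemma smooth_fun_eq:
  "smooth_fun A W h \<longleftrightarrow> (\<forall>c\<in>A. C_infinity_on (snd c ` (fst c \<inter> W)) (h \<circ> chart_inv c))"
  by (auto simp: smooth_fun_def split_beta)

lemma smooth_curve_eq:
  "smooth_curve A I \<gamma> \<longleftrightarrow>
     continuous_on I \<gamma> \<and> (\<forall>c\<in>A. C_infinity_on (I \<inter> \<gamma> -` fst c) (snd c \<circ> \<gamma>))"
  by (auto simp: smooth_curve_def split_beta)

lemma smooth_change_chart:
  fixes c d :: "('a::topological_space, 'n::finite) chart"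
  assumes c: "is_chart c" and d: "is_chart d" and t: "smooth_transition d c"
    and V: "open V" and h: "C_infinity_on (snd c ` (fst c \<inter> V)) (h \<circ> chart_inv c)"
  shows "C_infinity_on (snd d ` (fst d \<inter> (fst c \<inter> V))) (h \<circ> chart_inv d)"
proof -
  let ?S = "snd d ` (fst d \<inter> (fst c \<inter> V))"
  have o: "open ?S" "open (snd c ` (fst c \<inter> V))"
    using c d V chart_open[OF c] by (auto intro!: chart_image_open)
  have "C_infinity_on ?S (\<lambda>z. (h \<circ> chart_inv c) ((snd c \<circ> chart_inv d) z))"
  proof (rule C_infinity_on_compose[OF o _ _ h])
    show "(snd c \<circ> chart_inv d) ` ?S \<subseteq> snd c ` (fst c \<inter> V)"
      using chart_inv_coord[OF d] by auto
    show "C_infinity_on ?S (snd c \<circ> chart_inv d)"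
      using t unfolding smooth_transition_eq by (rule C_infinity_on_subset) auto
  qed
  moreover have "(h \<circ> chart_inv c) ((snd c \<circ> chart_inv d) z) = (h \<circ> chart_inv d) z" if "z \<in> ?S" for z
    using that chart_inv_coord[OF d] chart_inv_coord[OF c] by auto
  ultimately show ?thesis using C_infinity_on_cong[OF o(1)] by metis
qed

locale smooth_manifold =
  fixes A :: "('a::{t2_space, second_countable_topology}, 'n::finite) chart set"
  assumes atlas: "smooth_atlas A"
begin

abbreviation charts :: "('a, 'n) chart set" where
  "charts \<equiv> maximal_atlas A"

lemma atlas_subset_charts: "A \<subseteq> charts"
  using atlas by (auto simp: smooth_atlas_def maximal_atlas_def)

lemma chart_exists: "\<exists>c\<in>A. p \<in> fst c"
  using atlas unfolding smooth_atlas_def by blast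

lemma charts_is_chart: "c \<in> charts \<Longrightarrow> is_chart c"
  by (simp add: maximal_atlas_def)

lemmas open_dom = chart_open[OF charts_is_chart]
lemmas inv_coord = chart_inv_coord[OF charts_is_chart]
lemmas coord_inv = coord_chart_inv[OF charts_is_chart]
lemmas inv_in = chart_inv_in[OF charts_is_chart]
lemmas open_image = chart_image_open[OF charts_is_chart]

lemma chart_at_in: "chart_at A p \<in> A" "p \<in> fst (chart_at A p)"
proof -
  have "\<exists>c. c \<in> A \<and> p \<in> fst c" using chart_exists by blast
  from someI_ex[OF this] show "chart_at A p \<in> A" "p \<in> fst (chart_at A p)" by (auto simp: chart_at_def)
qed

lemma chart_at_charts: "chart_at A p \<in> charts"
  using chart_at_in atlas_subset_charts by blast

lemma smooth_fun_chart:
  assumes "smooth_fun A W h" "open W" "c \<in> charts"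
  shows "C_infinity_on (snd c ` (fst c \<inter> W)) (h \<circ> chart_inv c)"
proof (rule C_infinity_on_local)
  fix z assume "z \<in> snd c ` (fst c \<inter> W)"
  then obtain q where q: "z = snd c q" "q \<in> fst c" "q \<in> W" by auto
  obtain d where d: "d \<in> A" "q \<in> fst d" using chart_exists by blast
  have dc: "d \<in> charts" using d(1) atlas_subset_charts by blast
  have "smooth_transition c d" using assms(3) d(1) by (simp add: maximal_atlas_def)
  then have "C_infinity_on (snd c ` (fst c \<inter> (fst d \<inter> W))) (h \<circ> chart_inv c)"
    using assms d charts_is_chart[OF dc] charts_is_chart[OF assms(3)]
    by (auto intro!: smooth_change_chart simp: smooth_fun_eq)
  moreover have "open (snd c ` (fst c \<inter> (fst d \<inter> W)))"
    using open_image[OF assms(3)] open_dom[OF dc] assms(2) by auto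
  ultimately show "\<exists>V. open V \<and> z \<in> V \<and> C_infinity_on V (h \<circ> chart_inv c)"
    using q d by blast
qed

text \<open>Slice charts of submanifolds need only belong to the maximal atlas. Since \<open>smooth_fun\<close> refers to \<open>A\<close>,
  smoothness has to be carried between the two by transition maps.\<close>

lemma smooth_funI:
  assumes "\<And>p. p \<in> W \<Longrightarrow> \<exists>c\<in>charts. \<exists>V. open V \<and> p \<in> V \<and> p \<in> fst c \<and>
      C_infinity_on (snd c ` (fst c \<inter> V)) (h \<circ> chart_inv c)"
  shows "smooth_fun A W h"
  unfolding smooth_fun_eq
proof
  fix d assume d: "d \<in> A"
  then have dc: "d \<in> charts" using atlas_subset_charts by blast
  show "C_infinity_on (snd d ` (fst d \<inter> W)) (h \<circ> chart_inv d)"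
  proof (rule C_infinity_on_local)
    fix z assume "z \<in> snd d ` (fst d \<inter> W)"
    then obtain q where q: "z = snd d q" "q \<in> fst d" "q \<in> W" by auto
    obtain c V where c: "c \<in> charts" "open V" "q \<in> V" "q \<in> fst c"
      "C_infinity_on (snd c ` (fst c \<inter> V)) (h \<circ> chart_inv c)" using assms[OF q(3)] by blast
    have "smooth_transition d c" using c d by (simp add: maximal_atlas_def)
    then have "C_infinity_on (snd d ` (fst d \<inter> (fst c \<inter> V))) (h \<circ> chart_inv d)"
      using c charts_is_chart[OF dc] charts_is_chart[OF c(1)] by (auto intro!: smooth_change_chart)
    moreover have "open (snd d ` (fst d \<inter> (fst c \<inter> V)))"
      using open_image[OF dc] open_dom[OF c(1)] c(2) by auto
    ultimately show "\<exists>V. open V \<and> z \<in> V \<and> C_infinity_on V (h \<circ> chart_inv d)"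
      using q c by blast
  qed
qed

lemma smooth_fun_subset: "smooth_fun A W h \<Longrightarrow> V \<subseteq> W \<Longrightarrow> smooth_fun A V h"
  unfolding smooth_fun_eq by (blast intro: C_infinity_on_subset)

lemma smooth_fun_cong:
  assumes "smooth_fun A W h" "open W" "\<And>q. q \<in> W \<Longrightarrow> h q = h' q"
  shows "smooth_fun A W h'"
  unfolding smooth_fun_eq
proof
  fix c assume c: "c \<in> A"
  then have cc: "c \<in> charts" using atlas_subset_charts by blast
  have "(h \<circ> chart_inv c) z = (h' \<circ> chart_inv c) z" if "z \<in> snd c ` (fst c \<inter> W)" for z
    using that assms(3) inv_coord[OF cc] by auto
  then show "C_infinity_on (snd c ` (fst c \<inter> W)) (h' \<circ> chart_inv c)"
    using C_infinity_on_cong[OF open_image[OF cc assms(2)]] assms(1) c unfolding smooth_fun_eq by blast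
qed

lemma atlas_image_open: "c \<in> A \<Longrightarrow> open W \<Longrightarrow> open (snd c ` (fst c \<inter> W))"
  using open_image atlas_subset_charts by blast

lemma smooth_fun_const: "smooth_fun A W (\<lambda>p. a)"
  by (simp add: smooth_fun_eq o_def)

lemma smooth_fun_add:
  "smooth_fun A W h \<Longrightarrow> smooth_fun A W h' \<Longrightarrow> open W \<Longrightarrow> smooth_fun A W (\<lambda>p. h p + h' p)"
  by (simp add: smooth_fun_eq o_def C_infinity_on_add atlas_image_open)

lemma smooth_fun_mult:
  "smooth_fun A W h \<Longrightarrow> smooth_fun A W h' \<Longrightarrow> open W \<Longrightarrow> smooth_fun A W (\<lambda>p. h p * h' p)"
  by (simp add: smooth_fun_eq o_def C_infinity_on_mult atlas_image_open)

lemma smooth_fun_diff: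
  "smooth_fun A W h \<Longrightarrow> smooth_fun A W h' \<Longrightarrow> open W \<Longrightarrow> smooth_fun A W (\<lambda>p. h p - h' p)"
  using smooth_fun_add[of W h "\<lambda>p. (-1) * h' p"] smooth_fun_mult[OF smooth_fun_const, of W h' "-1"] by simp

lemma smooth_fun_sum:
  "finite I \<Longrightarrow> (\<And>i. i \<in> I \<Longrightarrow> smooth_fun A W (h i)) \<Longrightarrow> open W \<Longrightarrow> smooth_fun A W (\<lambda>p. \<Sum>i\<in>I. h i p)"
  by (induction I rule: finite_induct) (auto intro: smooth_fun_add smooth_fun_const)

lemma smooth_fun_exp:
  assumes "smooth_fun A W h" "open W"
  shows "smooth_fun A W (\<lambda>p. exp (h p))"
  unfolding smooth_fun_eq
proof
  fix c assume c: "c \<in> A"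
  then have "C_infinity_on (snd c ` (fst c \<inter> W)) (h \<circ> chart_inv c)"
    using assms(1) by (simp add: smooth_fun_eq)
  then have "C_infinity_on (snd c ` (fst c \<inter> W)) (\<lambda>z. exp ((h \<circ> chart_inv c) z))"
    by (rule C_infinity_on_compose[OF atlas_image_open[OF c assms(2)] open_UNIV _ _ C_infinity_on_exp, rotated]) simp
  then show "C_infinity_on (snd c ` (fst c \<inter> W)) ((\<lambda>p. exp (h p)) \<circ> chart_inv c)"
    by (simp add: o_def)
qed

lemma smooth_fun_coord:
  assumes "c \<in> charts"
  shows "smooth_fun A (fst c) (coord_fun c i)"
proof -
  have "C_infinity_on (snd c ` (fst c \<inter> UNIV)) (coord_fun c i \<circ> chart_inv c)
      \<longleftrightarrow> C_infinity_on (snd c ` (fst c \<inter> UNIV)) (\<lambda>z. z $ i)"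
    using coord_inv[OF assms] open_image[OF assms open_UNIV]
    by (intro C_infinity_on_cong) (auto simp: coord_fun_eq)
  moreover have "C_infinity_on (snd c ` (fst c \<inter> UNIV)) (\<lambda>z. z $ i)"
    by (rule C_infinity_on_bounded_linear) (rule bounded_linear_vec_nth)
  ultimately have "C_infinity_on (snd c ` (fst c \<inter> UNIV)) (coord_fun c i \<circ> chart_inv c)" by simp
  with assms show ?thesis by (intro smooth_funI) (metis UNIV_I open_UNIV)
qed

lemma smooth_nearI: "smooth_fun A W h \<Longrightarrow> open W \<Longrightarrow> p \<in> W \<Longrightarrow> smooth_near A p h"
  unfolding smooth_near_def by blast

lemma smooth_near_coord: "c \<in> charts \<Longrightarrow> p \<in> fst c \<Longrightarrow> smooth_near A p (coord_fun c i)"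
  using smooth_nearI[OF smooth_fun_coord open_dom] by blast

lemma smooth_near_common:
  assumes "smooth_near A p h" "smooth_near A p h'"
  obtains W where "open W" "p \<in> W" "smooth_fun A W h" "smooth_fun A W h'"
proof -
  obtain V V' where "open V" "p \<in> V" "smooth_fun A V h" "open V'" "p \<in> V'" "smooth_fun A V' h'"
    using assms unfolding smooth_near_def by blast
  then show ?thesis by (intro that[of "V \<inter> V'"]) (auto intro: smooth_fun_subset)
qed

lemma smooth_near_cong_imp:
  assumes "open W" "p \<in> W" "\<And>q. q \<in> W \<Longrightarrow> h q = h' q" "smooth_near A p h"
  shows "smooth_near A p h'"
proof -
  from assms(4) obtain V where V: "open V" "p \<in> V" "smooth_fun A V h"
    unfolding smooth_near_def by blast
  have o: "open (V \<inter> W)" using V(1) assms(1) by (rule open_Int)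
  have "smooth_fun A (V \<inter> W) h" by (rule smooth_fun_subset[OF V(3)]) blast
  then have "smooth_fun A (V \<inter> W) h'" by (rule smooth_fun_cong[OF _ o]) (simp add: assms(3))
  then show ?thesis by (rule smooth_nearI[OF _ o]) (simp add: V assms)
qed

lemma smooth_near_cong:
  assumes "open W" "p \<in> W" "\<And>q. q \<in> W \<Longrightarrow> h q = h' q"
  shows "smooth_near A p h \<longleftrightarrow> smooth_near A p h'"
proof
  show "smooth_near A p h \<Longrightarrow> smooth_near A p h'"
    by (rule smooth_near_cong_imp[OF assms])
  show "smooth_near A p h' \<Longrightarrow> smooth_near A p h"
    by (rule smooth_near_cong_imp[OF assms(1,2)]) (simp_all add: assms(3))
qed

lemma smooth_near_differentiable:
  assumes "smooth_near A p h" "c \<in> charts" "p \<in> fst c"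
  shows "(h \<circ> chart_inv c) differentiable (at (snd c p))"
proof -
  obtain W where W: "open W" "p \<in> W" "smooth_fun A W h" using assms unfolding smooth_near_def by blast
  show ?thesis
    by (rule C_infinity_on_differentiable[OF smooth_fun_chart[OF W(3,1) assms(2)]]) (use W assms in auto)
qed

section \<open>Tangent vectors in coordinates\<close>

text \<open>The derivation \<open>w\<^sup>i \<partial>\<^sub>i\<close> at \<open>p\<close>, with the convention of \<open>velocity\<close> for functions that are not smooth
  near \<open>p\<close>.\<close>

definition dvec :: "('a, 'n) chart \<Rightarrow> 'a \<Rightarrow> real ^ 'n \<Rightarrow> 'a tvec" where
  "dvec c p w = (\<lambda>h. if smooth_near A p h
     then frechet_derivative (h \<circ> chart_inv c) (at (snd c p)) w else 0)"

lemma coord_field_dvec: "coord_field A c i p = dvec c p (axis i 1)"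
  by (rule ext) (simp add: coord_field_eq dvec_def)

definition cmp :: "('a, 'n) chart \<Rightarrow> 'a tvec \<Rightarrow> real ^ 'n" where
  "cmp c v = (\<chi> i. v (coord_fun c i))"

lemma dvec_add_scale:
  assumes "c \<in> charts" "p \<in> fst c"
  shows "dvec c p (a *\<^sub>R w + w') = tadd (tscale a (dvec c p w)) (dvec c p w')"
proof
  fix h
  have "linear (frechet_derivative (h \<circ> chart_inv c) (at (snd c p)))" if "smooth_near A p h"
    using smooth_near_differentiable[OF that assms] by (rule linear_frechet_derivative)
  then show "dvec c p (a *\<^sub>R w + w') h = tadd (tscale a (dvec c p w)) (dvec c p w') h"
    by (simp add: dvec_def tadd_def tscale_def linear_add linear_scale)
qed

lemma cmp_dvec:
  assumes "c \<in> charts" "p \<in> fst c"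
  shows "cmp c (dvec c p w) = w"
proof -
  have "dvec c p w (coord_fun c i) = w $ i" for i
  proof -
    have "((coord_fun c i \<circ> chart_inv c) has_derivative (\<lambda>w. w $ i)) (at (snd c p))"
    proof (rule has_derivative_transform_within_open[where s = "snd c ` (fst c \<inter> UNIV)" and f = "\<lambda>z. z $ i"])
      show "((\<lambda>z. z $ i) has_derivative (\<lambda>w. w $ i)) (at (snd c p))"
        by (rule bounded_linear_imp_has_derivative) (rule bounded_linear_vec_nth)
      show "open (snd c ` (fst c \<inter> UNIV))" by (rule open_image[OF assms(1) open_UNIV])
    qed (use assms coord_inv[OF assms(1)] in \<open>auto simp: coord_fun_eq\<close>)
    then have "frechet_derivative (coord_fun c i \<circ> chart_inv c) (at (snd c p)) = (\<lambda>w. w $ i)"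
      by (rule frechet_derivative_at[symmetric])
    then show ?thesis
      using smooth_near_coord[OF assms] by (simp add: dvec_def)
  qed
  then show ?thesis by (simp add: cmp_def vec_eq_iff)
qed

lemma curve_vimage_open:
  assumes "smooth_curve A I \<gamma>" "open I" "open W"
  shows "open (I \<inter> \<gamma> -` W)"
proof -
  have "continuous_on I \<gamma>" using assms by (simp add: smooth_curve_def)
  then have "open (\<gamma> -` W \<inter> I)" using assms continuous_on_open_vimage[of I \<gamma>] by blast
  then show ?thesis by (simp add: Int_commute)
qed

lemma smooth_along_curve_differentiable:
  assumes "smooth_curve A I \<gamma>" "open I" "t \<in> I" "smooth_near A (\<gamma> t) h"
  shows "(h \<circ> \<gamma>) differentiable (at t)"
proof -
  obtain W where W: "open W" "\<gamma> t \<in> W" "smooth_fun A W h" using assms unfolding smooth_near_def by blast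
  obtain c where c: "c \<in> A" "\<gamma> t \<in> fst c" using chart_exists by blast
  then have cc: "c \<in> charts" using atlas_subset_charts by blast
  have "C_infinity_on (I \<inter> \<gamma> -` fst c) (snd c \<circ> \<gamma>)" using assms(1) c unfolding smooth_curve_eq by blast
  then have 1: "(snd c \<circ> \<gamma>) differentiable (at t)"
    by (rule C_infinity_on_differentiable) (use assms c in auto)
  have 2: "(h \<circ> chart_inv c) differentiable (at ((snd c \<circ> \<gamma>) t))"
    using smooth_near_differentiable[OF assms(4) cc c(2)] by simp
  have "((h \<circ> chart_inv c) \<circ> (snd c \<circ> \<gamma>)) differentiable (at t)"
    using 1 2 differentiable_chain_at by blast
  then obtain D where "((h \<circ> chart_inv c) \<circ> (snd c \<circ> \<gamma>) has_derivative D) (at t)"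
    unfolding differentiable_def by blast
  then have "(h \<circ> \<gamma> has_derivative D) (at t)"
    by (rule has_derivative_transform_within_open[OF _ curve_vimage_open[OF assms(1,2) open_dom[OF cc]]])
      (use assms c inv_coord[OF cc] in auto)
  then show ?thesis unfolding differentiable_def by blast
qed

lemma smooth_along_curve_has_derivative:
  assumes "smooth_curve A I \<gamma>" "open I" "t \<in> I" "smooth_near A (\<gamma> t) h"
  shows "((\<lambda>s. h (\<gamma> s)) has_real_derivative velocity A \<gamma> t h) (at t)"
  using smooth_along_curve_differentiable[OF assms] assms(4)
  by (simp add: velocity_def o_def real_differentiable_def DERIV_deriv_iff_real_differentiable)

lemma curve_velocity:
  assumes "smooth_curve A I \<gamma>" "open I" "t \<in> I" "c \<in> charts" "\<gamma> t \<in> fst c"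
  shows "velocity A \<gamma> t = dvec c (\<gamma> t) (cmp c (velocity A \<gamma> t))"
proof
  fix h
  let ?w = "cmp c (velocity A \<gamma> t)"
  show "velocity A \<gamma> t h = dvec c (\<gamma> t) ?w h"
  proof (cases "smooth_near A (\<gamma> t) h")
    case True
    have "((\<lambda>s. snd c (\<gamma> s) $ i) has_vector_derivative ?w $ i) (at t)" for i
      using smooth_along_curve_has_derivative[OF assms(1-3) smooth_near_coord[OF assms(4,5), of i]]
      by (simp add: cmp_def coord_fun_eq has_real_derivative_iff_has_vector_derivative)
    then have "((\<lambda>s. snd c (\<gamma> s)) has_derivative (\<lambda>s. s *\<^sub>R ?w)) (at t)"
      unfolding has_vector_derivative_def
      by (subst has_derivative_componentwise_within) (auto simp: Basis_vec_def inner_axis)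
    then have 1: "((snd c \<circ> \<gamma>) has_derivative (\<lambda>s. s *\<^sub>R ?w)) (at t)" by (simp add: o_def)
    have 2: "((h \<circ> chart_inv c) has_derivative frechet_derivative (h \<circ> chart_inv c) (at (snd c (\<gamma> t)))) (at ((snd c \<circ> \<gamma>) t))"
      using smooth_near_differentiable[OF True assms(4,5)] frechet_derivative_works by auto
    let ?D = "frechet_derivative (h \<circ> chart_inv c) (at (snd c (\<gamma> t))) \<circ> (\<lambda>s. s *\<^sub>R ?w)"
    have "((h \<circ> chart_inv c) \<circ> (snd c \<circ> \<gamma>) has_derivative ?D) (at t)"
      using diff_chain_at[OF 1 2] .
    then have "(h \<circ> \<gamma> has_derivative ?D) (at t)"
      by (rule has_derivative_transform_within_open[OF _ curve_vimage_open[OF assms(1,2) open_dom[OF assms(4)]]])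
        (use assms inv_coord[OF assms(4)] in auto)
    moreover have "(h \<circ> \<gamma> has_derivative (\<lambda>s. velocity A \<gamma> t h * s)) (at t)"
      using smooth_along_curve_has_derivative[OF assms(1-3) True] by (simp add: has_field_derivative_def o_def)
    ultimately have "?D = (\<lambda>s. velocity A \<gamma> t h * s)" by (rule has_derivative_unique)
    then have "?D 1 = velocity A \<gamma> t h" by simp
    then show ?thesis using True by (simp add: dvec_def)
  qed (simp add: dvec_def velocity_def)
qed

lemma coordinate_line:
  assumes "c \<in> charts" "p \<in> fst c"
  obtains \<gamma> \<epsilon> where "\<epsilon> > 0" "smooth_curve A {-\<epsilon><..<\<epsilon>} \<gamma>" "\<gamma> ` {-\<epsilon><..<\<epsilon>} \<subseteq> fst c" "\<gamma> 0 = p"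
    "\<And>t. t \<in> {-\<epsilon><..<\<epsilon>} \<Longrightarrow> snd c (\<gamma> t) = snd c p + t *\<^sub>R w" "velocity A \<gamma> 0 = dvec c p w"
proof -
  let ?l = "\<lambda>t. snd c p + t *\<^sub>R w" and ?T = "snd c ` (fst c \<inter> UNIV)"
  define \<gamma> where "\<gamma> t = chart_inv c (?l t)" for t
  have T: "open ?T" by (rule open_image[OF assms(1) open_UNIV])
  have "open (?l -` ?T)"
    by (rule open_vimage[OF T]) (intro continuous_intros)
  moreover have "0 \<in> ?l -` ?T" using assms by simp
  ultimately obtain \<epsilon> where e0: "\<epsilon> > 0" "ball 0 \<epsilon> \<subseteq> ?l -` ?T" using openE by blast
  then have e: "\<epsilon> > 0" "\<And>t. \<bar>t\<bar> < \<epsilon> \<Longrightarrow> ?l t \<in> ?T"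
    by (auto simp: subset_iff)
  let ?I = "{-\<epsilon><..<\<epsilon>}"
  have I: "?l t \<in> snd c ` fst c" if "t \<in> ?I" for t using e(2)[of t] that by auto
  have in_dom: "\<gamma> t \<in> fst c" "snd c (\<gamma> t) = ?l t" if "t \<in> ?I" for t
    using inv_in[OF assms(1) I[OF that]] coord_inv[OF assms(1) I[OF that]] by (simp_all add: \<gamma>_def)
  have cont: "continuous_on ?I \<gamma>"
    unfolding \<gamma>_def
    by (rule continuous_on_compose2[OF chart_inv_continuous[OF charts_is_chart[OF assms(1)]]])
      (auto intro!: continuous_intros I)
  have lin: "C_infinity_on S ?l" if "open S" for S
    using that by (intro C_infinity_on_add C_infinity_on_const C_infinity_on_bounded_linear bounded_linear_scaleR_left)
  have "smooth_curve A ?I \<gamma>"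
    unfolding smooth_curve_eq
  proof (intro conjI cont ballI)
    fix d assume d: "d \<in> A"
    then have dc: "d \<in> charts" using atlas_subset_charts by blast
    have o: "open (?I \<inter> \<gamma> -` fst d)"
      using continuous_on_open_vimage[of ?I \<gamma>] cont open_dom[OF dc] by (simp add: Int_commute)
    have "C_infinity_on (?I \<inter> \<gamma> -` fst d) (\<lambda>t. (snd d \<circ> chart_inv c) (?l t))"
    proof (rule C_infinity_on_compose[OF o _ _ lin[OF o]])
      show "open (snd c ` (fst c \<inter> fst d))" by (rule open_image[OF assms(1) open_dom[OF dc]])
      show "?l ` (?I \<inter> \<gamma> -` fst d) \<subseteq> snd c ` (fst c \<inter> fst d)"
      proof (intro image_subsetI)
        fix t assume "t \<in> ?I \<inter> \<gamma> -` fst d"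
        then show "?l t \<in> snd c ` (fst c \<inter> fst d)" using in_dom[of t] by (metis IntD1 IntD2 IntI imageI vimageE)
      qed
      show "C_infinity_on (snd c ` (fst c \<inter> fst d)) (snd d \<circ> chart_inv c)"
        using assms(1) d by (simp add: maximal_atlas_def smooth_transition_eq)
    qed
    then show "C_infinity_on (?I \<inter> \<gamma> -` fst d) (snd d \<circ> \<gamma>)" by (simp add: o_def \<gamma>_def)
  qed
  moreover have g0: "\<gamma> 0 = p" using inv_coord[OF assms] by (simp add: \<gamma>_def)
  moreover have "velocity A \<gamma> 0 = dvec c p w"
  proof -
    have 0: "(0::real) \<in> ?I" using e by simp
    have "cmp c (velocity A \<gamma> 0) $ i = w $ i" for i
    proof -
      have d1: "((\<lambda>s. coord_fun c i (\<gamma> s)) has_real_derivative velocity A \<gamma> 0 (coord_fun c i)) (at 0)"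
        using smooth_along_curve_has_derivative[OF calculation(1) open_greaterThanLessThan 0]
          smooth_near_coord assms g0 by simp
      have d2: "((\<lambda>t. snd c p $ i + t * w $ i) has_real_derivative w $ i) (at 0)"
        by (auto intro!: derivative_eq_intros)
      have "((\<lambda>s. coord_fun c i (\<gamma> s)) has_real_derivative w $ i) (at 0)"
        by (rule has_field_derivative_transform_within_open[OF d2 open_greaterThanLessThan 0])
          (use in_dom in \<open>simp add: coord_fun_eq\<close>)
      then show ?thesis using DERIV_unique[OF d1] by (simp add: cmp_def)
    qed
    then have "cmp c (velocity A \<gamma> 0) = w" by (simp add: vec_eq_iff)
    then show ?thesis
      using curve_velocity[OF calculation(1) open_greaterThanLessThan 0 assms(1)] g0 assms(2) by simp
  qed
  ultimately show ?thesis using that[of \<epsilon> \<gamma>] e(1) in_dom by blast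
qed

text \<open>Coordinate lines realise every \<open>w\<^sup>i \<partial>\<^sub>i\<close> as a velocity, and by the chain rule every velocity has this
  form; so the tangent space is a copy of \<open>real ^ 'n\<close> through \<open>dvec c p\<close> and \<open>cmp c\<close>.\<close>

lemma dvec_tangent:
  assumes "c \<in> charts" "p \<in> fst c"
  shows "dvec c p w \<in> tangent A p"
proof -
  obtain \<gamma> \<epsilon> where "\<epsilon> > 0" "smooth_curve A {-\<epsilon><..<\<epsilon>} \<gamma>" "\<gamma> 0 = p" "velocity A \<gamma> 0 = dvec c p w"
    using coordinate_line[OF assms, of w] by metis
  then show ?thesis unfolding tangent_space_def
    by (auto intro!: exI[of _ \<gamma>] exI[of _ \<epsilon>])
qed

lemma tangent_dvec:
  assumes "c \<in> charts" "p \<in> fst c" "v \<in> tangent A p"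
  shows "v = dvec c p (cmp c v)"
proof -
  obtain \<gamma> \<epsilon> where g: "v = velocity A \<gamma> 0" "\<epsilon> > 0" "smooth_curve A {-\<epsilon><..<\<epsilon>} \<gamma>" "\<gamma> 0 = p"
    using assms(3) unfolding tangent_space_def by auto
  then show ?thesis
    using curve_velocity[OF g(3) open_greaterThanLessThan _ assms(1), of 0] assms(2) by simp
qed

lemma tangent_eqI:
  assumes "c \<in> charts" "p \<in> fst c" "u \<in> tangent A p" "v \<in> tangent A p" "cmp c u = cmp c v"
  shows "u = v"
  using tangent_dvec[OF assms(1-3)] tangent_dvec[OF assms(1,2,4)] assms(5) by simp

lemma cmp_tadd [simp]: "cmp c (tadd u v) = cmp c u + cmp c v"
  by (simp add: cmp_def tadd_def vec_eq_iff)

lemma cmp_tscale [simp]: "cmp c (tscale a u) = a *\<^sub>R cmp c u"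
  by (simp add: cmp_def tscale_def vec_eq_iff)

lemma cmp_tzero [simp]: "cmp c tzero = 0"
  by (simp add: cmp_def tzero_def vec_eq_iff)

lemma tangent_closed:
  assumes "u \<in> tangent A p" "v \<in> tangent A p"
  shows "tadd (tscale a u) v \<in> tangent A p"
proof -
  obtain c where "c \<in> A" "p \<in> fst c" using chart_exists by blast
  then have c: "c \<in> charts" "p \<in> fst c" using atlas_subset_charts by auto
  have "tadd (tscale a u) v = dvec c p (a *\<^sub>R cmp c u + cmp c v)"
    using dvec_add_scale[OF c] tangent_dvec[OF c assms(1)] tangent_dvec[OF c assms(2)] by metis
  then show ?thesis using dvec_tangent[OF c] by simp
qed

lemma tscale_1 [simp]: "tscale 1 u = u" by (simp add: tscale_def)
lemma tscale_0 [simp]: "tscale 0 u = tzero" by (simp add: tscale_def tzero_def)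
lemma tadd_tzero [simp]: "tadd u tzero = u" "tadd tzero u = u" by (simp_all add: tadd_def tzero_def)

lemma tangent_tadd: "u \<in> tangent A p \<Longrightarrow> v \<in> tangent A p \<Longrightarrow> tadd u v \<in> tangent A p"
  using tangent_closed[of u p v 1] by simp

lemma tangent_tzero: "tzero \<in> tangent A p"
proof -
  obtain c where "c \<in> A" "p \<in> fst c" using chart_exists by blast
  then have c: "c \<in> charts" "p \<in> fst c" using atlas_subset_charts by auto
  have "tadd (tscale (-1) (dvec c p 0)) (dvec c p 0) = tzero" by (simp add: tadd_def tscale_def tzero_def)
  then show ?thesis using tangent_closed[OF dvec_tangent[OF c] dvec_tangent[OF c]] by metis
qed

lemma tangent_tscale: "u \<in> tangent A p \<Longrightarrow> tscale a u \<in> tangent A p"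
  using tangent_closed[OF _ tangent_tzero, of u p a] by simp

text \<open>Velocities see only germs: both the derivative along the curve and smoothness near \<open>p\<close>, which decides
  between the two cases of \<open>velocity\<close>, are properties of the germ.\<close>

lemma tangent_local:
  assumes "v \<in> tangent A p" "open W" "p \<in> W" "\<And>q. q \<in> W \<Longrightarrow> h q = h' q"
  shows "v h = v h'"
proof -
  obtain \<gamma> \<epsilon> where g: "v = velocity A \<gamma> 0" "\<epsilon> > 0" "smooth_curve A {-\<epsilon><..<\<epsilon>} \<gamma>" "\<gamma> 0 = p"
    using assms(1) unfolding tangent_space_def by auto
  have near: "smooth_near A p h \<longleftrightarrow> smooth_near A p h'" by (rule smooth_near_cong[OF assms(2-4)])
  show ?thesis
  proof (cases "smooth_near A p h")
    case True
    have 0: "(0::real) \<in> {-\<epsilon><..<\<epsilon>}" using g by simp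
    have "((\<lambda>s. h (\<gamma> s)) has_real_derivative v h) (at 0)"
      using smooth_along_curve_has_derivative[OF g(3) open_greaterThanLessThan 0] True g by simp
    then have 1: "((\<lambda>s. h' (\<gamma> s)) has_real_derivative v h) (at 0)"
      by (rule has_field_derivative_transform_within_open[OF _ curve_vimage_open[OF g(3) open_greaterThanLessThan assms(2)]])
        (use g assms in auto)
    have "((\<lambda>s. h' (\<gamma> s)) has_real_derivative v h') (at 0)"
      using smooth_along_curve_has_derivative[OF g(3) open_greaterThanLessThan 0] True near g by simp
    then show ?thesis using DERIV_unique 1 by blast
  next
    case False
    then show ?thesis using g near by (simp add: velocity_def)
  qed
qed

lemma tangent_derivation:
  assumes "v \<in> tangent A p" "smooth_near A p h" "smooth_near A p h'"
  shows tangent_fun_add: "v (\<lambda>q. h q + h' q) = v h + v h'"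
    and tangent_fun_mult: "v (\<lambda>q. h q * h' q) = v h * h' p + h p * v h'"
proof -
  obtain \<gamma> \<epsilon> where g: "v = velocity A \<gamma> 0" "\<epsilon> > 0" "smooth_curve A {-\<epsilon><..<\<epsilon>} \<gamma>" "\<gamma> 0 = p"
    using assms(1) unfolding tangent_space_def by auto
  have 0: "(0::real) \<in> {-\<epsilon><..<\<epsilon>}" using g by simp
  have D: "((\<lambda>s. k (\<gamma> s)) has_real_derivative v k) (at 0)" if "smooth_near A p k" for k
    using smooth_along_curve_has_derivative[OF g(3) open_greaterThanLessThan 0] that g by simp
  obtain W where W: "open W" "p \<in> W" "smooth_fun A W h" "smooth_fun A W h'"
    using smooth_near_common[OF assms(2,3)] by blast
  have "smooth_near A p (\<lambda>q. h q + h' q)" "smooth_near A p (\<lambda>q. h q * h' q)"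
    using W by (auto intro!: smooth_nearI[OF _ W(1,2)] smooth_fun_add smooth_fun_mult)
  note S = this[THEN D]
  show "v (\<lambda>q. h q + h' q) = v h + v h'"
    using DERIV_unique[OF S(1) DERIV_add[OF D[OF assms(2)] D[OF assms(3)]]] .
  show "v (\<lambda>q. h q * h' q) = v h * h' p + h p * v h'"
    using DERIV_unique[OF S(2) DERIV_mult[OF D[OF assms(2)] D[OF assms(3)]]] g by (simp add: mult.commute)
qed

lemma tangent_fun_const:
  assumes "v \<in> tangent A p"
  shows "v (\<lambda>q. a) = 0"
proof -
  obtain \<gamma> \<epsilon> where g: "v = velocity A \<gamma> 0" using assms(1) unfolding tangent_space_def by auto
  show ?thesis by (simp add: g velocity_def o_def)
qed

end


section \<open>Vector fields in coordinates\<close>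

lemma vec_axis_expand: "w = (\<Sum>i\<in>UNIV. (w $ i) *\<^sub>R axis i (1::real))"
  by (simp add: vec_eq_iff axis_def if_distrib[of "\<lambda>x. _ * x"] cong: if_cong)

context smooth_manifold
begin

lemma tangent_expand:
  assumes "c \<in> charts" "p \<in> fst c" "v \<in> tangent A p"
  shows "v h = (\<Sum>i\<in>UNIV. v (coord_fun c i) * coord_field A c i p h)"
proof (cases "smooth_near A p h")
  case True
  let ?L = "frechet_derivative (h \<circ> chart_inv c) (at (snd c p))"
  have L: "linear ?L" using smooth_near_differentiable[OF True assms(1,2)] by (rule linear_frechet_derivative)
  have "v h = ?L (cmp c v)" using fun_cong[OF tangent_dvec[OF assms]] True by (simp add: dvec_def)
  also have "cmp c v = (\<Sum>i\<in>UNIV. v (coord_fun c i) *\<^sub>R axis i 1)"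
    by (subst vec_axis_expand) (simp add: cmp_def)
  also have "?L \<dots> = (\<Sum>i\<in>UNIV. v (coord_fun c i) * ?L (axis i 1))"
    by (simp add: linear_sum[OF L] linear_scale[OF L])
  finally show ?thesis using True by (simp add: coord_field_eq)
next
  case False
  then show ?thesis using fun_cong[OF tangent_dvec[OF assms], of h] by (simp add: dvec_def coord_field_eq)
qed

lemma coord_field_coord:
  assumes "c \<in> charts" "p \<in> fst c"
  shows "coord_field A c i p (coord_fun c j) = (if i = j then 1 else 0)"
  using arg_cong[OF cmp_dvec[OF assms, of "axis i 1"], of "\<lambda>w. w $ j"]
  by (simp add: coord_field_dvec cmp_def axis_def)

lemma coord_field_tangent: "c \<in> charts \<Longrightarrow> p \<in> fst c \<Longrightarrow> coord_field A c i p \<in> tangent A p"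
  by (simp add: coord_field_dvec dvec_tangent)

lemma cmp_coord_field: "c \<in> charts \<Longrightarrow> p \<in> fst c \<Longrightarrow> cmp c (coord_field A c i p) = axis i 1"
  by (simp add: coord_field_dvec cmp_dvec)

lemma smooth_vfield_tangent: "smooth_vfield A W X \<Longrightarrow> p \<in> W \<Longrightarrow> X p \<in> tangent A p"
  by (simp add: smooth_vfield_def)

lemma smooth_vfield_fun:
  "smooth_vfield A W X \<Longrightarrow> open V \<Longrightarrow> V \<subseteq> W \<Longrightarrow> smooth_fun A V h \<Longrightarrow> smooth_fun A V (\<lambda>p. X p h)"
  by (simp add: smooth_vfield_def)

lemma smooth_vfield_subset: "smooth_vfield A W X \<Longrightarrow> V \<subseteq> W \<Longrightarrow> smooth_vfield A V X"
  unfolding smooth_vfield_def by (meson subset_iff subset_trans)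

lemma smooth_vfield_cong:
  assumes X: "smooth_vfield A W X" and eq: "\<And>q. q \<in> W \<Longrightarrow> X q = X' q"
  shows "smooth_vfield A W X'"
  unfolding smooth_vfield_def
proof (intro conjI ballI allI impI)
  fix p assume "p \<in> W"
  then show "X' p \<in> tangent A p" using smooth_vfield_tangent[OF X] eq by metis
next
  fix V h assume V: "open V \<and> V \<subseteq> W \<and> smooth_fun A V h"
  then have "smooth_fun A V (\<lambda>p. X p h)" using smooth_vfield_fun[OF X] by blast
  then show "smooth_fun A V (\<lambda>p. X' p h)"
    by (rule smooth_fun_cong) (use V eq in \<open>auto simp: subset_iff\<close>)
qed

lemma smooth_vfield_coord_field:
  assumes c: "c \<in> charts"
  shows "smooth_vfield A (fst c) (coord_field A c i)"
  unfolding smooth_vfield_def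
proof (intro conjI ballI allI impI)
  fix p assume "p \<in> fst c"
  then show "coord_field A c i p \<in> tangent A p" by (rule coord_field_tangent[OF c])
next
  fix V h assume V: "open V \<and> V \<subseteq> fst c \<and> smooth_fun A V h"
  let ?S = "snd c ` (fst c \<inter> V)"
  have "C_infinity_on ?S (\<lambda>z. frechet_derivative (h \<circ> chart_inv c) (at z) (axis i 1))"
    using V smooth_fun_chart[OF _ _ c] by (intro C_infinity_on_frechet_derivative) blast
  moreover have "frechet_derivative (h \<circ> chart_inv c) (at z) (axis i 1) = ((\<lambda>p. coord_field A c i p h) \<circ> chart_inv c) z"
    if "z \<in> ?S" for z
    using that V inv_coord[OF c] smooth_nearI[of V h] by (auto simp: coord_field_eq)
  ultimately have "C_infinity_on ?S ((\<lambda>p. coord_field A c i p h) \<circ> chart_inv c)"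
    using C_infinity_on_cong[OF open_image[OF c], of V "\<lambda>z. frechet_derivative (h \<circ> chart_inv c) (at z) (axis i 1)"
      "(\<lambda>p. coord_field A c i p h) \<circ> chart_inv c"] V by simp
  then show "smooth_fun A V (\<lambda>p. coord_field A c i p h)"
    using c V by (intro smooth_funI) blast
qed

lemma smooth_vfield_add:
  assumes "smooth_vfield A W X" "smooth_vfield A W Y"
  shows "smooth_vfield A W (vf_add X Y)"
  unfolding smooth_vfield_def
proof (intro conjI ballI allI impI)
  fix p assume "p \<in> W"
  then show "vf_add X Y p \<in> tangent A p"
    using smooth_vfield_tangent assms by (auto simp: vf_add_def intro: tangent_tadd)
next
  fix V h assume "open V \<and> V \<subseteq> W \<and> smooth_fun A V h"
  then show "smooth_fun A V (\<lambda>p. vf_add X Y p h)"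
    using smooth_fun_add[OF smooth_vfield_fun[OF assms(1)] smooth_vfield_fun[OF assms(2)], of V h h]
    by (simp add: vf_add_def tadd_def)
qed

lemma smooth_vfield_scale:
  assumes "smooth_vfield A W X" "smooth_fun A W a"
  shows "smooth_vfield A W (vf_scale a X)"
  unfolding smooth_vfield_def
proof (intro conjI ballI allI impI)
  fix p assume "p \<in> W"
  then show "vf_scale a X p \<in> tangent A p"
    using smooth_vfield_tangent assms by (auto simp: vf_scale_def intro: tangent_tscale)
next
  fix V h assume V: "open V \<and> V \<subseteq> W \<and> smooth_fun A V h"
  then show "smooth_fun A V (\<lambda>p. vf_scale a X p h)"
    using smooth_fun_mult[OF smooth_fun_subset[OF assms(2)] smooth_vfield_fun[OF assms(1)], of V h]
    by (simp add: vf_scale_def tscale_def)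
qed

definition vf_sum :: "'i set \<Rightarrow> ('i \<Rightarrow> 'a \<Rightarrow> real) \<Rightarrow> ('i \<Rightarrow> 'a vfield) \<Rightarrow> 'a vfield" where
  "vf_sum I a X = (\<lambda>p h. \<Sum>i\<in>I. a i p * X i p h)"

lemma vf_sum_empty: "vf_sum {} a X = (\<lambda>p. tzero)"
  by (simp add: vf_sum_def tzero_def)

lemma vf_sum_insert:
  "finite I \<Longrightarrow> i \<notin> I \<Longrightarrow> vf_sum (insert i I) a X = vf_add (vf_scale (a i) (X i)) (vf_sum I a X)"
  by (simp add: vf_sum_def vf_add_def vf_scale_def tadd_def tscale_def fun_eq_iff)

lemma smooth_vfield_tzero: "smooth_vfield A W (\<lambda>p. tzero)"
  unfolding smooth_vfield_def using tangent_tzero smooth_fun_const[of _ 0] by (simp add: tzero_def)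

lemma smooth_vfield_sum:
  assumes "finite I" "\<And>i. i \<in> I \<Longrightarrow> smooth_fun A W (a i)" "\<And>i. i \<in> I \<Longrightarrow> smooth_vfield A W (X i)"
  shows "smooth_vfield A W (vf_sum I a X)"
  using assms
  by (induction I rule: finite_induct)
    (simp_all add: vf_sum_empty vf_sum_insert smooth_vfield_tzero smooth_vfield_add smooth_vfield_scale)

text \<open>Tangent vectors act on germs of functions, and therefore so does the bracket.\<close>

lemma lie_bracket_local:
  assumes "open W" "p \<in> W" "\<And>q. q \<in> W \<Longrightarrow> X q = X' q" "\<And>q. q \<in> W \<Longrightarrow> Y q = Y' q"
    "X p \<in> tangent A p" "Y p \<in> tangent A p"
  shows "lie_bracket A X Y p = lie_bracket A X' Y' p"
proof
  fix h
  have "X p (\<lambda>q. Y q h) = X p (\<lambda>q. Y' q h)" "Y p (\<lambda>q. X q h) = Y p (\<lambda>q. X' q h)"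
    using tangent_local[OF assms(5,1,2), of "\<lambda>q. Y q h" "\<lambda>q. Y' q h"]
      tangent_local[OF assms(6,1,2), of "\<lambda>q. X q h" "\<lambda>q. X' q h"] assms(3,4) by auto
  then show "lie_bracket A X Y p h = lie_bracket A X' Y' p h"
    using assms(2-4) by (simp add: lie_bracket_def)
qed

end

section \<open>The Levi-Civita connection in coordinates\<close>

text \<open>A Lorentzian scalar product in coordinates. The pseudo-orthonormal basis is an argument, because traces
  are computed as sums over it.\<close>

definition lorentz_form :: "(real ^ 'n \<Rightarrow> real ^ 'n \<Rightarrow> real) \<Rightarrow> ('n::finite \<Rightarrow> real ^ 'n) \<Rightarrow> 'n \<Rightarrow> bool" where
  "lorentz_form G e i0 \<longleftrightarrow> bilinear G \<and> (\<forall>u v. G u v = G v u) \<and>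
     (\<forall>v. \<exists>a. v = (\<Sum>i\<in>UNIV. a i *\<^sub>R e i)) \<and>
     (\<forall>i j. G (e i) (e j) = (if i \<noteq> j then 0 else if i = i0 then -1 else 1))"

lemma bilinear_sum_left:
  assumes "bilinear G" shows "G (\<Sum>i\<in>I. a i *\<^sub>R e i) w = (\<Sum>i\<in>I. a i * G (e i) w)"
proof -
  have L: "linear (\<lambda>u. G u w)" using assms by (simp add: bilinear_def)
  show ?thesis using linear_sum[OF L, of "\<lambda>i. a i *\<^sub>R e i" I] linear_scale[OF L] by simp
qed

lemma bilinear_sum_right:
  assumes "bilinear G" shows "G w (\<Sum>i\<in>I. a i *\<^sub>R e i) = (\<Sum>i\<in>I. a i * G w (e i))"
proof -
  have L: "linear (G w)" using assms by (simp add: bilinear_def)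
  show ?thesis using linear_sum[OF L, of "\<lambda>i. a i *\<^sub>R e i" I] linear_scale[OF L] by simp
qed

lemma lorentz_form_expand:
  assumes "lorentz_form G e i0"
  shows "v = (\<Sum>i\<in>UNIV. (G (e i) (e i) * G v (e i)) *\<^sub>R e i)"
proof -
  have G: "bilinear G" and \<eta>: "\<And>i j. G (e i) (e j) = (if i \<noteq> j then 0 else if i = i0 then -1 else 1)"
    using assms unfolding lorentz_form_def by auto
  obtain a where a: "v = (\<Sum>i\<in>UNIV. a i *\<^sub>R e i)" using assms unfolding lorentz_form_def by blast
  have "G v (e j) = a j * G (e j) (e j)" for j
  proof -
    have "G v (e j) = (\<Sum>i\<in>UNIV. a i * G (e i) (e j))" unfolding a by (rule bilinear_sum_left[OF G])
    also have "\<dots> = (\<Sum>i\<in>UNIV. if i = j then a j * G (e j) (e j) else 0)"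
      by (rule sum.cong) (auto simp: \<eta>)
    finally show ?thesis by simp
  qed
  then have "G (e i) (e i) * G v (e i) = a i" for i by (simp add: \<eta>)
  then show ?thesis using a by simp
qed

lemma lorentz_form_nondegenerate:
  assumes "lorentz_form G e i0" "\<And>w. G v w = 0"
  shows "v = 0"
  using lorentz_form_expand[OF assms(1), of v] assms(2) by simp

locale lorentzian_manifold = smooth_manifold A
  for A :: "('a::{t2_space, second_countable_topology}, 'n::finite) chart set" +
  fixes g :: "'a \<Rightarrow> 'a tvec \<Rightarrow> 'a tvec \<Rightarrow> real"
    and nabla :: "'a vfield \<Rightarrow> 'a vfield \<Rightarrow> 'a vfield"
  assumes metric: "lorentzian_metric A g"
    and levi_civita: "levi_civita A g nabla"
begin

lemma g_linear:
  assumes "u \<in> tangent A p" "v \<in> tangent A p" "w \<in> tangent A p"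
  shows g_linear_left: "g p (tadd (tscale a u) v) w = a * g p u w + g p v w"
    and g_linear_right: "g p w (tadd (tscale a u) v) = a * g p w u + g p w v"
  using metric assms unfolding lorentzian_metric_def smooth_tensor2_def bilinear_at_def by blast+

lemma g_sym: "u \<in> tangent A p \<Longrightarrow> v \<in> tangent A p \<Longrightarrow> g p u v = g p v u"
  using metric unfolding lorentzian_metric_def by blast

lemma g_tzero: "w \<in> tangent A p \<Longrightarrow> g p tzero w = 0"
  using g_linear_left[OF tangent_tzero tangent_tzero, of w p 1] by simp

lemma g_tadd:
  "u \<in> tangent A p \<Longrightarrow> v \<in> tangent A p \<Longrightarrow> w \<in> tangent A p \<Longrightarrow> g p (tadd u v) w = g p u w + g p v w"
  using g_linear_left[of u p v w 1] by simp

lemma g_tscale: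
  "u \<in> tangent A p \<Longrightarrow> w \<in> tangent A p \<Longrightarrow> g p (tscale a u) w = a * g p u w"
  using g_linear_left[OF _ tangent_tzero, of u p w a] g_tzero by simp

lemma g_tadd_right:
  "u \<in> tangent A p \<Longrightarrow> v \<in> tangent A p \<Longrightarrow> w \<in> tangent A p \<Longrightarrow> g p w (tadd u v) = g p w u + g p w v"
  using g_linear_right[of u p v w 1] by simp

lemma g_tscale_right:
  "u \<in> tangent A p \<Longrightarrow> w \<in> tangent A p \<Longrightarrow> g p w (tscale a u) = a * g p w u"
  using g_sym[OF tangent_tscale, of u p w a] g_sym[of u p w] g_tscale by simp

lemma g_smooth:
  "open W \<Longrightarrow> smooth_vfield A W X \<Longrightarrow> smooth_vfield A W Y \<Longrightarrow> smooth_fun A W (\<lambda>p. g p (X p) (Y p))"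
  using metric unfolding lorentzian_metric_def smooth_tensor2_def by blast

definition gram :: "('a, 'n) chart \<Rightarrow> 'a \<Rightarrow> real ^ 'n \<Rightarrow> real ^ 'n \<Rightarrow> real" where
  "gram c p u w = g p (dvec c p u) (dvec c p w)"

lemma g_gram:
  assumes "c \<in> charts" "p \<in> fst c" "u \<in> tangent A p" "v \<in> tangent A p"
  shows "g p u v = gram c p (cmp c u) (cmp c v)"
  using tangent_dvec[OF assms(1,2)] assms(3,4) unfolding gram_def by metis

lemma dvec_scale_add:
  assumes "c \<in> charts" "p \<in> fst c"
  shows "dvec c p (w + w') = tadd (dvec c p w) (dvec c p w')" "dvec c p (a *\<^sub>R w) = tscale a (dvec c p w)"
    "dvec c p 0 = tzero"
proof -
  show 1: "dvec c p (w + w') = tadd (dvec c p w) (dvec c p w')" for w w'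
    using dvec_add_scale[OF assms, of 1 w w'] by simp
  show 0: "dvec c p 0 = tzero"
    using 1[of 0 0] by (auto simp: tadd_def tzero_def fun_eq_iff)
  show "dvec c p (a *\<^sub>R w) = tscale a (dvec c p w)"
    using dvec_add_scale[OF assms, of a w 0] 0 by simp
qed

lemma gram_bilinear:
  assumes "c \<in> charts" "p \<in> fst c"
  shows "bilinear (gram c p)"
proof -
  have T: "dvec c p u \<in> tangent A p" for u by (rule dvec_tangent[OF assms])
  show ?thesis
    unfolding bilinear_def gram_def
    using g_tadd[OF T T T] g_tscale[OF T T] g_tadd_right[OF T T T] g_tscale_right[OF T T]
    by (intro conjI allI linearI) (simp_all add: dvec_scale_add[OF assms])
qed

lemma gram_lorentz:
  assumes "c \<in> charts" "p \<in> fst c"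
  obtains e i0 where "lorentz_form (gram c p) e i0"
proof -
  have T: "dvec c p u \<in> tangent A p" for u by (rule dvec_tangent[OF assms])
  have "\<exists>b :: 'n \<Rightarrow> 'a tvec. \<exists>i0. (\<forall>i. b i \<in> tangent A p) \<and>
      (\<forall>v\<in>tangent A p. \<exists>a. v = (\<lambda>h. \<Sum>i\<in>UNIV. a i * b i h)) \<and>
      (\<forall>i j. g p (b i) (b j) = (if i \<noteq> j then 0 else if i = i0 then -1 else 1))"
    using metric unfolding lorentzian_metric_def by (elim conjE allE[of _ p])
  then obtain b :: "'n \<Rightarrow> 'a tvec" and i0 where b': "\<forall>i. b i \<in> tangent A p"
    "\<forall>v\<in>tangent A p. \<exists>a. v = (\<lambda>h. \<Sum>i\<in>UNIV. a i * b i h)"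
    "\<forall>i j. g p (b i) (b j) = (if i \<noteq> j then 0 else if i = i0 then -1 else 1)"
    by (elim exE conjE)
  note b = spec[OF b'(1)] bspec[OF b'(2)] spec[OF spec[OF b'(3)]]
  let ?e = "\<lambda>i. cmp c (b i)"
  have "\<exists>a. v = (\<Sum>i\<in>UNIV. a i *\<^sub>R ?e i)" for v
  proof -
    obtain a where a: "dvec c p v = (\<lambda>h. \<Sum>i\<in>UNIV. a i * b i h)" using b(2)[OF T] by blast
    have "cmp c (dvec c p v) = (\<Sum>i\<in>UNIV. a i *\<^sub>R ?e i)"
      by (simp add: a cmp_def vec_eq_iff)
    then show ?thesis using cmp_dvec[OF assms] by metis
  qed
  moreover have "gram c p (?e i) (?e j) = (if i \<noteq> j then 0 else if i = i0 then -1 else 1)" for i j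
    using g_gram[OF assms b(1) b(1)] b(3) by metis
  moreover have "gram c p u v = gram c p v u" for u v
    using g_sym[OF T T] by (simp add: gram_def)
  ultimately have "lorentz_form (gram c p) ?e i0"
    using gram_bilinear[OF assms] unfolding lorentz_form_def by blast
  then show ?thesis by (rule that)
qed

lemma g_nondegenerate:
  assumes "c \<in> charts" "p \<in> fst c" "u \<in> tangent A p" "v \<in> tangent A p"
    "\<And>i. g p u (coord_field A c i p) = g p v (coord_field A c i p)"
  shows "u = v"
proof -
  obtain e i0 where L: "lorentz_form (gram c p) e i0" using gram_lorentz[OF assms(1,2)] .
  have B: "bilinear (gram c p)" by (rule gram_bilinear[OF assms(1,2)])
  have "gram c p (cmp c u - cmp c v) w = 0" for w
  proof -
    have ax: "gram c p (cmp c u - cmp c v) (axis i 1) = 0" for i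
      using assms(5)[of i] g_gram[OF assms(1,2,3) coord_field_tangent[OF assms(1,2)]]
        g_gram[OF assms(1,2,4) coord_field_tangent[OF assms(1,2)]]
      by (simp add: cmp_coord_field[OF assms(1,2)] bilinear_lsub[OF B])
    have "gram c p (cmp c u - cmp c v) w = gram c p (cmp c u - cmp c v) (\<Sum>i\<in>UNIV. (w $ i) *\<^sub>R axis i 1)"
      by (rule arg_cong[OF vec_axis_expand])
    then show ?thesis using bilinear_sum_right[OF B, of _ "\<lambda>i. w $ i" "\<lambda>i. axis i 1" UNIV] ax by simp
  qed
  then have "cmp c u - cmp c v = 0" by (rule lorentz_form_nondegenerate[OF L])
  then show ?thesis using tangent_eqI[OF assms(1-4)] by simp
qed

lemma nabla_smooth:
  assumes "open W" "smooth_vfield A W X" "smooth_vfield A W Y"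
  shows "smooth_vfield A W (nabla X Y)"
  using levi_civita assms smooth_fun_const[of W 0] unfolding levi_civita_def affine_connection_def by blast

lemma nabla_tangent:
  "open W \<Longrightarrow> smooth_vfield A W X \<Longrightarrow> smooth_vfield A W Y \<Longrightarrow> p \<in> W \<Longrightarrow> nabla X Y p \<in> tangent A p"
  using nabla_smooth smooth_vfield_tangent by blast

lemma nabla_rules:
  assumes "open W" "smooth_vfield A W X" "smooth_vfield A W X'" "smooth_vfield A W Y" "smooth_vfield A W Y'"
    "smooth_fun A W h" "p \<in> W"
  shows nabla_left: "nabla (vf_add (vf_scale h X) X') Y p = tadd (tscale (h p) (nabla X Y p)) (nabla X' Y p)"
    and nabla_add: "nabla X (vf_add Y Y') p = tadd (nabla X Y p) (nabla X Y' p)"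
    and nabla_scale: "nabla X (vf_scale h Y) p = tadd (tscale (X p h) (Y p)) (tscale (h p) (nabla X Y p))"
  using levi_civita assms unfolding levi_civita_def affine_connection_def by blast+

lemma nabla_torsion:
  assumes "open W" "smooth_vfield A W X" "smooth_vfield A W Y" "p \<in> W"
  shows "tadd (nabla X Y p) (tscale (-1) (nabla Y X p)) = lie_bracket A X Y p"
  using levi_civita assms unfolding levi_civita_def by blast

lemma nabla_metric:
  assumes "open W" "smooth_vfield A W X" "smooth_vfield A W Y" "smooth_vfield A W Z" "p \<in> W"
  shows "X p (\<lambda>q. g q (Y q) (Z q)) = g p (nabla X Y p) (Z p) + g p (Y p) (nabla X Z p)"
  using levi_civita assms unfolding levi_civita_def by blast

lemma lie_bracket_tangent:
  assumes "open W" "smooth_vfield A W X" "smooth_vfield A W Y" "p \<in> W"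
  shows "lie_bracket A X Y p \<in> tangent A p"
  unfolding nabla_torsion[OF assms, symmetric]
  using nabla_tangent[OF assms] nabla_tangent[OF assms(1,3,2,4)] by (intro tangent_tadd tangent_tscale)

lemma lie_bracket_smooth:
  assumes "open W" "smooth_vfield A W X" "smooth_vfield A W Y"
  shows "smooth_vfield A W (lie_bracket A X Y)"
proof (rule smooth_vfield_cong)
  show "smooth_vfield A W (vf_add (nabla X Y) (vf_scale (\<lambda>q. -1) (nabla Y X)))"
    by (intro smooth_vfield_add smooth_vfield_scale nabla_smooth assms smooth_fun_const)
qed (use nabla_torsion[OF assms] in \<open>simp add: vf_add_def vf_scale_def\<close>)

lemma cmp_lie_bracket:
  assumes "open W" "smooth_vfield A W X" "smooth_vfield A W Y" "p \<in> W" "c \<in> charts" "p \<in> fst c"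
  shows "lie_bracket A X Y p (coord_fun c m) = X p (\<lambda>q. Y q (coord_fun c m)) - Y p (\<lambda>q. X q (coord_fun c m))"
  using smooth_near_coord[OF assms(5,6)] by (simp add: lie_bracket_def)

lemma koszul:
  assumes W: "open W" "smooth_vfield A W X" "smooth_vfield A W Y" "smooth_vfield A W Z" "p \<in> W"
  shows "2 * g p (nabla X Y p) (Z p) = X p (\<lambda>q. g q (Y q) (Z q)) + Y p (\<lambda>q. g q (X q) (Z q))
     - Z p (\<lambda>q. g q (X q) (Y q)) + g p (lie_bracket A X Y p) (Z p)
     - g p (lie_bracket A X Z p) (Y p) - g p (lie_bracket A Y Z p) (X p)"
proof -
  note T = nabla_tangent[OF W(1)] smooth_vfield_tangent W
  have t: "g p (lie_bracket A U V p) S = g p (nabla U V p) S - g p (nabla V U p) S"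
    if "smooth_vfield A W U" "smooth_vfield A W V" "S \<in> tangent A p" for U V S
    using nabla_torsion[OF W(1) that(1,2) W(5)] that nabla_tangent[OF W(1) that(1,2) W(5)]
      nabla_tangent[OF W(1) that(2,1) W(5)] g_tadd[OF _ tangent_tscale] g_tscale by (metis mult_minus1 add_uminus_conv_diff)
  have s: "g p (U p) (nabla V S p) = g p (nabla V S p) (U p)"
    if "smooth_vfield A W U" "smooth_vfield A W V" "smooth_vfield A W S" for U V S
    by (rule g_sym) (use T that in auto)
  have "X p \<in> tangent A p" "Y p \<in> tangent A p" "Z p \<in> tangent A p" using T by auto
  then show ?thesis
    using t[OF W(2,3)] t[OF W(2,4)] t[OF W(3,4)] s W
      nabla_metric[OF W(1,2,3,4,5)] nabla_metric[OF W(1,3,2,4,5)] nabla_metric[OF W(1,4,2,3,5)]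
    by simp
qed

text \<open>The right-hand side of the Koszul formula involves only germs, so the connection is a local operator
  although its axioms speak of fields on the whole manifold.\<close>

lemma nabla_local:
  assumes "open W" "smooth_vfield A W X" "smooth_vfield A W Y" "p \<in> W"
    "\<And>q. q \<in> W \<Longrightarrow> X q = X' q" "\<And>q. q \<in> W \<Longrightarrow> Y q = Y' q"
  shows "nabla X Y p = nabla X' Y' p"
proof -
  obtain c where "c \<in> A" "p \<in> fst c" using chart_exists by blast
  then have c: "c \<in> charts" "p \<in> fst c" using atlas_subset_charts by auto
  let ?W = "W \<inter> fst c"
  have o: "open ?W" "p \<in> ?W" using assms(4) c(2) open_Int[OF assms(1) open_dom[OF c(1)]] by auto
  have X: "smooth_vfield A ?W X" and Y: "smooth_vfield A ?W Y"
    using assms(2,3) by (blast intro: smooth_vfield_subset)+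
  have X': "smooth_vfield A ?W X'" and Y': "smooth_vfield A ?W Y'"
    using smooth_vfield_cong[OF X] smooth_vfield_cong[OF Y] assms(5,6) by auto
  show ?thesis
  proof (rule g_nondegenerate[OF c])
    show "nabla X Y p \<in> tangent A p" "nabla X' Y' p \<in> tangent A p"
      using nabla_tangent o X Y X' Y' by auto
    fix i
    let ?Z = "coord_field A c i"
    have Z: "smooth_vfield A ?W ?Z" using smooth_vfield_coord_field[OF c(1)] by (rule smooth_vfield_subset) auto
    have T: "X p \<in> tangent A p" "Y p \<in> tangent A p" "?Z p \<in> tangent A p"
      using smooth_vfield_tangent X Y Z o by auto
    have eq: "X p = X' p" "Y p = Y' p" using assms by auto
    have br: "lie_bracket A X Y p = lie_bracket A X' Y' p"
      "lie_bracket A X ?Z p = lie_bracket A X' ?Z p" "lie_bracket A Y ?Z p = lie_bracket A Y' ?Z p"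
      by (rule lie_bracket_local[OF o]; use assms(5,6) T in simp)+
    have df: "X p (\<lambda>q. g q (Y q) (?Z q)) = X p (\<lambda>q. g q (Y' q) (?Z q))"
      "Y p (\<lambda>q. g q (X q) (?Z q)) = Y p (\<lambda>q. g q (X' q) (?Z q))"
      "?Z p (\<lambda>q. g q (X q) (Y q)) = ?Z p (\<lambda>q. g q (X' q) (Y' q))"
      using tangent_local[OF T(1) o, of "\<lambda>q. g q (Y q) (?Z q)"] tangent_local[OF T(2) o, of "\<lambda>q. g q (X q) (?Z q)"]
        tangent_local[OF T(3) o, of "\<lambda>q. g q (X q) (Y q)"] assms(5,6) by auto
    have "2 * g p (nabla X Y p) (?Z p) = 2 * g p (nabla X' Y' p) (?Z p)"
      unfolding koszul[OF o(1) X Y Z o(2)] koszul[OF o(1) X' Y' Z o(2)] br df unfolding eq ..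
    then show "g p (nabla X Y p) (?Z p) = g p (nabla X' Y' p) (?Z p)" by simp
  qed
qed

lemma nabla_tzero_right:
  assumes "open W" "smooth_vfield A W X" "p \<in> W"
  shows "nabla X (\<lambda>q. tzero) p = tzero"
proof -
  have z: "(\<lambda>q. tzero) = vf_scale (\<lambda>q. 0) X" by (simp add: vf_scale_def)
  have "nabla X (vf_scale (\<lambda>q. 0) X) p = tadd (tscale (X p (\<lambda>q. 0)) (X p)) (tscale 0 (nabla X X p))"
    by (rule nabla_scale[OF assms(1,2,2,2,2) smooth_fun_const assms(3)])
  then show ?thesis unfolding z
    using tangent_fun_const[OF smooth_vfield_tangent[OF assms(2,3)]] by simp
qed

lemma nabla_tzero_left:
  assumes "open W" "smooth_vfield A W X" "p \<in> W"
  shows "nabla (\<lambda>q. tzero) X p = tzero"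
proof -
  have z: "vf_add (vf_scale (\<lambda>q. -1) X) X = (\<lambda>q. tzero)"
    by (simp add: vf_add_def vf_scale_def tadd_def tscale_def tzero_def)
  have "nabla (vf_add (vf_scale (\<lambda>q. -1) X) X) X p = tadd (tscale (-1) (nabla X X p)) (nabla X X p)"
    by (rule nabla_left[OF assms(1,2,2,2,2) smooth_fun_const assms(3)])
  then show ?thesis unfolding z by (simp add: tadd_def tscale_def tzero_def)
qed

lemma nabla_sum_left:
  assumes "finite I" "open W" "p \<in> W" "smooth_vfield A W Y"
    "\<And>i. i \<in> I \<Longrightarrow> smooth_fun A W (a i)" "\<And>i. i \<in> I \<Longrightarrow> smooth_vfield A W (X i)"
  shows "nabla (vf_sum I a X) Y p h = (\<Sum>i\<in>I. a i p * nabla (X i) Y p h)"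
  using assms(1,5,6)
proof (induction I rule: finite_induct)
  case empty
  then show ?case using nabla_tzero_left[OF assms(2,4,3)] by (simp add: vf_sum_empty tzero_def)
next
  case (insert i I)
  have "smooth_vfield A W (vf_sum I a X)" using insert by (intro smooth_vfield_sum) auto
  then have "nabla (vf_add (vf_scale (a i) (X i)) (vf_sum I a X)) Y p
      = tadd (tscale (a i p) (nabla (X i) Y p)) (nabla (vf_sum I a X) Y p)"
    using insert assms by (intro nabla_left) auto
  then show ?case using insert by (simp add: vf_sum_insert tadd_def tscale_def)
qed

lemma nabla_sum_right:
  assumes "finite I" "open W" "p \<in> W" "smooth_vfield A W X"
    "\<And>i. i \<in> I \<Longrightarrow> smooth_fun A W (a i)" "\<And>i. i \<in> I \<Longrightarrow> smooth_vfield A W (Y i)"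
  shows "nabla X (vf_sum I a Y) p h = (\<Sum>i\<in>I. X p (a i) * Y i p h + a i p * nabla X (Y i) p h)"
  using assms(1,5,6)
proof (induction I rule: finite_induct)
  case empty
  then show ?case using nabla_tzero_right[OF assms(2,4,3)] by (simp add: vf_sum_empty tzero_def)
next
  case (insert i I)
  have 1: "smooth_vfield A W (vf_sum I a Y)" "smooth_vfield A W (Y i)" "smooth_fun A W (a i)"
    using insert by (auto intro!: smooth_vfield_sum)
  have "nabla X (vf_add (vf_scale (a i) (Y i)) (vf_sum I a Y)) p
      = tadd (nabla X (vf_scale (a i) (Y i)) p) (nabla X (vf_sum I a Y) p)"
    using 1 assms by (intro nabla_add[where h = "a i" and X' = X]) (auto intro: smooth_vfield_scale)
  moreover have "nabla X (vf_scale (a i) (Y i)) p = tadd (tscale (X p (a i)) (Y i p)) (tscale (a i p) (nabla X (Y i) p))"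
    using 1 assms by (intro nabla_scale[where X' = X and Y' = X]) auto
  ultimately show ?case using insert by (simp add: vf_sum_insert tadd_def tscale_def)
qed

definition christoffel :: "('a, 'n) chart \<Rightarrow> 'n \<Rightarrow> 'n \<Rightarrow> 'n \<Rightarrow> 'a \<Rightarrow> real" where
  "christoffel c i j m p = nabla (coord_field A c i) (coord_field A c j) p (coord_fun c m)"

lemma vfield_expand:
  assumes "c \<in> charts" "smooth_vfield A W X" "q \<in> W" "q \<in> fst c"
  shows "X q = vf_sum UNIV (\<lambda>i p. X p (coord_fun c i)) (coord_field A c) q"
  unfolding vf_sum_def by (rule ext) (rule tangent_expand[OF assms(1,4) smooth_vfield_tangent[OF assms(2,3)]])

lemma nabla_expand_left:
  assumes c: "c \<in> charts" "p \<in> fst c" and W: "open W" "p \<in> W" "smooth_vfield A W X" "smooth_vfield A W Y"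
  shows "nabla X Y p h = (\<Sum>i\<in>UNIV. X p (coord_fun c i) * nabla (coord_field A c i) Y p h)"
proof -
  let ?W = "W \<inter> fst c" and ?X = "vf_sum UNIV (\<lambda>i p. X p (coord_fun c i)) (coord_field A c)"
  have o: "open ?W" "p \<in> ?W" using W(2) c(2) open_Int[OF W(1) open_dom[OF c(1)]] by auto
  have X: "smooth_vfield A ?W X" and Y: "smooth_vfield A ?W Y" and D: "\<And>i. smooth_vfield A ?W (coord_field A c i)"
    using W(3,4) smooth_vfield_coord_field[OF c(1)] by (blast intro: smooth_vfield_subset)+
  have x: "smooth_fun A ?W (\<lambda>p. X p (coord_fun c i))" for i
    by (rule smooth_vfield_fun[OF X o(1) subset_refl]) (rule smooth_fun_subset[OF smooth_fun_coord[OF c(1)]], simp)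
  have "nabla X Y p = nabla ?X Y p"
    by (rule nabla_local[OF o(1) X Y o(2)]) (use vfield_expand[OF c(1) X] in auto)
  then show ?thesis using nabla_sum_left[OF finite o Y x D] by simp
qed

text \<open>By locality \<open>Y\<close> may be replaced by its coordinate expansion, to which the Leibniz rule applies.\<close>

lemma nabla_expand:
  assumes c: "c \<in> charts" "p \<in> fst c" and W: "open W" "p \<in> W" "smooth_vfield A W X" "smooth_vfield A W Y"
  shows "nabla X Y p (coord_fun c m) = X p (\<lambda>q. Y q (coord_fun c m))
     + (\<Sum>i\<in>UNIV. \<Sum>j\<in>UNIV. X p (coord_fun c i) * Y p (coord_fun c j) * christoffel c i j m p)"
proof -
  let ?W = "W \<inter> fst c" and ?y = "\<lambda>j q. Y q (coord_fun c j)"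
  let ?Y = "vf_sum UNIV ?y (coord_field A c)"
  have o: "open ?W" "p \<in> ?W" using W(2) c(2) open_Int[OF W(1) open_dom[OF c(1)]] by auto
  have X: "smooth_vfield A ?W X" and Y: "smooth_vfield A ?W Y" and D: "\<And>i. smooth_vfield A ?W (coord_field A c i)"
    using W(3,4) smooth_vfield_coord_field[OF c(1)] by (blast intro: smooth_vfield_subset)+
  have y: "smooth_fun A ?W (?y i)" for i
    by (rule smooth_vfield_fun[OF Y o(1) subset_refl]) (rule smooth_fun_subset[OF smooth_fun_coord[OF c(1)]], simp)
  have "nabla X Y p = nabla X ?Y p"
    by (rule nabla_local[OF o(1) X Y o(2)]) (use vfield_expand[OF c(1) Y] in auto)
  then have "nabla X Y p (coord_fun c m) = (\<Sum>j\<in>UNIV. X p (?y j) * coord_field A c j p (coord_fun c m)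
      + ?y j p * nabla X (coord_field A c j) p (coord_fun c m))"
    using nabla_sum_right[OF finite o X y D] by simp
  also have "\<dots> = (\<Sum>j\<in>UNIV. if j = m then X p (?y m) else 0)
      + (\<Sum>j\<in>UNIV. ?y j p * nabla X (coord_field A c j) p (coord_fun c m))"
    unfolding sum.distrib[symmetric] by (rule sum.cong) (simp_all add: coord_field_coord[OF c])
  also have "(\<Sum>j\<in>UNIV. ?y j p * nabla X (coord_field A c j) p (coord_fun c m))
      = (\<Sum>j\<in>UNIV. \<Sum>i\<in>UNIV. X p (coord_fun c i) * ?y j p * christoffel c i j m p)"
    using nabla_expand_left[OF c o X D]
    by (simp add: christoffel_def sum_distrib_left mult_ac)
  also have "\<dots> = (\<Sum>i\<in>UNIV. \<Sum>j\<in>UNIV. X p (coord_fun c i) * ?y j p * christoffel c i j m p)"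
    by (rule sum.swap)
  finally show ?thesis by simp
qed

lemma coord_field_const:
  assumes "c \<in> charts" "p \<in> fst c" "open V" "p \<in> V" "\<And>q. q \<in> V \<Longrightarrow> h q = a"
  shows "coord_field A c i p h = 0"
  using tangent_local[OF coord_field_tangent[OF assms(1,2)] assms(3,4), of h "\<lambda>q. a"] assms(5)
    tangent_fun_const[OF coord_field_tangent[OF assms(1,2)]] by simp

text \<open>A torsion-free connection exhibits the bracket of two coordinate fields as a tangent vector; it
  annihilates the coordinates, hence vanishes. This is the symmetry of second derivatives.\<close>

lemma coord_bracket:
  assumes c: "c \<in> charts" "p \<in> fst c"
  shows "lie_bracket A (coord_field A c i) (coord_field A c j) p = tzero"
proof (rule tangent_eqI[OF c])
  let ?D = "coord_field A c"
  note D = smooth_vfield_coord_field[OF c(1)]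
  show "lie_bracket A (?D i) (?D j) p \<in> tangent A p"
    by (rule lie_bracket_tangent[OF open_dom[OF c(1)] D D c(2)])
  have "?D a p (\<lambda>q. ?D b q (coord_fun c m)) = 0" for a b m
    by (rule coord_field_const[OF c open_dom[OF c(1)] c(2)]) (simp add: coord_field_coord[OF c(1)])
  then have "lie_bracket A (?D i) (?D j) p (coord_fun c m) = 0" for m
    using cmp_lie_bracket[OF open_dom[OF c(1)] D D c(2) c] by simp
  then show "cmp c (lie_bracket A (?D i) (?D j) p) = cmp c tzero"
    by (simp add: cmp_def tzero_def vec_eq_iff)
qed (rule tangent_tzero)

lemma coord_commute:
  assumes "c \<in> charts" "p \<in> fst c" "smooth_near A p h"
  shows "coord_field A c i p (\<lambda>q. coord_field A c j q h) = coord_field A c j p (\<lambda>q. coord_field A c i q h)"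
  using fun_cong[OF coord_bracket[OF assms(1,2)], of i j h] assms(3) by (simp add: lie_bracket_def tzero_def)

lemma nabla_coord_commute:
  assumes c: "c \<in> charts" "p \<in> fst c"
  shows "nabla (coord_field A c i) (coord_field A c j) p = nabla (coord_field A c j) (coord_field A c i) p"
  using nabla_torsion[OF open_dom[OF c(1)] smooth_vfield_coord_field[OF c(1)] smooth_vfield_coord_field[OF c(1)] c(2), of i j]
    coord_bracket[OF c, of i j]
  by (auto simp: tadd_def tscale_def tzero_def fun_eq_iff)

lemma christoffel_sym:
  "c \<in> charts \<Longrightarrow> p \<in> fst c \<Longrightarrow> christoffel c i j m p = christoffel c j i m p"
  by (simp add: christoffel_def nabla_coord_commute[of c p i j])

section \<open>The covariant differential of a vector field\<close>

text \<open>\<open>cov E p u\<close> is \<open>\<nabla>\<^sub>u E\<close> for a single tangent vector \<open>u\<close>. A chart is used only to extend \<open>u\<close> to a field;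
  \<open>cov_field\<close> shows that the result does not depend on it.\<close>

definition cov :: "'a vfield \<Rightarrow> 'a \<Rightarrow> 'a tvec \<Rightarrow> 'a tvec" where
  "cov E p u = (\<lambda>h. \<Sum>i\<in>UNIV. u (coord_fun (chart_at A p) i) * nabla (coord_field A (chart_at A p) i) E p h)"

lemma cov_field:
  assumes "open W" "p \<in> W" "smooth_vfield A W X" "smooth_vfield A W E"
  shows "cov E p (X p) = nabla X E p"
  unfolding cov_def by (rule ext) (rule nabla_expand_left[OF chart_at_charts chart_at_in(2) assms, symmetric])

lemma cov_tadd: "cov E p (tadd (tscale a u) v) = tadd (tscale a (cov E p u)) (cov E p v)"
  by (simp add: cov_def tadd_def tscale_def sum.distrib sum_distrib_left algebra_simps)

lemma cov_coord:
  assumes E: "open W" "p \<in> W" "smooth_vfield A W E" and c: "c \<in> charts" "p \<in> fst c"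
  shows "cov E p (coord_field A c i p) = nabla (coord_field A c i) E p"
proof (rule cov_field)
  show "open (W \<inter> fst c)" using open_Int[OF E(1) open_dom[OF c(1)]] .
  show "smooth_vfield A (W \<inter> fst c) (coord_field A c i)" "smooth_vfield A (W \<inter> fst c) E"
    using smooth_vfield_subset[OF smooth_vfield_coord_field[OF c(1)]] smooth_vfield_subset[OF E(3)] by auto
qed (use E c in simp)

lemma cov_tangent:
  assumes "open W" "p \<in> W" "smooth_vfield A W E" "u \<in> tangent A p"
  shows "cov E p u \<in> tangent A p"
proof -
  let ?c = "chart_at A p" and ?W = "W \<inter> fst (chart_at A p)"
  let ?X = "vf_sum UNIV (\<lambda>i q. u (coord_fun ?c i)) (coord_field A ?c)"
  have o: "open ?W" "p \<in> ?W" using assms(2) chart_at_in(2) open_Int[OF assms(1) open_dom[OF chart_at_charts]] by auto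
  have X: "smooth_vfield A ?W ?X"
    by (intro smooth_vfield_sum smooth_fun_const smooth_vfield_subset[OF smooth_vfield_coord_field[OF chart_at_charts]]) auto
  have E: "smooth_vfield A ?W E" using assms(3) by (rule smooth_vfield_subset) simp
  have "u = ?X p" unfolding vf_sum_def by (rule ext) (rule tangent_expand[OF chart_at_charts chart_at_in(2) assms(4)])
  then show ?thesis using cov_field[OF o X E] nabla_tangent[OF o(1) X E o(2)] by simp
qed

lemma coord_exterior:
  assumes E: "open W" "p \<in> W" "smooth_vfield A W E" and c: "c \<in> charts" "p \<in> fst c"
  shows "coord_field A c i p (\<lambda>q. g q (E q) (coord_field A c j q)) - coord_field A c j p (\<lambda>q. g q (E q) (coord_field A c i q))
    = g p (nabla (coord_field A c i) E p) (coord_field A c j p) - g p (nabla (coord_field A c j) E p) (coord_field A c i p)"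
proof -
  let ?W = "W \<inter> fst c" and ?D = "coord_field A c"
  have o: "open ?W" "p \<in> ?W" using E(2) c(2) open_Int[OF E(1) open_dom[OF c(1)]] by auto
  have D: "smooth_vfield A ?W (?D i)" for i
    by (rule smooth_vfield_subset[OF smooth_vfield_coord_field[OF c(1)]]) simp
  have E': "smooth_vfield A ?W E" using E(3) by (rule smooth_vfield_subset) simp
  show ?thesis
    using nabla_metric[OF o(1) D E' D o(2), of i j] nabla_metric[OF o(1) D E' D o(2), of j i]
      nabla_coord_commute[OF c, of i j] by simp
qed

lemma g_coord_sum:
  assumes c: "c \<in> charts" "p \<in> fst c" and u: "u \<in> tangent A p" and w: "w \<in> tangent A p"
  shows "g p w u = (\<Sum>j\<in>UNIV. u (coord_fun c j) * g p w (coord_field A c j p))"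
proof -
  have "cmp c u = (\<Sum>j\<in>UNIV. u (coord_fun c j) *\<^sub>R cmp c (coord_field A c j p))"
    using vec_axis_expand[of "cmp c u"] by (simp add: cmp_coord_field[OF c]) (simp add: cmp_def)
  then show ?thesis
    using g_gram[OF c w u] g_gram[OF c w coord_field_tangent[OF c]] bilinear_sum_right[OF gram_bilinear[OF c]] by simp
qed

text \<open>The exterior derivative of the form metrically equivalent to \<open>E\<close> is the skew part of \<open>\<nabla>E\<close>; in
  particular it does not depend on the chart.\<close>

lemma ext_deriv1_cov:
  assumes E: "smooth_vfield A UNIV E" and u: "u \<in> tangent A p" and v: "v \<in> tangent A p"
  shows "ext_deriv1 A (\<lambda>q v. g q (E q) v) p u v = g p (cov E p u) v - g p (cov E p v) u"
proof -
  let ?c = "chart_at A p" let ?D = "coord_field A ?c" and ?x = "coord_fun ?c"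
  note c = chart_at_charts[of p] chart_at_in(2)[of p]
  note E' = open_UNIV UNIV_I E
  have T: "nabla (?D i) E p \<in> tangent A p" for i
    using cov_coord[OF E' c] cov_tangent[OF E' coord_field_tangent[OF c]] by metis
  have S: "g p (cov E p y) z = (\<Sum>i\<in>UNIV. \<Sum>j\<in>UNIV. y (?x i) * z (?x j) * g p (nabla (?D i) E p) (?D j p))"
    if "y \<in> tangent A p" "z \<in> tangent A p" for y z
  proof -
    have "cmp ?c (cov E p y) = (\<Sum>i\<in>UNIV. y (?x i) *\<^sub>R cmp ?c (nabla (?D i) E p))"
      by (simp add: cmp_def cov_def vec_eq_iff)
    then have "g p (cov E p y) z = (\<Sum>i\<in>UNIV. y (?x i) * g p (nabla (?D i) E p) z)"
      using g_gram[OF c cov_tangent[OF E' that(1)] that(2)] g_gram[OF c T that(2)]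
        bilinear_sum_left[OF gram_bilinear[OF c]] by simp
    then show ?thesis using g_coord_sum[OF c that(2) T] by (simp add: sum_distrib_left mult_ac)
  qed
  have "ext_deriv1 A (\<lambda>q v. g q (E q) v) p u v = (\<Sum>i\<in>UNIV. \<Sum>j\<in>UNIV.
      (g p (nabla (?D i) E p) (?D j p) - g p (nabla (?D j) E p) (?D i p)) * u (?x i) * v (?x j))"
    by (simp add: ext_deriv1_def Let_def coord_exterior[OF E' c])
  also have "\<dots> = (\<Sum>i\<in>UNIV. \<Sum>j\<in>UNIV. u (?x i) * v (?x j) * g p (nabla (?D i) E p) (?D j p))
      - (\<Sum>i\<in>UNIV. \<Sum>j\<in>UNIV. v (?x j) * u (?x i) * g p (nabla (?D j) E p) (?D i p))"
    by (simp add: sum_subtractf[symmetric] algebra_simps)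
  also have "(\<Sum>i\<in>UNIV. \<Sum>j\<in>UNIV. v (?x j) * u (?x i) * g p (nabla (?D j) E p) (?D i p))
      = (\<Sum>j\<in>UNIV. \<Sum>i\<in>UNIV. v (?x j) * u (?x i) * g p (nabla (?D j) E p) (?D i p))"
    by (rule sum.swap)
  finally show ?thesis unfolding S[OF u v] S[OF v u] .
qed

end


section \<open>Linear algebra of Lorentzian scalar products and skew forms\<close>

lemma lorentz_form_parseval:
  assumes "lorentz_form G e i0"
  shows "G v w = (\<Sum>i\<in>UNIV. G (e i) (e i) * (G v (e i) * G w (e i)))"
proof -
  have B: "bilinear G" and S: "\<And>u v. G u v = G v u" using assms unfolding lorentz_form_def by auto
  have "G v w = G v (\<Sum>i\<in>UNIV. (G (e i) (e i) * G w (e i)) *\<^sub>R e i)"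
    by (rule arg_cong[OF lorentz_form_expand[OF assms]])
  then show ?thesis by (simp add: bilinear_sum_right[OF B] mult_ac)
qed

lemma lorentz_null_zero:
  assumes "lorentz_form G e i0" "G w w = 0" "G w (e i0) = 0"
  shows "w = 0"
proof -
  have \<eta>: "\<And>i. G (e i) (e i) = (if i = i0 then -1 else 1)" using assms(1) unfolding lorentz_form_def by auto
  have "0 = (\<Sum>i\<in>UNIV. G (e i) (e i) * (G w (e i) * G w (e i)))"
    using lorentz_form_parseval[OF assms(1), of w w] assms(2) by simp
  also have "\<dots> = (\<Sum>i\<in>UNIV. (G w (e i))\<^sup>2)"
    by (rule sum.cong) (auto simp: \<eta> assms(3) power2_eq_square)
  finally have "\<forall>i\<in>UNIV. (G w (e i))\<^sup>2 = 0" using sum_nonneg_eq_0_iff[of UNIV "\<lambda>i. (G w (e i))\<^sup>2"] by simp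
  then show ?thesis using lorentz_form_expand[OF assms(1), of w] by simp
qed

text \<open>Subtract from \<open>v\<close> the multiple of \<open>u\<close> that has the same time component: the difference is null and
  purely spatial.\<close>

lemma lorentz_null_parallel:
  assumes L: "lorentz_form G e i0" and "G u u = 0" "G v v = 0" "G u v = 0" "u \<noteq> 0"
  shows "\<exists>a. v = a *\<^sub>R u"
proof -
  have B: "bilinear G" and S: "\<And>u v. G u v = G v u" using L unfolding lorentz_form_def by auto
  have u0: "G u (e i0) \<noteq> 0" using lorentz_null_zero[OF L] assms by blast
  define a where "a = G v (e i0) / G u (e i0)"
  have "v - a *\<^sub>R u = 0"
  proof (rule lorentz_null_zero[OF L])
    show "G (v - a *\<^sub>R u) (e i0) = 0"
      using u0 by (simp add: bilinear_lsub[OF B] bilinear_lmul[OF B] a_def)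
    show "G (v - a *\<^sub>R u) (v - a *\<^sub>R u) = 0"
      using assms S[of v u]
      by (simp add: bilinear_lsub[OF B] bilinear_lmul[OF B] bilinear_rsub[OF B] bilinear_rmul[OF B])
  qed
  then show ?thesis by auto
qed

definition ltrace :: "(real ^ 'n \<Rightarrow> real ^ 'n) \<Rightarrow> real" where
  "ltrace L = (\<Sum>i\<in>(UNIV :: 'n::finite set). L (axis i 1) $ i)"

text \<open>The right-hand side mentions only the scalar product and the endomorphism, so it can be compared between
  charts.\<close>

lemma ltrace_lorentz:
  assumes G: "lorentz_form G e i0" and L: "linear L"
  shows "ltrace L = (\<Sum>i\<in>UNIV. G (e i) (e i) * G (L (e i)) (e i))"
proof -
  have B: "bilinear G" using G unfolding lorentz_form_def by auto
  have "L (axis m 1) $ m = (\<Sum>i\<in>UNIV. (G (e i) (e i) * G (L (axis m 1)) (e i)) * e i $ m)" for m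
    using arg_cong[OF lorentz_form_expand[OF G, of "L (axis m 1)"], of "\<lambda>w. w $ m"] by simp
  then have "ltrace L = (\<Sum>m\<in>UNIV. \<Sum>i\<in>UNIV. (G (e i) (e i) * G (L (axis m 1)) (e i)) * e i $ m)"
    by (simp add: ltrace_def)
  also have "\<dots> = (\<Sum>i\<in>UNIV. G (e i) (e i) * (\<Sum>m\<in>UNIV. e i $ m * G (L (axis m 1)) (e i)))"
    unfolding sum_distrib_left by (subst sum.swap) (simp add: mult_ac)
  also have "\<dots> = (\<Sum>i\<in>UNIV. G (e i) (e i) * G (L (e i)) (e i))"
  proof (rule sum.cong[OF refl])
    fix i
    have "L (e i) = L (\<Sum>m\<in>UNIV. (e i $ m) *\<^sub>R axis m 1)" by (rule arg_cong[OF vec_axis_expand])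
    also have "\<dots> = (\<Sum>m\<in>UNIV. (e i $ m) *\<^sub>R L (axis m 1))" by (simp add: linear_sum[OF L] linear_scale[OF L])
    finally show "G (e i) (e i) * (\<Sum>m\<in>UNIV. e i $ m * G (L (axis m 1)) (e i)) = G (e i) (e i) * G (L (e i)) (e i)"
      by (simp add: bilinear_sum_left[OF B])
  qed
  finally show ?thesis .
qed

lemma ltrace_rank_one:
  assumes "linear \<phi>"
  shows "ltrace (\<lambda>u. \<phi> u *\<^sub>R k) = \<phi> k"
proof -
  have "\<phi> k = \<phi> (\<Sum>m\<in>UNIV. (k $ m) *\<^sub>R axis m 1)" by (rule arg_cong[OF vec_axis_expand])
  then show ?thesis by (simp add: ltrace_def linear_sum[OF assms] linear_scale[OF assms] mult.commute)
qed

lemma ltrace_add: "ltrace (\<lambda>u. L u + L' u) = ltrace L + ltrace L'"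
  by (simp add: ltrace_def sum.distrib)

text \<open>A bilinear form that annihilates the null vector \<open>k\<close> does not notice the shear
  \<open>e\<^sub>i \<mapsto> e\<^sub>i + m\<^sub>i e\<^sub>0\<close> into the hyperplane orthogonal to \<open>k\<close>, as far as its trace is concerned.\<close>

lemma lorentz_trace_project:
  assumes G: "lorentz_form G e i0" and X: "bilinear X" "\<And>v. X k v = 0" "\<And>v. X v k = 0"
    and k: "G k k = 0" "G k (e i0) \<noteq> 0"
  defines "m \<equiv> \<lambda>i. - (G k (e i) / G k (e i0))"
  shows "(\<Sum>i\<in>UNIV. G (e i) (e i) * X (e i + m i *\<^sub>R e i0) (e i + m i *\<^sub>R e i0))
    = (\<Sum>i\<in>UNIV. G (e i) (e i) * X (e i) (e i))"
proof -
  let ?\<eta> = "\<lambda>i. G (e i) (e i)"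
  have m: "?\<eta> i * m i = (?\<eta> i * G k (e i)) * (- 1 / G k (e i0))" for i by (simp add: m_def)
  have 1: "(\<Sum>i\<in>UNIV. ?\<eta> i * m i * X (e i) (e i0)) = 0" "(\<Sum>i\<in>UNIV. ?\<eta> i * m i * X (e i0) (e i)) = 0"
  proof -
    have "X k (e i0) = (\<Sum>i\<in>UNIV. ?\<eta> i * G k (e i) * X (e i) (e i0))"
      "X (e i0) k = (\<Sum>i\<in>UNIV. ?\<eta> i * G k (e i) * X (e i0) (e i))"
      using arg_cong[OF lorentz_form_expand[OF G, of k], of "\<lambda>x. X x (e i0)"]
        arg_cong[OF lorentz_form_expand[OF G, of k], of "X (e i0)"]
      unfolding bilinear_sum_left[OF X(1)] bilinear_sum_right[OF X(1)] by blast+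
    then have *: "(\<Sum>i\<in>UNIV. ?\<eta> i * G k (e i) * X (e i) (e i0)) * (- 1 / G k (e i0)) = 0"
      "(\<Sum>i\<in>UNIV. ?\<eta> i * G k (e i) * X (e i0) (e i)) * (- 1 / G k (e i0)) = 0"
      using X by auto
    show "(\<Sum>i\<in>UNIV. ?\<eta> i * m i * X (e i) (e i0)) = 0" "(\<Sum>i\<in>UNIV. ?\<eta> i * m i * X (e i0) (e i)) = 0"
      using * unfolding sum_distrib_right m by (simp_all add: mult_ac)
  qed
  have 2: "(\<Sum>i\<in>UNIV. ?\<eta> i * (m i * m i)) = 0"
  proof -
    have "(\<Sum>i\<in>UNIV. ?\<eta> i * (G k (e i) * G k (e i))) * (1 / (G k (e i0) * G k (e i0))) = 0"
      using lorentz_form_parseval[OF G, of k k] k by simp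
    then show ?thesis unfolding sum_distrib_right by (simp add: m_def)
  qed
  have "?\<eta> i * X (e i + m i *\<^sub>R e i0) (e i + m i *\<^sub>R e i0) = ?\<eta> i * X (e i) (e i)
      + ?\<eta> i * m i * X (e i) (e i0) + ?\<eta> i * m i * X (e i0) (e i) + ?\<eta> i * (m i * m i) * X (e i0) (e i0)" for i
    by (simp add: bilinear_ladd[OF X(1)] bilinear_radd[OF X(1)] bilinear_lmul[OF X(1)] bilinear_rmul[OF X(1)] algebra_simps)
  then show ?thesis using 1 2 by (simp add: sum.distrib sum_distrib_right[symmetric])
qed

lemma bilinear_prod:
  assumes "linear \<phi>" "linear \<psi>"
  shows "bilinear (\<lambda>u v. \<phi> u * \<psi> v :: real)"
  unfolding bilinear_def
  by (intro conjI allI linearI)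
    (simp_all add: linear_add[OF assms(1)] linear_scale[OF assms(1)] linear_add[OF assms(2)] linear_scale[OF assms(2)] algebra_simps)

text \<open>A self-adjoint endomorphism \<open>L\<close> annihilating a null vector \<open>k\<close> descends to the Euclidean plane
  \<open>k\<^sup>\<bottom>/k\<close>, where the claim is the Cauchy--Schwarz inequality for \<open>L\<close> and the identity. The projections \<open>f\<^sub>i\<close>
  of the basis vectors to \<open>k\<^sup>\<bottom>\<close> along \<open>e\<^sub>0\<close> make this visible without a choice of a basis of the quotient.\<close>

lemma selfadjoint_trace_inequality:
  fixes G :: "real ^ 'n \<Rightarrow> real ^ 'n \<Rightarrow> real"
  assumes n: "CARD('n) = 4" and G: "lorentz_form G e i0" and L: "linear L" "\<And>u v. G (L u) v = G (L v) u"
    and k: "k \<noteq> 0" "G k k = 0" "L k = 0"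
  shows "(ltrace L)\<^sup>2 \<le> 2 * ltrace (\<lambda>u. L (L u))"
proof -
  have B: "bilinear G" and S: "\<And>u v. G u v = G v u"
    and ee: "\<And>i j. G (e i) (e j) = (if i \<noteq> j then 0 else if i = i0 then -1 else 1)"
    using G unfolding lorentz_form_def by auto
  have Gl: "linear (G u)" "linear (\<lambda>v. G v u)" for u using B by (auto simp: bilinear_def)
  have k0: "G k (e i0) \<noteq> 0" using lorentz_null_zero[OF G k(2)] k(1) by blast
  let ?\<eta> = "\<lambda>i. G (e i) (e i)"
  define m where "m i = - (G k (e i) / G k (e i0))" for i
  define f where "f i = e i + m i *\<^sub>R e i0" for i
  define b where "b u v = G (L u) v" for u v
  have b: "bilinear b"
    unfolding bilinear_def b_def
    by (intro conjI allI linearI)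
      (simp_all add: linear_add[OF L(1)] linear_scale[OF L(1)] bilinear_ladd[OF B] bilinear_radd[OF B]
        bilinear_lmul[OF B] bilinear_rmul[OF B])
  have bl: "linear (b u)" "linear (\<lambda>v. b v u)" for u using b by (auto simp: bilinear_def)
  have b_sym: "b u v = b v u" for u v using L(2) by (simp add: b_def)
  have bk: "b k v = 0" "b v k = 0" for v
    using k(3) b_sym linear_0[OF Gl(2)] by (simp_all add: b_def)
  have fk: "G (f i) k = 0" for i
    using k0 unfolding S[of _ k] by (simp add: f_def m_def bilinear_rsub[OF B] bilinear_rmul[OF B])
  have f0: "f i0 = 0" using k0 by (simp add: f_def m_def)
  note proj = lorentz_trace_project[OF G _ _ _ k(2) k0, folded m_def, folded f_def]
  define \<theta> where "\<theta> = ltrace L"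
  have tr: "\<theta> = (\<Sum>i\<in>UNIV. ?\<eta> i * b (e i) (e i))"
    unfolding \<theta>_def b_def by (rule ltrace_lorentz[OF G L(1)])
  have LL: "linear (\<lambda>u. L (L u))" using linear_compose[OF L(1) L(1)] by (simp add: o_def)
  have QQ: "(\<Sum>j\<in>UNIV. \<Sum>i\<in>UNIV. ?\<eta> j * (?\<eta> i * (b (f i) (f j) * b (f i) (f j)))) = ltrace (\<lambda>u. L (L u))"
  proof -
    have "(\<Sum>i\<in>UNIV. ?\<eta> i * (b (f i) (f j) * b (f i) (f j))) = (\<Sum>i\<in>UNIV. ?\<eta> i * (b (e i) (f j) * b (e i) (f j)))" for j
      by (rule proj[OF bilinear_prod[OF bl(2) bl(2)]]) (simp_all add: bk)
    then have "(\<Sum>j\<in>UNIV. \<Sum>i\<in>UNIV. ?\<eta> j * (?\<eta> i * (b (f i) (f j) * b (f i) (f j))))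
        = (\<Sum>j\<in>UNIV. \<Sum>i\<in>UNIV. ?\<eta> j * (?\<eta> i * (b (e i) (f j) * b (e i) (f j))))"
      by (simp add: sum_distrib_left[symmetric])
    also have "\<dots> = (\<Sum>i\<in>UNIV. ?\<eta> i * (\<Sum>j\<in>UNIV. ?\<eta> j * (b (e i) (f j) * b (e i) (f j))))"
      unfolding sum_distrib_left by (subst sum.swap) (simp add: mult_ac)
    also have "\<dots> = (\<Sum>i\<in>UNIV. ?\<eta> i * (\<Sum>j\<in>UNIV. ?\<eta> j * (b (e i) (e j) * b (e i) (e j))))"
    proof -
      have "(\<Sum>j\<in>UNIV. ?\<eta> j * (b (e i) (f j) * b (e i) (f j))) = (\<Sum>j\<in>UNIV. ?\<eta> j * (b (e i) (e j) * b (e i) (e j)))" for i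
        by (rule proj[OF bilinear_prod[OF bl(1) bl(1)]]) (simp_all add: bk)
      then show ?thesis by simp
    qed
    also have "\<dots> = (\<Sum>i\<in>UNIV. ?\<eta> i * G (L (e i)) (L (e i)))"
      unfolding b_def lorentz_form_parseval[OF G, symmetric] ..
    also have "\<dots> = ltrace (\<lambda>u. L (L u))"
      unfolding ltrace_lorentz[OF G LL] using L(2) S by (intro sum.cong) metis+
    finally show ?thesis .
  qed
  have QP: "(\<Sum>i\<in>UNIV. \<Sum>j\<in>UNIV. ?\<eta> i * (?\<eta> j * (b (f i) (f j) * G (f i) (f j)))) = \<theta>"
  proof -
    have "(\<Sum>j\<in>UNIV. ?\<eta> j * (b (f i) (f j) * G (f i) (f j))) = b (f i) (f i)" for i
    proof -
      have "(\<Sum>j\<in>UNIV. ?\<eta> j * (b (f i) (f j) * G (f i) (f j))) = (\<Sum>j\<in>UNIV. ?\<eta> j * (b (f i) (e j) * G (f i) (e j)))"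
        by (rule proj[OF bilinear_prod[OF bl(1) Gl(1)]]) (simp_all add: bk fk)
      also have "\<dots> = b (f i) (f i)"
        unfolding b_def lorentz_form_parseval[OF G, symmetric] ..
      finally show ?thesis .
    qed
    then have "(\<Sum>i\<in>UNIV. \<Sum>j\<in>UNIV. ?\<eta> i * (?\<eta> j * (b (f i) (f j) * G (f i) (f j)))) = (\<Sum>i\<in>UNIV. ?\<eta> i * b (f i) (f i))"
      by (simp add: sum_distrib_left[symmetric])
    also have "\<dots> = (\<Sum>i\<in>UNIV. ?\<eta> i * b (e i) (e i))"
      by (rule proj[OF b]) (simp_all add: bk)
    finally show ?thesis by (simp add: tr)
  qed
  have PP: "(\<Sum>i\<in>UNIV. \<Sum>j\<in>UNIV. ?\<eta> i * (?\<eta> j * (G (f i) (f j) * G (f i) (f j)))) = 2"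
  proof -
    have "(\<Sum>j\<in>UNIV. ?\<eta> j * (G (f i) (f j) * G (f i) (f j))) = G (f i) (f i)" for i
    proof -
      have "(\<Sum>j\<in>UNIV. ?\<eta> j * (G (f i) (f j) * G (f i) (f j))) = (\<Sum>j\<in>UNIV. ?\<eta> j * (G (f i) (e j) * G (f i) (e j)))"
        by (rule proj[OF bilinear_prod[OF Gl(1) Gl(1)]]) (simp_all add: fk)
      also have "\<dots> = G (f i) (f i)" by (rule lorentz_form_parseval[OF G, symmetric])
      finally show ?thesis .
    qed
    then have "(\<Sum>i\<in>UNIV. \<Sum>j\<in>UNIV. ?\<eta> i * (?\<eta> j * (G (f i) (f j) * G (f i) (f j)))) = (\<Sum>i\<in>UNIV. ?\<eta> i * G (f i) (f i))"
      by (simp add: sum_distrib_left[symmetric])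
    also have "\<dots> = (\<Sum>i\<in>UNIV. 1 + ?\<eta> i * (2 * m i * G (e i) (e i0)) - ?\<eta> i * (m i * m i))"
      by (rule sum.cong)
        (auto simp: f_def bilinear_ladd[OF B] bilinear_radd[OF B] bilinear_lmul[OF B] bilinear_rmul[OF B] ee algebra_simps)
    also have "\<dots> = real CARD('n) + (\<Sum>i\<in>UNIV. ?\<eta> i * (2 * m i * G (e i) (e i0))) - (\<Sum>i\<in>UNIV. ?\<eta> i * (m i * m i))"
      by (simp add: sum.distrib sum_subtractf)
    also have "(\<Sum>i\<in>UNIV. ?\<eta> i * (m i * m i)) = (\<Sum>i\<in>UNIV. ?\<eta> i * (G k (e i) * G k (e i))) / (G k (e i0))\<^sup>2"
      by (simp add: m_def sum_divide_distrib power2_eq_square)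
    also have "(\<Sum>i\<in>UNIV. ?\<eta> i * (G k (e i) * G k (e i))) = 0"
      using lorentz_form_parseval[OF G, of k k] k(2) by simp
    also have "(\<Sum>i\<in>UNIV. ?\<eta> i * (2 * m i * G (e i) (e i0))) = (\<Sum>i\<in>UNIV. if i = i0 then 2 * m i0 else 0)"
      by (rule sum.cong) (auto simp: ee)
    also have "m i0 = -1" using k0 by (simp add: m_def)
    finally show ?thesis using n by simp
  qed
  \<comment> \<open>The signs \<open>\<eta>\<close> are harmless since \<open>f i0 = 0\<close>; \<open>\<theta> / 2\<close> is the coefficient of the orthogonal projection of
    \<open>b\<close> to the induced metric, whose square norm is 2.\<close>
  have "0 \<le> (\<Sum>i\<in>UNIV. \<Sum>j\<in>UNIV. ?\<eta> i * (?\<eta> j * (b (f i) (f j) - (\<theta> / 2) * G (f i) (f j))\<^sup>2))"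
  proof (intro sum_nonneg)
    fix i j
    show "0 \<le> ?\<eta> i * (?\<eta> j * (b (f i) (f j) - (\<theta> / 2) * G (f i) (f j))\<^sup>2)"
      using f0 linear_0[OF Gl(1)] linear_0[OF Gl(2)] linear_0[OF bl(1)] linear_0[OF bl(2)] ee by (cases "i = i0 \<or> j = i0") auto
  qed
  also have "\<dots> = (\<Sum>i\<in>UNIV. \<Sum>j\<in>UNIV. ?\<eta> j * (?\<eta> i * (b (f j) (f i) * b (f j) (f i)))
      - \<theta> * (?\<eta> i * (?\<eta> j * (b (f i) (f j) * G (f i) (f j))))
      + (\<theta> / 2)\<^sup>2 * (?\<eta> i * (?\<eta> j * (G (f i) (f j) * G (f i) (f j)))))"
    by (intro sum.cong refl) (simp add: b_sym power2_eq_square algebra_simps)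
  also have "\<dots> = (\<Sum>i\<in>UNIV. \<Sum>j\<in>UNIV. ?\<eta> i * (?\<eta> j * (b (f j) (f i) * b (f j) (f i)))) - \<theta> * \<theta> + (\<theta> / 2)\<^sup>2 * 2"
    unfolding sum.distrib sum_subtractf sum_distrib_left[symmetric] QP[symmetric, unfolded sum_distrib_left[symmetric]]
    using PP QP by (simp add: sum_distrib_left[symmetric] mult_ac)
  also have "(\<Sum>i\<in>UNIV. \<Sum>j\<in>UNIV. ?\<eta> i * (?\<eta> j * (b (f j) (f i) * b (f j) (f i)))) = ltrace (\<lambda>u. L (L u))"
    by (rule QQ)
  finally show ?thesis by (simp add: \<theta>_def power2_eq_square)
qed

text \<open>If the three-form \<open>k\<^sup>\<flat> \<and> d k\<^sup>\<flat>\<close> vanishes, then \<open>L\<close> differs from a self-adjoint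
  endomorphism by a rank one term with values in \<open>k\<close>, which is invisible to both traces.\<close>

lemma twist_free_trace_inequality:
  fixes G :: "real ^ 'n \<Rightarrow> real ^ 'n \<Rightarrow> real"
  assumes n: "CARD('n) = 4" and G: "lorentz_form G e i0" and L: "linear L"
    and k: "k \<noteq> 0" "G k k = 0" "L k = 0" "\<And>u. G (L u) k = 0"
  defines "F \<equiv> \<lambda>u v. G (L u) v - G (L v) u"
  assumes T: "\<And>u v w. G k u * F v w + G k v * F w u + G k w * F u v = 0"
  shows "(ltrace L)\<^sup>2 \<le> 2 * ltrace (\<lambda>u. L (L u))"
proof -
  have B: "bilinear G" and S: "\<And>u v. G u v = G v u" using G unfolding lorentz_form_def by auto
  have k0: "G k (e i0) \<noteq> 0" using lorentz_null_zero[OF G k(2)] k(1) by blast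
  define \<beta> where "\<beta> v = - F v (e i0) / G k (e i0)" for v
  have F: "F u v = G k u * \<beta> v - G k v * \<beta> u" for u v
  proof -
    have "F (e i0) u = - F u (e i0)" by (simp add: F_def)
    then show ?thesis using T[of u v "e i0"] k0 by (simp add: \<beta>_def field_simps)
  qed
  have \<beta>: "linear \<beta>"
    unfolding \<beta>_def F_def
    by (rule linearI) (simp_all add: linear_add[OF L] linear_scale[OF L] bilinear_ladd[OF B] bilinear_radd[OF B]
        bilinear_lmul[OF B] bilinear_rmul[OF B] add_divide_distrib diff_divide_distrib algebra_simps)
  have \<beta>k: "\<beta> k = 0" using k by (simp add: \<beta>_def F_def bilinear_lzero[OF B])
  define L' where "L' u = L u + \<beta> u *\<^sub>R k" for u
  have L': "linear L'"
    unfolding L'_def by (rule linearI)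
      (simp_all add: linear_add[OF L] linear_scale[OF L] linear_add[OF \<beta>] linear_scale[OF \<beta>] algebra_simps)
  have "(ltrace L')\<^sup>2 \<le> 2 * ltrace (\<lambda>u. L' (L' u))"
  proof (rule selfadjoint_trace_inequality[OF n G L' _ k(1,2)])
    show "G (L' u) v = G (L' v) u" for u v
      using F[of u v] unfolding F_def L'_def
      by (simp add: bilinear_ladd[OF B] bilinear_lmul[OF B] algebra_simps)
    show "L' k = 0" using k \<beta>k by (simp add: L'_def)
  qed
  moreover have "ltrace L' = ltrace L"
    using ltrace_add[of L "\<lambda>u. \<beta> u *\<^sub>R k"] ltrace_rank_one[OF \<beta>, of k] \<beta>k by (simp add: L'_def[abs_def])
  moreover have "ltrace (\<lambda>u. L' (L' u)) = ltrace (\<lambda>u. L (L u))"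
  proof -
    have l: "linear (\<lambda>u. \<beta> (L u))" using linear_compose[OF L \<beta>] by (simp add: o_def)
    have "L' (L' u) = L (L u) + \<beta> (L u) *\<^sub>R k" for u
      using k \<beta>k by (simp add: L'_def linear_add[OF L] linear_scale[OF L] linear_add[OF \<beta>] linear_scale[OF \<beta>])
    then show ?thesis
      using ltrace_add[of "\<lambda>u. L (L u)" "\<lambda>u. \<beta> (L u) *\<^sub>R k"] ltrace_rank_one[OF l, of k] k(3) linear_0[OF \<beta>] by simp
  qed
  ultimately show ?thesis by simp
qed

text \<open>In four dimensions a three-form is the contraction of a volume form with a vector, so it cannot be
  annihilated by two independent vectors. Alternation is expressed by cyclic symmetry and \<open>T x x y = 0\<close>.\<close>

lemma three_form_two_kernel:
  fixes T :: "real ^ 'n \<Rightarrow> real ^ 'n \<Rightarrow> real ^ 'n \<Rightarrow> real"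
  assumes n: "CARD('n) = 4"
    and lin: "\<And>a x x' y z. T (a *\<^sub>R x + x') y z = a * T x y z + T x' y z"
    and cyc: "\<And>x y z. T x y z = T y z x" and alt: "\<And>x y. T x x y = 0"
    and k: "k \<noteq> 0" "\<And>y z. T k y z = 0" and u: "\<And>c. u \<noteq> c *\<^sub>R k" "\<And>y z. T u y z = 0"
  shows "T x y z = 0"
proof -
  obtain i where i: "k $ i \<noteq> 0" using k(1) by (auto simp: vec_eq_iff)
  define u' where "u' = (- (u $ i / k $ i)) *\<^sub>R k + u"
  have u': "u' $ i = 0" "\<And>y z. T u' y z = 0"
    using i unfolding u'_def lin by (simp_all add: k(2) u(2))
  have "u' \<noteq> 0"
  proof
    assume "u' = 0"
    then have "u = (u $ i / k $ i) *\<^sub>R k" by (simp add: u'_def)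
    then show False using u(1) by blast
  qed
  then obtain j where j: "u' $ j \<noteq> 0" by (auto simp: vec_eq_iff)
  then have ij: "i \<noteq> j" using u' by auto
  have "card (UNIV - {i, j}) = 2" using n ij by (simp add: card_Diff_subset)
  then obtain l m where lm: "UNIV - {i, j} = {l, m}" "l \<noteq> m" by (auto simp: card_2_iff)
  have red: "\<exists>a b. \<forall>y z. T x y z = T (a *\<^sub>R axis l 1 + b *\<^sub>R axis m 1) y z" for x
  proof -
    define x' where "x' = (- (x $ i / k $ i)) *\<^sub>R k + x"
    define x'' where "x'' = (- (x' $ j / u' $ j)) *\<^sub>R u' + x'"
    have x'': "x'' $ i = 0" "x'' $ j = 0" using i j u' by (simp_all add: x''_def x'_def)
    have "x'' = (x'' $ l) *\<^sub>R axis l 1 + (x'' $ m) *\<^sub>R axis m 1"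
      unfolding vec_eq_iff
    proof
      fix s
      have "s = i \<or> s = j \<or> s = l \<or> s = m" using lm by blast
      then show "x'' $ s = ((x'' $ l) *\<^sub>R axis l 1 + (x'' $ m) *\<^sub>R axis m 1) $ s"
        using x'' lm by (auto simp: axis_def)
    qed
    moreover have "T x y z = T x'' y z" for y z unfolding x''_def x'_def lin by (simp add: k(2) u'(2))
    ultimately show ?thesis by metis
  qed
  have zero: "T 0 y z = 0" for y z using lin[of 0 0 0 y z] by (metis add.right_neutral add_0 mult_zero_left scaleR_zero_left alt lin mult_1 scaleR_one add_cancel_left_right)
  have sc: "T (a *\<^sub>R x) y z = a * T x y z" for a x y z using lin[of a x 0 y z] zero by simp
  have ad: "T (x + x') y z = T x y z + T x' y z" for x x' y z using lin[of 1 x x' y z] by simp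
  have ad2: "T y (x + x') z = T y x z + T y x' z" "T y (a *\<^sub>R x) z = a * T y x z"
    "T z y (x + x') = T z y x + T z y x'" "T z y (a *\<^sub>R x) = a * T z y x" for x x' y z a
    using ad sc cyc by metis+
  have alt': "T x y x = 0" "T y x x = 0" for x y using alt cyc by metis+
  obtain a1 b1 where 1: "\<And>y z. T x y z = T (a1 *\<^sub>R axis l 1 + b1 *\<^sub>R axis m 1) y z" using red[of x] by blast
  obtain a2 b2 where 2: "\<And>x z. T y z x = T (a2 *\<^sub>R axis l 1 + b2 *\<^sub>R axis m 1) z x" using red[of y] by blast
  obtain a3 b3 where 3: "\<And>x y. T z x y = T (a3 *\<^sub>R axis l 1 + b3 *\<^sub>R axis m 1) x y" using red[of z] by blast
  let ?v = "\<lambda>a b. a *\<^sub>R axis l 1 + b *\<^sub>R axis m 1 :: real ^ 'n"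
  have "T x y z = T (?v a1 b1) y z" by (rule 1)
  also have "\<dots> = T (?v a2 b2) z (?v a1 b1)" using 2 cyc by metis
  also have "\<dots> = T (?v a3 b3) (?v a1 b1) (?v a2 b2)" using 3 cyc by metis
  also have "\<dots> = 0" by (simp add: ad sc ad2 alt alt')
  finally show ?thesis .
qed

text \<open>Up to the factor \<open>e\<^sup>f\<close>, the form \<open>a \<and> \<kappa> + F\<close> is \<open>d(e\<^sup>f k\<^sup>\<flat>)\<close> at a point. A vector in its kernel, together with
  \<open>k\<close>, would span a plane of vectors annihilating \<open>\<kappa> \<and> F\<close>.\<close>

lemma degenerate_imp_twist_free:
  fixes F :: "real ^ 'n \<Rightarrow> real ^ 'n \<Rightarrow> real"
  assumes n: "CARD('n) = 4" and F: "bilinear F" "\<And>u v. F u v = - F v u"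
    and lin: "linear \<kappa>" "linear a" and \<kappa>: "\<kappa> w \<noteq> 0" "\<kappa> k = 0" and k: "\<And>v. F k v = 0" "a k \<noteq> 0"
    and u: "u \<noteq> 0" "\<And>v. a u * \<kappa> v - a v * \<kappa> u + F u v = 0"
  shows "\<kappa> x * F y z + \<kappa> y * F z x + \<kappa> z * F x y = 0"
proof -
  define T where "T x y z = \<kappa> x * F y z + \<kappa> y * F z x + \<kappa> z * F x y" for x y z
  have uk: "\<kappa> u = 0"
    using u(2)[of k] \<kappa>(2) k F(2)[of u k] by simp
  have Fu: "F u v = - a u * \<kappa> v" "F v u = a u * \<kappa> v" for v
    using u(2)[of v] uk F(2)[of v u] by simp_all
  have F0: "F v k = 0" "F v v = 0" for v using F(2)[of v k] k F(2)[of v v] by simp_all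
  have "T x y z = 0"
  proof (rule three_form_two_kernel[OF n])
    show "T (a *\<^sub>R x + x') y z = a * T x y z + T x' y z" for a x x' y z
      by (simp add: T_def linear_add[OF lin(1)] linear_scale[OF lin(1)] bilinear_ladd[OF F(1)]
          bilinear_radd[OF F(1)] bilinear_lmul[OF F(1)] bilinear_rmul[OF F(1)] algebra_simps)
    show "T x y z = T y z x" "T x x y = 0" for x y z
      using F(2)[of x y] F0 by (simp_all add: T_def algebra_simps)
    show "k \<noteq> 0" using k(2) linear_0[OF lin(2)] by auto
    show "T k y z = 0" "T u y z = 0" for y z
      using \<kappa>(2) k(1) F0 uk Fu by (simp_all add: T_def)
    show "u \<noteq> c *\<^sub>R k" for c
    proof
      assume c: "u = c *\<^sub>R k"
      then have "F u w = 0" using k(1) by (simp add: bilinear_lmul[OF F(1)])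
      then have "a u = 0" using Fu(1)[of w] \<kappa>(1) by simp
      then have "c = 0" using c k(2) by (simp add: linear_scale[OF lin(2)])
      then show False using c u(1) by simp
    qed
  qed
  then show ?thesis by (simp add: T_def)
qed

text \<open>On an isotropic hyperplane only the pairing with the missing axis is left; it is one linear condition, so
  some nonzero vector of the hyperplane satisfies it and lies in the kernel of the form.\<close>

lemma isotropic_hyperplane_degenerate:
  fixes \<Omega> :: "real ^ 'n \<Rightarrow> real ^ 'n \<Rightarrow> real"
  assumes n: "CARD('n) = 4" and \<Omega>: "bilinear \<Omega>"
    and iso: "\<And>l m. l \<noteq> j \<Longrightarrow> m \<noteq> j \<Longrightarrow> \<Omega> (axis l 1) (axis m 1) = 0"
  obtains u where "u \<noteq> 0" "\<And>v. \<Omega> u v = 0"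
proof -
  have "card (UNIV - {j}) = 3" using n by (simp add: card_Diff_subset)
  then obtain l m s where lms: "UNIV - {j} = {l, m, s}" "l \<noteq> m" unfolding card_3_iff by blast
  then have lm: "l \<noteq> j" "m \<noteq> j" "l \<noteq> m" by auto
  have crit: "\<Omega> u v = 0" if "\<And>s. \<Omega> u (axis s 1) = 0" for u v
  proof -
    have "\<Omega> u v = \<Omega> u (\<Sum>i\<in>UNIV. (v $ i) *\<^sub>R axis i 1)" by (rule arg_cong[OF vec_axis_expand])
    then show ?thesis using that by (simp add: bilinear_sum_right[OF \<Omega>])
  qed
  let ?a = "\<Omega> (axis m 1) (axis j 1)" and ?b = "\<Omega> (axis l 1) (axis j 1)"
  show ?thesis
  proof (cases "?a = 0")
    case True
    show ?thesis
    proof (rule that)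
      show "axis m 1 \<noteq> (0 :: real ^ 'n)" by (simp add: axis_eq_0_iff)
      show "\<Omega> (axis m 1) v = 0" for v
      proof (rule crit)
        show "\<Omega> (axis m 1) (axis s 1) = 0" for s using True iso[OF lm(2), of s] by (cases "s = j") simp_all
      qed
    qed
  next
    case False
    let ?u = "?a *\<^sub>R axis l 1 - ?b *\<^sub>R axis m 1 :: real ^ 'n"
    show ?thesis
    proof (rule that)
      have "?u $ l = ?a" using lm by (simp add: axis_def)
      then show "?u \<noteq> 0" using False by (metis zero_index)
      show "\<Omega> ?u v = 0" for v
      proof (rule crit)
        fix s
        show "\<Omega> ?u (axis s 1) = 0"
          using iso[OF lm(1), of s] iso[OF lm(2), of s]
          by (cases "s = j") (simp_all add: bilinear_lsub[OF \<Omega>] bilinear_lmul[OF \<Omega>])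
      qed
    qed
  qed
qed

text \<open>On a coordinate plane a skew form is a multiple of the area form. If it is nonzero there, its vanishing on
  \<open>(k, u)\<close> and \<open>(k, v)\<close> makes \<open>u\<close> and \<open>v\<close> multiples of \<open>k\<close>.\<close>

lemma isotropic_plane:
  fixes \<Omega> :: "real ^ 'n \<Rightarrow> real ^ 'n \<Rightarrow> real"
  assumes \<Omega>: "bilinear \<Omega>" "\<And>u. \<Omega> u u = 0" and J: "card (- J) = 2"
    and supp: "\<And>i. i \<in> J \<Longrightarrow> k $ i = 0" "\<And>i. i \<in> J \<Longrightarrow> u $ i = 0" "\<And>i. i \<in> J \<Longrightarrow> v $ i = 0"
    and k: "k \<noteq> 0" "\<Omega> k u = 0" "\<Omega> k v = 0"
  shows "\<Omega> u v = 0"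
proof -
  obtain l m where lm: "- J = {l, m}" "l \<noteq> m" using J by (auto simp: card_2_iff)
  have ex: "x = (x $ l) *\<^sub>R axis l 1 + (x $ m) *\<^sub>R axis m 1" if "\<And>i. i \<in> J \<Longrightarrow> x $ i = 0" for x :: "real ^ 'n"
    unfolding vec_eq_iff
  proof
    fix s
    have "s \<in> J \<or> s = l \<or> s = m" using lm by blast
    then show "x $ s = ((x $ l) *\<^sub>R axis l 1 + (x $ m) *\<^sub>R axis m 1) $ s"
      using that lm by (auto simp: axis_def)
  qed
  let ?w = "\<Omega> (axis l 1) (axis m 1)"
  have "\<Omega> (axis l 1 + axis m 1) (axis l 1 + axis m 1) = ?w + \<Omega> (axis m 1) (axis l 1)"
    using \<Omega>(2)[of "axis l 1"] \<Omega>(2)[of "axis m 1"]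
    by (simp only: bilinear_ladd[OF \<Omega>(1)] bilinear_radd[OF \<Omega>(1)])
  then have skew: "\<Omega> (axis m 1) (axis l 1) = - ?w" unfolding \<Omega>(2) by simp
  have area: "\<Omega> x y = (x $ l * y $ m - x $ m * y $ l) * ?w"
    if "\<And>i. i \<in> J \<Longrightarrow> x $ i = 0" "\<And>i. i \<in> J \<Longrightarrow> y $ i = 0" for x y
  proof -
    have "\<Omega> x y = \<Omega> ((x $ l) *\<^sub>R axis l 1 + (x $ m) *\<^sub>R axis m 1) ((y $ l) *\<^sub>R axis l 1 + (y $ m) *\<^sub>R axis m 1)"
      using ex[OF that(1)] ex[OF that(2)] by simp
    also have "\<dots> = (x $ l * y $ m - x $ m * y $ l) * ?w"
      by (simp add: bilinear_ladd[OF \<Omega>(1)] bilinear_radd[OF \<Omega>(1)] bilinear_lmul[OF \<Omega>(1)]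
          bilinear_rmul[OF \<Omega>(1)] \<Omega>(2) skew algebra_simps)
    finally show ?thesis .
  qed
  show ?thesis
  proof (cases "?w = 0")
    case False
    have 1: "k $ l * u $ m = k $ m * u $ l" "k $ l * v $ m = k $ m * v $ l"
      using area[OF supp(1,2)] area[OF supp(1,3)] k False by simp_all
    have "k $ l \<noteq> 0 \<or> k $ m \<noteq> 0" using ex[OF supp(1)] k(1) by auto
    moreover have "k $ l * (u $ l * v $ m - u $ m * v $ l) = 0" "k $ m * (u $ l * v $ m - u $ m * v $ l) = 0"
      using 1 by algebra+
    ultimately show ?thesis using area[OF supp(2,3)] by auto
  qed (simp add: area[OF supp(2,3)])
qed


section \<open>Two facts on ordinary differential inequalities\<close>

lemma gronwall_zero:
  fixes s D :: "real \<Rightarrow> real"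
  assumes D: "\<And>t. t \<in> {a<..<b} \<Longrightarrow> (s has_real_derivative D t) (at t)"
    and bound: "\<And>t. t \<in> {a<..<b} \<Longrightarrow> \<bar>D t\<bar> \<le> C * s t" and nonneg: "\<And>t. t \<in> {a<..<b} \<Longrightarrow> 0 \<le> s t"
    and t0: "t0 \<in> {a<..<b}" "s t0 = 0" and t: "t \<in> {a<..<b}"
  shows "s t = 0"
proof -
  have "s t \<le> 0"
  proof (cases "t0 \<le> t")
    case True
    have "exp (- C * t) * s t \<le> exp (- C * t0) * s t0"
    proof (rule DERIV_nonpos_imp_nonincreasing[OF True])
      fix x assume "t0 \<le> x" "x \<le> t"
      then have x: "x \<in> {a<..<b}" using t t0 by auto
      have "((\<lambda>t. exp (- C * t) * s t) has_real_derivative exp (- C * x) * (D x - C * s x)) (at x)"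
        by (auto intro!: derivative_eq_intros D[OF x] simp: algebra_simps)
      moreover have "exp (- C * x) * (D x - C * s x) \<le> 0"
        using bound[OF x] by (intro mult_nonneg_nonpos) auto
      ultimately show "\<exists>y. ((\<lambda>t. exp (- C * t) * s t) has_real_derivative y) (at x) \<and> y \<le> 0" by blast
    qed
    then show ?thesis using t0(2) by (simp add: mult_le_0_iff)
  next
    case False
    then have le: "t \<le> t0" by simp
    have "exp (C * t) * s t \<le> exp (C * t0) * s t0"
    proof (rule DERIV_nonneg_imp_nondecreasing[OF le])
      fix x assume "t \<le> x" "x \<le> t0"
      then have x: "x \<in> {a<..<b}" using t t0 by auto
      have "((\<lambda>t. exp (C * t) * s t) has_real_derivative exp (C * x) * (D x + C * s x)) (at x)"
        by (auto intro!: derivative_eq_intros D[OF x] simp: algebra_simps)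
      moreover have "0 \<le> exp (C * x) * (D x + C * s x)"
        using bound[OF x] by (intro mult_nonneg_nonneg) auto
      ultimately show "\<exists>y. ((\<lambda>t. exp (C * t) * s t) has_real_derivative y) (at x) \<and> 0 \<le> y" by blast
    qed
    then show ?thesis using t0(2) by (simp add: mult_le_0_iff)
  qed
  then show ?thesis using nonneg[OF t] by simp
qed

text \<open>As long as \<open>\<theta> < 0\<close>, the function \<open>1 / \<theta> - t / 2\<close> is nondecreasing, so \<open>1 / \<theta>\<close> would reach \<open>0\<close> not later than
  at \<open>t\<^sub>0 - 2 / \<theta>(t\<^sub>0)\<close>.\<close>

lemma riccati_negative_blowup:
  fixes \<theta> D :: "real \<Rightarrow> real"
  assumes D: "\<And>t. (\<theta> has_real_derivative D t) (at t)" and ineq: "\<And>t. D t < - (\<theta> t)\<^sup>2 / 2"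
  shows "0 \<le> \<theta> t0"
proof (rule ccontr)
  assume "\<not> 0 \<le> \<theta> t0"
  then have neg0: "\<theta> t0 < 0" by simp
  have dneg: "D t < 0" for t
    using ineq[of t] by (smt (verit) divide_nonneg_pos minus_divide_left zero_le_power2)
  have neg: "\<theta> t < 0" if "t0 \<le> t" for t
  proof -
    have "\<theta> t \<le> \<theta> t0"
      by (rule DERIV_nonpos_imp_nonincreasing[OF that]) (use D dneg less_imp_le in blast)
    then show ?thesis using neg0 by simp
  qed
  define t1 where "t1 = t0 - 2 / \<theta> t0"
  have t1: "t0 \<le> t1" using neg0 by (simp add: t1_def divide_nonneg_neg)
  have "inverse (\<theta> t0) - t0 / 2 \<le> inverse (\<theta> t1) - t1 / 2"
  proof (rule DERIV_nonneg_imp_nondecreasing[OF t1])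
    fix t assume "t0 \<le> t" "t \<le> t1"
    then have n: "\<theta> t \<noteq> 0" using neg[of t] by simp
    have "((\<lambda>t. inverse (\<theta> t) - t / 2) has_real_derivative - (D t / (\<theta> t)\<^sup>2) - 1 / 2) (at t)"
      using n by (auto intro!: derivative_eq_intros D simp: power2_eq_square field_simps)
    moreover have "0 \<le> - (D t / (\<theta> t)\<^sup>2) - 1 / 2"
      using ineq[of t] n by (simp add: field_simps)
    ultimately show "\<exists>y. ((\<lambda>t. inverse (\<theta> t) - t / 2) has_real_derivative y) (at t) \<and> 0 \<le> y" by blast
  qed
  moreover have "t1 / 2 = t0 / 2 - inverse (\<theta> t0)"
    using neg0 by (simp add: t1_def field_simps)
  ultimately have "0 \<le> inverse (\<theta> t1)" by simp
  then show False using neg[OF t1] by simp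
qed

text \<open>The differential inequality is invariant under \<open>\<theta>(t) \<mapsto> -\<theta>(-t)\<close>, so blow-up in the future of negative
  values also excludes positive values.\<close>

lemma riccati_no_global_solution:
  fixes \<theta> D :: "real \<Rightarrow> real"
  assumes D: "\<And>t. (\<theta> has_real_derivative D t) (at t)" and ineq: "\<And>t. D t < - (\<theta> t)\<^sup>2 / 2"
  shows False
proof -
  have 1: "0 \<le> \<theta> t" for t by (rule riccati_negative_blowup[OF D ineq])
  have "0 \<le> - \<theta> (- t)" for t
  proof (rule riccati_negative_blowup[where \<theta> = "\<lambda>t. - \<theta> (- t)" and D = "\<lambda>t. D (- t)"])
    fix t
    have "((\<lambda>t. \<theta> (- t)) has_real_derivative D (- t) * (- 1)) (at t)"
      by (rule DERIV_chain2[OF D]) (auto intro!: derivative_eq_intros)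
    from DERIV_minus[OF this] show "((\<lambda>t. - \<theta> (- t)) has_real_derivative D (- t)) (at t)" by simp
    show "D (- t) < - (- \<theta> (- t))\<^sup>2 / 2" using ineq[of "- t"] by simp
  qed
  from this[of "- t" for t] have "\<theta> t = 0" for t using 1[of t] by (metis add.inverse_inverse neg_0_le_iff_le order_antisym)
  then have "\<theta> = (\<lambda>t. 0)" by auto
  then have "D 0 = 0" using DERIV_unique[OF D[of 0]] DERIV_const by blast
  then show False using ineq[of 0] \<open>\<theta> = _\<close> by simp
qed

lemma linear_zero_axis:
  fixes \<phi> :: "real ^ 'n \<Rightarrow> real"
  assumes "linear \<phi>" "\<And>i. \<phi> (axis i 1) = 0"
  shows "\<phi> w = 0"
proof -
  have "\<phi> w = \<phi> (\<Sum>i\<in>UNIV. (w $ i) *\<^sub>R axis i 1)" by (rule arg_cong[OF vec_axis_expand])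
  then show ?thesis by (simp add: linear_sum[OF assms(1)] linear_scale[OF assms(1)] assms(2))
qed

section \<open>Differentiation of smooth functions by tangent vectors\<close>

context smooth_manifold
begin

context
  fixes W p v
  assumes W: "open W" "p \<in> W" and v: "v \<in> tangent A p"
begin

lemma D_add: "smooth_fun A W h \<Longrightarrow> smooth_fun A W h' \<Longrightarrow> v (\<lambda>q. h q + h' q) = v h + v h'"
  using tangent_fun_add[OF v] smooth_nearI W by blast

lemma D_mult: "smooth_fun A W h \<Longrightarrow> smooth_fun A W h' \<Longrightarrow> v (\<lambda>q. h q * h' q) = v h * h' p + h p * v h'"
  using tangent_fun_mult[OF v] smooth_nearI W by blast

lemma D_cmult: "smooth_fun A W h \<Longrightarrow> v (\<lambda>q. a * h q) = a * v h"
  using D_mult[OF smooth_fun_const] tangent_fun_const[OF v] by simp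

lemma D_diff:
  assumes "smooth_fun A W h" "smooth_fun A W h'"
  shows "v (\<lambda>q. h q - h' q) = v h - v h'"
proof -
  have "smooth_fun A W (\<lambda>q. (-1) * h' q)" by (rule smooth_fun_mult[OF smooth_fun_const assms(2) W(1)])
  from D_add[OF assms(1) this] show ?thesis using D_cmult[OF assms(2), of "-1"] by simp
qed

lemma D_sum:
  assumes "finite I" "\<And>i. i \<in> I \<Longrightarrow> smooth_fun A W (h i)"
  shows "v (\<lambda>q. \<Sum>i\<in>I. h i q) = (\<Sum>i\<in>I. v (h i))"
  using assms
proof (induction I rule: finite_induct)
  case empty
  then show ?case using tangent_fun_const[OF v, of 0] by simp
next
  case (insert i I)
  then have "smooth_fun A W (\<lambda>q. \<Sum>i\<in>I. h i q)" by (intro smooth_fun_sum W) auto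
  then show ?case using insert D_add[of "h i"] by simp
qed

lemma D_zero: "(\<And>q. q \<in> W \<Longrightarrow> h q = 0) \<Longrightarrow> v h = 0"
  using tangent_local[OF v W, of h "\<lambda>q. 0"] tangent_fun_const[OF v] by simp

lemma D_cong: "(\<And>q. q \<in> W \<Longrightarrow> h q = h' q) \<Longrightarrow> v h = v h'"
  by (rule tangent_local[OF v W])

end

end

section \<open>Null geodesic fields: rotation and expansion\<close>

locale null_geodesic_field = lorentzian_manifold A g nabla
  for A :: "('a::{t2_space, second_countable_topology}, 'n::finite) chart set" and g nabla +
  fixes k :: "'a vfield"
  assumes k_smooth: "smooth_vfield A UNIV k"
    and k_null: "null_vfield g k"
    and k_geodesic: "\<And>p. nabla k k p = tzero"
begin

lemma k_tangent: "k p \<in> tangent A p"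
  using smooth_vfield_tangent[OF k_smooth] by simp

lemma k_smooth_on: "smooth_vfield A W k"
  by (rule smooth_vfield_subset[OF k_smooth]) simp

text \<open>The endomorphism \<open>u \<mapsto> \<nabla>\<^sub>u k\<close> of the tangent space in coordinates.\<close>

definition cov_mat :: "('a, 'n) chart \<Rightarrow> 'a \<Rightarrow> real ^ 'n \<Rightarrow> real ^ 'n" where
  "cov_mat c p w = cmp c (cov k p (dvec c p w))"

text \<open>The two-form \<open>d k\<^sup>\<flat>\<close>.\<close>

definition rot :: "'a \<Rightarrow> 'a tvec \<Rightarrow> 'a tvec \<Rightarrow> real" where
  "rot p u v = g p (cov k p u) v - g p (cov k p v) u"

lemma k_cov_tangent: "u \<in> tangent A p \<Longrightarrow> cov k p u \<in> tangent A p"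
  by (rule cov_tangent[OF open_UNIV UNIV_I k_smooth])

context
  fixes c p
  assumes c: "c \<in> charts" "p \<in> fst c"
begin

lemma cov_mat_linear: "linear (cov_mat c p)"
proof (rule linearI)
  show "cov_mat c p (u + v) = cov_mat c p u + cov_mat c p v" for u v
    using cov_tadd[of k p 1 "dvec c p u" "dvec c p v"] by (simp add: cov_mat_def dvec_scale_add[OF c])
  have "cov k p tzero = tzero" by (simp add: cov_def tzero_def)
  then show "cov_mat c p (a *\<^sub>R u) = a *\<^sub>R cov_mat c p u" for a u
    using cov_tadd[of k p a "dvec c p u" tzero] by (simp add: cov_mat_def dvec_scale_add[OF c])
qed

lemma cov_mat_axis: "cov_mat c p (axis i 1) $ m = nabla (coord_field A c i) k p (coord_fun c m)"
  using cov_coord[OF open_UNIV UNIV_I k_smooth c, of i]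
  by (simp add: cov_mat_def coord_field_dvec) (simp add: cmp_def)

lemma gram_cov: "gram c p (cov_mat c p u) v = g p (cov k p (dvec c p u)) (dvec c p v)"
  using tangent_dvec[OF c k_cov_tangent[OF dvec_tangent[OF c]]] by (simp add: gram_def cov_mat_def)

lemma gram_k: "gram c p (cmp c (k p)) v = g p (k p) (dvec c p v)"
  using tangent_dvec[OF c k_tangent] by (simp add: gram_def)

lemma cov_mat_k: "cov_mat c p (cmp c (k p)) = 0"
proof -
  have "cov k p (k p) = nabla k k p" by (rule cov_field[OF open_UNIV UNIV_I k_smooth k_smooth])
  then show ?thesis using tangent_dvec[OF c k_tangent] k_geodesic by (simp add: cov_mat_def)
qed

lemma k_cmp_nonzero: "cmp c (k p) \<noteq> 0"
proof
  assume "cmp c (k p) = 0"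
  then have "k p = tzero" using tangent_eqI[OF c k_tangent tangent_tzero] by simp
  then show False using k_null by (simp add: null_vfield_def)
qed

lemma gram_k_k: "gram c p (cmp c (k p)) (cmp c (k p)) = 0"
  using g_gram[OF c k_tangent k_tangent] k_null by (simp add: null_vfield_def)

lemma gram_linear: "linear (gram c p u)" "linear (\<lambda>v. gram c p v u)"
  using gram_bilinear[OF c] by (auto simp: bilinear_def)

text \<open>Differentiate \<open>g(k,k) = 0\<close>.\<close>

lemma gram_cov_k: "gram c p (cov_mat c p u) (cmp c (k p)) = 0"
proof (rule linear_zero_axis[of "\<lambda>u. gram c p (cov_mat c p u) (cmp c (k p))"])
  show "linear (\<lambda>u. gram c p (cov_mat c p u) (cmp c (k p)))"
    using linear_compose[OF cov_mat_linear gram_linear(2)] by (simp add: o_def)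
  fix i
  let ?D = "coord_field A c i"
  have N: "nabla ?D k p \<in> tangent A p"
    using k_cov_tangent[OF coord_field_tangent[OF c]] cov_coord[OF open_UNIV UNIV_I k_smooth c] by metis
  have "?D p (\<lambda>q. g q (k q) (k q)) = g p (nabla ?D k p) (k p) + g p (k p) (nabla ?D k p)"
    by (rule nabla_metric[OF open_dom[OF c(1)] smooth_vfield_coord_field[OF c(1)] k_smooth_on k_smooth_on c(2)])
  moreover have "?D p (\<lambda>q. g q (k q) (k q)) = 0"
    by (rule coord_field_const[OF c open_UNIV UNIV_I]) (use k_null in \<open>simp add: null_vfield_def\<close>)
  ultimately have "g p (nabla ?D k p) (k p) = 0" using g_sym[OF N k_tangent] by simp
  then have "g p (cov k p (dvec c p (axis i 1))) (k p) = 0"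
    using cov_coord[OF open_UNIV UNIV_I k_smooth c, of i] by (simp add: coord_field_dvec)
  then show "gram c p (cov_mat c p (axis i 1)) (cmp c (k p)) = 0"
    unfolding gram_cov using tangent_dvec[OF c k_tangent] by simp
qed

definition rot_mat :: "real ^ 'n \<Rightarrow> real ^ 'n \<Rightarrow> real" where
  "rot_mat u v = gram c p (cov_mat c p u) v - gram c p (cov_mat c p v) u"

lemma rot_mat_eq: "rot_mat u v = rot p (dvec c p u) (dvec c p v)"
  by (simp add: rot_mat_def rot_def gram_cov)

lemma rot_mat_bilinear: "bilinear rot_mat"
  unfolding bilinear_def rot_mat_def
  using gram_bilinear[OF c] cov_mat_linear
  by (intro conjI allI linearI)
    (simp_all add: linear_add linear_scale bilinear_ladd bilinear_radd bilinear_lmul bilinear_rmul algebra_simps)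

lemma rot_mat_skew: "rot_mat u v = - rot_mat v u"
  by (simp add: rot_mat_def)

lemma rot_mat_k: "rot_mat (cmp c (k p)) v = 0"
  using cov_mat_k gram_cov_k linear_0[OF gram_linear(2)] by (simp add: rot_mat_def)

end

text \<open>\<open>k\<^sup>\<flat> \<and> d k\<^sup>\<flat>\<close> vanishes at \<open>p\<close>.\<close>

definition twist_free :: "'a \<Rightarrow> bool" where
  "twist_free p \<longleftrightarrow> (\<forall>u\<in>tangent A p. \<forall>v\<in>tangent A p. \<forall>w\<in>tangent A p.
     g p (k p) u * rot p v w + g p (k p) v * rot p w u + g p (k p) w * rot p u v = 0)"

text \<open>Components of \<open>k\<^sup>\<flat>\<close>, of \<open>d k\<^sup>\<flat>\<close> and of \<open>k\<^sup>\<flat> \<and> d k\<^sup>\<flat>\<close> in a chart.\<close>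

definition kflat :: "('a, 'n) chart \<Rightarrow> 'n \<Rightarrow> 'a \<Rightarrow> real" where
  "kflat c i q = g q (k q) (coord_field A c i q)"

definition dk :: "('a, 'n) chart \<Rightarrow> 'n \<Rightarrow> 'n \<Rightarrow> 'a \<Rightarrow> real" where
  "dk c i j q = coord_field A c i q (kflat c j) - coord_field A c j q (kflat c i)"

definition twist :: "('a, 'n) chart \<Rightarrow> 'n \<Rightarrow> 'n \<Rightarrow> 'n \<Rightarrow> 'a \<Rightarrow> real" where
  "twist c i j l q = kflat c i q * dk c j l q + kflat c j q * dk c l i q + kflat c l q * dk c i j q"

lemma dk_rot:
  assumes c: "c \<in> charts" "p \<in> fst c"
  shows "dk c i j p = rot p (coord_field A c i p) (coord_field A c j p)"
  using coord_exterior[OF open_UNIV UNIV_I k_smooth c, of i j] cov_coord[OF open_UNIV UNIV_I k_smooth c]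
  by (simp add: dk_def kflat_def[abs_def] rot_def)

lemma twist_free_chart:
  assumes c: "c \<in> charts" "p \<in> fst c"
  shows "twist_free p \<longleftrightarrow> (\<forall>i j l. twist c i j l p = 0)"
proof
  assume "twist_free p"
  then show "\<forall>i j l. twist c i j l p = 0"
    using coord_field_tangent[OF c] by (simp add: twist_free_def twist_def kflat_def dk_rot[OF c])
next
  assume 0: "\<forall>i j l. twist c i j l p = 0"
  define T where "T u v w = gram c p (cmp c (k p)) u * rot_mat c p v w
     + gram c p (cmp c (k p)) v * rot_mat c p w u + gram c p (cmp c (k p)) w * rot_mat c p u v" for u v w
  have cyc: "T u v w = T v w u" for u v w by (simp add: T_def)
  have lin: "linear (\<lambda>u. T u v w)" for v w
    using gram_bilinear[OF c] rot_mat_bilinear[OF c] unfolding T_def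
    by (intro linearI) (simp_all add: bilinear_ladd bilinear_radd bilinear_lmul bilinear_rmul algebra_simps)
  have ax: "T (axis i 1) (axis j 1) (axis l 1) = 0" for i j l
    using 0[rule_format, of i j l]
    by (simp add: T_def twist_def kflat_def gram_k[OF c] rot_mat_eq[OF c] dk_rot[OF c] coord_field_dvec)
  have 1: "T u (axis j 1) (axis l 1) = 0" for u j l
    using linear_zero_axis[OF lin] ax by blast
  have 2: "T u v (axis l 1) = 0" for u v l
    using linear_zero_axis[OF lin, of "axis l 1" u v] 1 cyc by metis
  have 3: "T u v w = 0" for u v w
    using linear_zero_axis[OF lin, of u v w] 2 cyc by metis
  show "twist_free p"
    unfolding twist_free_def
  proof (intro ballI)
    fix u v w assume "u \<in> tangent A p" "v \<in> tangent A p" "w \<in> tangent A p"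
    then have "u = dvec c p (cmp c u)" "v = dvec c p (cmp c v)" "w = dvec c p (cmp c w)"
      using tangent_dvec[OF c] by auto
    then show "g p (k p) u * rot p v w + g p (k p) v * rot p w u + g p (k p) w * rot p u v = 0"
      using 3[of "cmp c u" "cmp c v" "cmp c w"] by (simp add: T_def gram_k[OF c] rot_mat_eq[OF c])
  qed
qed

subsection \<open>Transport of the twist along the flow\<close>

context
  fixes c
  assumes c: "c \<in> charts"
begin

abbreviation (input) "D \<equiv> coord_field A c"
abbreviation (input) "K i \<equiv> (\<lambda>q. k q (coord_fun c i))"

lemma D_field: "smooth_vfield A (fst c) (D i)"
  by (rule smooth_vfield_coord_field[OF c])

lemma D_smooth: "smooth_fun A (fst c) h \<Longrightarrow> smooth_fun A (fst c) (\<lambda>q. D i q h)"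
  by (rule smooth_vfield_fun[OF D_field open_dom[OF c] subset_refl])

lemma K_smooth: "smooth_fun A (fst c) (K i)"
  by (rule smooth_vfield_fun[OF k_smooth_on open_dom[OF c] subset_refl smooth_fun_coord[OF c]])

lemma kflat_smooth: "smooth_fun A (fst c) (kflat c i)"
  unfolding kflat_def[abs_def] by (rule g_smooth[OF open_dom[OF c] k_smooth_on D_field])

lemma dk_smooth: "smooth_fun A (fst c) (dk c i j)"
  unfolding dk_def[abs_def] by (intro smooth_fun_diff D_smooth kflat_smooth open_dom[OF c])

lemma twist_smooth: "smooth_fun A (fst c) (twist c i j l)"
  unfolding twist_def[abs_def]
  by (intro smooth_fun_add smooth_fun_mult kflat_smooth dk_smooth open_dom[OF c])

lemma dk_skew: "dk c i j q = - dk c j i q"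
  by (simp add: dk_def)

lemma K_kflat: "q \<in> fst c \<Longrightarrow> (\<Sum>i\<in>UNIV. K i q * kflat c i q) = 0"
  using g_coord_sum[OF c _ k_tangent k_tangent, of q] k_null by (simp add: kflat_def null_vfield_def)

lemma K_dk:
  assumes q: "q \<in> fst c"
  shows "(\<Sum>i\<in>UNIV. K i q * dk c i j q) = 0"
proof -
  have "cmp c (k q) = (\<Sum>i\<in>UNIV. K i q *\<^sub>R axis i 1)"
    by (subst vec_axis_expand) (simp add: cmp_def)
  then have "rot_mat c q (cmp c (k q)) (axis j 1) = (\<Sum>i\<in>UNIV. K i q * rot_mat c q (axis i 1) (axis j 1))"
    using bilinear_sum_left[OF rot_mat_bilinear[OF c q]] by simp
  then show ?thesis
    using rot_mat_k[OF c q] by (simp add: rot_mat_eq[OF c q] dk_rot[OF c q] coord_field_dvec)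
qed

context
  fixes p
  assumes p: "p \<in> fst c"
begin

lemma Dp: "D i p \<in> tangent A p"
  by (rule coord_field_tangent[OF c p])

lemmas rules_D = D_add[OF open_dom[OF c] p Dp] D_mult[OF open_dom[OF c] p Dp] D_diff[OF open_dom[OF c] p Dp]
  D_sum[OF open_dom[OF c] p Dp] D_zero[OF open_dom[OF c] p Dp]

lemma k_expand: "k p h = (\<Sum>i\<in>UNIV. K i p * D i p h)"
  by (rule tangent_expand[OF c p k_tangent])

text \<open>The product rule for \<open>i\<^sub>k \<phi> = 0\<close>.\<close>

lemma move_derivative:
  assumes "\<And>i. smooth_fun A (fst c) (\<phi> i)" "\<And>q. q \<in> fst c \<Longrightarrow> (\<Sum>i\<in>UNIV. K i q * \<phi> i q) = 0"
  shows "(\<Sum>i\<in>UNIV. K i p * D j p (\<phi> i)) = - (\<Sum>i\<in>UNIV. D j p (K i) * \<phi> i p)"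
proof -
  have "0 = D j p (\<lambda>q. \<Sum>i\<in>UNIV. K i q * \<phi> i q)" using rules_D(5) assms(2) by simp
  also have "\<dots> = (\<Sum>i\<in>UNIV. D j p (\<lambda>q. K i q * \<phi> i q))"
    by (rule rules_D(4)) (auto intro: smooth_fun_mult K_smooth assms(1) open_dom[OF c])
  also have "\<dots> = (\<Sum>i\<in>UNIV. D j p (K i) * \<phi> i p) + (\<Sum>i\<in>UNIV. K i p * D j p (\<phi> i))"
    using rules_D(2)[OF K_smooth assms(1)] by (simp add: sum.distrib)
  finally show ?thesis by simp
qed

text \<open>Cartan's formula \<open>L\<^sub>k = d i\<^sub>k + i\<^sub>k d\<close> gives \<open>L\<^sub>k k\<^sup>\<flat> = 0\<close> and hence \<open>L\<^sub>k dk\<^sup>\<flat> = 0\<close>. In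
  coordinates, \<open>i\<^sub>k k\<^sup>\<flat> = 0\<close> and \<open>i\<^sub>k dk\<^sup>\<flat> = 0\<close> enter through \<open>move_derivative\<close>.\<close>

lemma k_kflat: "k p (kflat c j) = - (\<Sum>i\<in>UNIV. D j p (K i) * kflat c i p)"
proof -
  have "k p (kflat c j) = (\<Sum>i\<in>UNIV. K i p * dk c i j p) + (\<Sum>i\<in>UNIV. K i p * D j p (kflat c i))"
    by (subst k_expand) (simp add: dk_def sum.distrib[symmetric] algebra_simps)
  then show ?thesis using K_dk[OF p] move_derivative[OF kflat_smooth K_kflat] by simp
qed

lemma curl_closed:
  assumes \<phi>: "\<And>i. smooth_fun A (fst c) (\<phi> i)"
  shows "D i p (\<lambda>q. D j q (\<phi> l) - D l q (\<phi> j)) + D j p (\<lambda>q. D l q (\<phi> i) - D i q (\<phi> l))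
    + D l p (\<lambda>q. D i q (\<phi> j) - D j q (\<phi> i)) = 0"
proof -
  have near: "smooth_near A p (\<phi> i)" for i
    by (rule smooth_nearI[OF \<phi> open_dom[OF c] p])
  have "D i p (\<lambda>q. D j q (\<phi> l) - D l q (\<phi> j)) = D i p (\<lambda>q. D j q (\<phi> l)) - D i p (\<lambda>q. D l q (\<phi> j))" for i j l
    by (rule rules_D(3)[OF D_smooth D_smooth]) (rule \<phi>)+
  then show ?thesis using coord_commute[OF c p near] by simp
qed

lemma dk_closed: "D i p (dk c j l) + D j p (dk c l i) + D l p (dk c i j) = 0"
  unfolding dk_def[abs_def] by (rule curl_closed[OF kflat_smooth])

lemma k_dk: "k p (dk c j l) = - (\<Sum>m\<in>UNIV. D j p (K m) * dk c m l p + D l p (K m) * dk c j m p)"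
proof -
  have skew: "D i p (dk c a b) = - D i p (dk c b a)" for i a b
  proof -
    have "D i p (dk c a b) = D i p (\<lambda>q. (-1) * dk c b a q)"
      by (rule arg_cong[of _ _ "D i p"]) (simp add: fun_eq_iff dk_skew[of a b])
    also have "\<dots> = - D i p (dk c b a)" using D_cmult[OF open_dom[OF c] p Dp dk_smooth, of i "-1" b a] by simp
    finally show ?thesis .
  qed
  have eq: "D i p (dk c j l) = D j p (dk c i l) - D l p (dk c i j)" for i
    using dk_closed[of i j l] skew[of j l i] by simp
  have "k p (dk c j l) = (\<Sum>i\<in>UNIV. K i p * D j p (dk c i l)) - (\<Sum>i\<in>UNIV. K i p * D l p (dk c i j))"
    by (subst k_expand) (simp only: eq right_diff_distrib sum_subtractf)
  also have "\<dots> = - (\<Sum>m\<in>UNIV. D j p (K m) * dk c m l p) + (\<Sum>m\<in>UNIV. D l p (K m) * dk c m j p)"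
    using move_derivative[OF dk_smooth K_dk] by simp
  also have "\<dots> = - (\<Sum>m\<in>UNIV. D j p (K m) * dk c m l p + D l p (K m) * dk c j m p)"
    by (simp add: sum.distrib dk_skew[of j] sum_negf sum_subtractf)
  finally show ?thesis .
qed

lemma k_twist:
  "k p (twist c i j l) = - (\<Sum>m\<in>UNIV. D i p (K m) * twist c m j l p + D j p (K m) * twist c i m l p
     + D l p (K m) * twist c i j m p)"
proof -
  have S: "smooth_fun A (fst c) (\<lambda>q. kflat c a q * dk c d e q)" for a d e
    by (rule smooth_fun_mult[OF kflat_smooth dk_smooth open_dom[OF c]])
  note add = D_add[OF open_dom[OF c] p k_tangent]
  have "k p (twist c i j l) = k p (\<lambda>q. kflat c i q * dk c j l q) + k p (\<lambda>q. kflat c j q * dk c l i q)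
     + k p (\<lambda>q. kflat c l q * dk c i j q)"
    unfolding twist_def[abs_def] add[OF smooth_fun_add[OF S S open_dom[OF c]] S] add[OF S S] ..
  also have "\<dots> = k p (kflat c i) * dk c j l p + kflat c i p * k p (dk c j l)
     + (k p (kflat c j) * dk c l i p + kflat c j p * k p (dk c l i))
     + (k p (kflat c l) * dk c i j p + kflat c l p * k p (dk c i j))"
    unfolding D_mult[OF open_dom[OF c] p k_tangent kflat_smooth dk_smooth] ..
  also have "\<dots> = - (\<Sum>m\<in>UNIV. D i p (K m) * twist c m j l p + D j p (K m) * twist c i m l p
     + D l p (K m) * twist c i j m p)"
    unfolding k_kflat k_dk twist_def
    by (simp add: sum_distrib_left sum_distrib_right sum_negf[symmetric] sum.distrib[symmetric] algebra_simps)
  finally show ?thesis .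
qed

end

end

end


context null_geodesic_field
begin

lemma abs_le_sqrt_sum:
  assumes "finite I" "x \<in> I"
  shows "\<bar>T x :: real\<bar> \<le> sqrt (\<Sum>x\<in>I. (T x)\<^sup>2)"
proof (rule real_le_rsqrt)
  show "\<bar>T x\<bar>\<^sup>2 \<le> (\<Sum>x\<in>I. (T x)\<^sup>2)"
    using member_le_sum[of x I "\<lambda>x. (T x)\<^sup>2"] assms by simp
qed

text \<open>The twist components satisfy a linear homogeneous system along integral curves of \<open>k\<close>, so the sum of
  their squares obeys a Gronwall inequality.\<close>

lemma twist_free_open:
  assumes \<gamma>: "smooth_curve A UNIV \<gamma>" "\<And>t. velocity A \<gamma> t = k (\<gamma> t)" and t0: "twist_free (\<gamma> t0)"
  shows "\<exists>\<delta>>0. \<forall>t\<in>{t0 - \<delta><..<t0 + \<delta>}. twist_free (\<gamma> t)"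
proof -
  define c where "c = chart_at A (\<gamma> t0)"
  have c: "c \<in> charts" "\<gamma> t0 \<in> fst c" using chart_at_charts chart_at_in by (auto simp: c_def)
  define T where "T x = twist c (fst x) (fst (snd x)) (snd (snd x))" for x :: "'n \<times> 'n \<times> 'n"
  define s where "s q = (\<Sum>x\<in>UNIV. (T x q)\<^sup>2)" for q
  define N where "N q = (\<Sum>i\<in>UNIV. \<Sum>m\<in>UNIV. \<bar>coord_field A c i q (\<lambda>q. k q (coord_fun c m))\<bar>)" for q
  have along: "((\<lambda>t. h (\<gamma> t)) has_real_derivative k (\<gamma> t) h) (at t)"
    if "smooth_fun A (fst c) h" "\<gamma> t \<in> fst c" for h t
    using smooth_along_curve_has_derivative[OF \<gamma>(1) open_UNIV UNIV_I smooth_nearI[OF that(1) open_dom[OF c(1)] that(2)]] \<gamma>(2)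
    by simp
  have "isCont (\<lambda>t. N (\<gamma> t)) t0"
    unfolding N_def
    by (intro isCont_sum continuous_intros DERIV_isCont[OF along] D_smooth K_smooth c)
  then have "eventually (\<lambda>t. N (\<gamma> t) < N (\<gamma> t0) + 1) (at t0)"
    using order_tendstoD(2)[of "\<lambda>t. N (\<gamma> t)" "N (\<gamma> t0)" "at t0" "N (\<gamma> t0) + 1"] by (simp add: isCont_def)
  moreover have "eventually (\<lambda>t. \<gamma> t \<in> fst c) (at t0)"
    using curve_vimage_open[OF \<gamma>(1) open_UNIV open_dom[OF c(1)]] c(2)
    by (auto simp: eventually_at_topological)
  ultimately have "eventually (\<lambda>t. N (\<gamma> t) < N (\<gamma> t0) + 1 \<and> \<gamma> t \<in> fst c) (at t0)"
    by (rule eventually_conj)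
  then obtain \<delta> where \<delta>: "\<delta> > 0" "\<And>t. t \<noteq> t0 \<Longrightarrow> dist t t0 < \<delta> \<Longrightarrow> N (\<gamma> t) < N (\<gamma> t0) + 1 \<and> \<gamma> t \<in> fst c"
    unfolding eventually_at by auto
  let ?I = "{t0 - \<delta><..<t0 + \<delta>}"
  have "N (\<gamma> t) \<le> N (\<gamma> t0) + 1 \<and> \<gamma> t \<in> fst c" if "t \<in> ?I" for t
  proof (cases "t = t0")
    case False
    have "\<bar>t - t0\<bar> < \<delta>" using that by (simp add: abs_less_iff)
    then show ?thesis using \<delta>(2)[OF False] by (simp add: dist_real_def less_imp_le)
  qed (simp add: c(2))
  then have I: "N (\<gamma> t) \<le> N (\<gamma> t0) + 1" "\<gamma> t \<in> fst c" if "t \<in> ?I" for t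
    using that by simp_all
  define E where "E t = (\<Sum>x\<in>UNIV. 2 * T x (\<gamma> t) * k (\<gamma> t) (T x))" for t
  \<comment> \<open>Each of the three terms of \<open>k_twist\<close> is at most \<open>N * sqrt s\<close>, and \<open>E\<close> has one summand per triple of indices.\<close>
  let ?C = "6 * real CARD('n \<times> 'n \<times> 'n) * (N (\<gamma> t0) + 1)"
  have s0: "s q = 0 \<longleftrightarrow> twist_free q" if "q \<in> fst c" for q
    unfolding twist_free_chart[OF c(1) that] s_def T_def by (subst sum_nonneg_eq_0_iff) auto
  have "s (\<gamma> t) = 0" if t: "t \<in> ?I" for t
  proof (rule gronwall_zero[of "t0 - \<delta>" "t0 + \<delta>" "\<lambda>t. s (\<gamma> t)" E ?C t0])
    fix t assume t: "t \<in> ?I"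
    let ?q = "\<gamma> t"
    have q: "?q \<in> fst c" by (rule I(2)[OF t])
    show "((\<lambda>t. s (\<gamma> t)) has_real_derivative E t) (at t)"
      unfolding s_def E_def
      by (rule DERIV_sum) (auto intro!: derivative_eq_intros along[OF _ q] twist_smooth c simp: T_def)
    show "0 \<le> s (\<gamma> t)" by (simp add: s_def sum_nonneg)
    have Tb: "\<bar>twist c i j l ?q\<bar> \<le> sqrt (s ?q)" for i j l
      using abs_le_sqrt_sum[of UNIV "(i, j, l)" "\<lambda>x. T x ?q"] by (simp add: s_def T_def)
    let ?d = "\<lambda>i m. coord_field A c i ?q (\<lambda>q. k q (coord_fun c m))"
    have db: "(\<Sum>m\<in>UNIV. \<bar>?d i m\<bar>) \<le> N ?q" for i
      unfolding N_def by (rule member_le_sum[of i UNIV "\<lambda>i. \<Sum>m\<in>UNIV. \<bar>?d i m\<bar>"]) (auto intro: sum_nonneg)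
    have kT: "\<bar>k ?q (T x)\<bar> \<le> 3 * N ?q * sqrt (s ?q)" for x
    proof -
      obtain i j l where x: "x = (i, j, l)" by (cases x)
      have "\<bar>k ?q (T x)\<bar> = \<bar>\<Sum>m\<in>UNIV. ?d i m * twist c m j l ?q + ?d j m * twist c i m l ?q + ?d l m * twist c i j m ?q\<bar>"
        using k_twist[OF c(1) q, of i j l] by (simp add: T_def x)
      also have "\<dots> \<le> (\<Sum>m\<in>UNIV. \<bar>?d i m * twist c m j l ?q + ?d j m * twist c i m l ?q + ?d l m * twist c i j m ?q\<bar>)"
        by (rule sum_abs)
      also have "\<dots> \<le> (\<Sum>m\<in>UNIV. (\<bar>?d i m\<bar> + \<bar>?d j m\<bar> + \<bar>?d l m\<bar>) * sqrt (s ?q))"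
      proof (rule sum_mono)
        fix m
        have "\<bar>?d i m * twist c m j l ?q + ?d j m * twist c i m l ?q + ?d l m * twist c i j m ?q\<bar>
            \<le> \<bar>?d i m\<bar> * \<bar>twist c m j l ?q\<bar> + \<bar>?d j m\<bar> * \<bar>twist c i m l ?q\<bar> + \<bar>?d l m\<bar> * \<bar>twist c i j m ?q\<bar>"
          by (simp only: abs_mult[symmetric])
        also have "\<dots> \<le> \<bar>?d i m\<bar> * sqrt (s ?q) + \<bar>?d j m\<bar> * sqrt (s ?q) + \<bar>?d l m\<bar> * sqrt (s ?q)"
          by (intro add_mono mult_left_mono Tb abs_ge_zero)
        finally show "\<bar>?d i m * twist c m j l ?q + ?d j m * twist c i m l ?q + ?d l m * twist c i j m ?q\<bar>
            \<le> (\<bar>?d i m\<bar> + \<bar>?d j m\<bar> + \<bar>?d l m\<bar>) * sqrt (s ?q)" by (simp add: algebra_simps)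
      qed
      also have "\<dots> = ((\<Sum>m\<in>UNIV. \<bar>?d i m\<bar>) + (\<Sum>m\<in>UNIV. \<bar>?d j m\<bar>) + (\<Sum>m\<in>UNIV. \<bar>?d l m\<bar>)) * sqrt (s ?q)"
        by (simp add: sum.distrib sum_distrib_right[symmetric])
      also have "\<dots> \<le> (3 * N ?q) * sqrt (s ?q)"
        using db[of i] db[of j] db[of l] by (intro mult_right_mono) (auto simp: s_def sum_nonneg)
      finally show ?thesis .
    qed
    have "\<bar>E t\<bar> \<le> (\<Sum>x\<in>UNIV. \<bar>2 * T x ?q * k ?q (T x)\<bar>)" unfolding E_def by (rule sum_abs)
    also have "\<dots> \<le> (\<Sum>x\<in>(UNIV :: ('n \<times> 'n \<times> 'n) set). 6 * N ?q * s ?q)"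
    proof (rule sum_mono)
      fix x :: "'n \<times> 'n \<times> 'n"
      have "\<bar>T x ?q\<bar> * \<bar>k ?q (T x)\<bar> \<le> sqrt (s ?q) * (3 * N ?q * sqrt (s ?q))"
        using Tb[of "fst x" "fst (snd x)" "snd (snd x)"] kT[of x]
        by (intro mult_mono) (auto simp: T_def s_def sum_nonneg)
      also have "\<dots> = 3 * N ?q * s ?q" by (simp add: s_def sum_nonneg)
      finally show "\<bar>2 * T x ?q * k ?q (T x)\<bar> \<le> 6 * N ?q * s ?q" by (simp add: abs_mult)
    qed
    also have "\<dots> = (6 * real CARD('n \<times> 'n \<times> 'n) * s ?q) * N ?q" by simp
    also have "\<dots> \<le> (6 * real CARD('n \<times> 'n \<times> 'n) * s ?q) * (N (\<gamma> t0) + 1)"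
      using I(1)[OF t] by (intro mult_left_mono) (auto simp: s_def sum_nonneg)
    finally show "\<bar>E t\<bar> \<le> ?C * s (\<gamma> t)" by (simp add: mult_ac)
  qed (use \<delta>(1) t t0 s0[OF c(2)] in auto)
  then show ?thesis using \<delta>(1) s0 I(2) by blast
qed

text \<open>The parameters at which the twist vanishes form a closed set by continuity, and an open one.\<close>

lemma twist_free_propagates:
  assumes \<gamma>: "smooth_curve A UNIV \<gamma>" "\<And>t. velocity A \<gamma> t = k (\<gamma> t)" and t0: "twist_free (\<gamma> t0)"
  shows "twist_free (\<gamma> t)"
proof -
  let ?Z = "{t. twist_free (\<gamma> t)}"
  have "open ?Z"
    unfolding open_dist
  proof
    fix t assume "t \<in> ?Z"
    then obtain \<delta> where \<delta>: "\<delta> > 0" "\<forall>y\<in>{t - \<delta><..<t + \<delta>}. twist_free (\<gamma> y)"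
      using twist_free_open[OF \<gamma>] by blast
    have "y \<in> ?Z" if "dist y t < \<delta>" for y
    proof -
      have "y \<in> {t - \<delta><..<t + \<delta>}" using that by (simp add: dist_real_def abs_less_iff)
      then show ?thesis using \<delta>(2) by simp
    qed
    then show "\<exists>e>0. \<forall>y. dist y t < e \<longrightarrow> y \<in> ?Z" using \<delta>(1) by blast
  qed
  moreover have "open (- ?Z)"
  proof (subst open_subopen, intro ballI)
    fix t assume t: "t \<in> - ?Z"
    define c where "c = chart_at A (\<gamma> t)"
    have c: "c \<in> charts" "\<gamma> t \<in> fst c" using chart_at_charts chart_at_in by (auto simp: c_def)
    obtain i j l where ne: "twist c i j l (\<gamma> t) \<noteq> 0" using t twist_free_chart[OF c] by auto
    let ?V = "{s \<in> \<gamma> -` fst c. twist c i j l (\<gamma> s) \<noteq> 0}"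
    have o: "open (\<gamma> -` fst c)" using curve_vimage_open[OF \<gamma>(1) open_UNIV open_dom[OF c(1)]] by simp
    have "continuous_on (\<gamma> -` fst c) (\<lambda>s. twist c i j l (\<gamma> s))"
    proof (intro continuous_at_imp_continuous_on ballI)
      fix s assume "s \<in> \<gamma> -` fst c"
      then have "smooth_near A (\<gamma> s) (twist c i j l)"
        using smooth_nearI[OF twist_smooth[OF c(1)] open_dom[OF c(1)]] by simp
      from smooth_along_curve_has_derivative[OF \<gamma>(1) open_UNIV UNIV_I this]
      show "isCont (\<lambda>s. twist c i j l (\<gamma> s)) s" by (rule DERIV_isCont)
    qed
    then have "open ((\<lambda>s. twist c i j l (\<gamma> s)) -` (- {0}) \<inter> \<gamma> -` fst c)"
      using continuous_on_open_vimage[OF o] open_Compl[OF closed_singleton] by blast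
    moreover have "?V = (\<lambda>s. twist c i j l (\<gamma> s)) -` (- {0}) \<inter> \<gamma> -` fst c" by auto
    ultimately have "open ?V" by simp
    moreover have "t \<in> ?V" using ne c(2) by simp
    moreover have "?V \<subseteq> - ?Z" using twist_free_chart[OF c(1)] by auto
    ultimately show "\<exists>V. open V \<and> t \<in> V \<and> V \<subseteq> - ?Z" by blast
  qed
  ultimately have "?Z = {} \<or> ?Z = UNIV" using clopen[of ?Z] by (simp add: closed_def)
  then show ?thesis using t0 by auto
qed

subsection \<open>The Raychaudhuri equation\<close>

definition expansion :: "'a \<Rightarrow> real" where
  "expansion p = ltrace (cov_mat (chart_at A p) p)"

text \<open>The expansion will be differentiated along curves that need not stay in one chart, so its values in different charts
  must agree. Both are traces over the same pseudo-orthonormal basis.\<close>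

lemma lorentz_form_change_chart:
  assumes c: "c \<in> charts" "p \<in> fst c" and d: "d \<in> charts" "p \<in> fst d"
    and e: "lorentz_form (gram c p) e i0"
  shows "lorentz_form (gram d p) (\<lambda>i. cmp d (dvec c p (e i))) i0"
proof -
  have T: "dvec c p u \<in> tangent A p" "dvec d p u \<in> tangent A p" for u
    using dvec_tangent c d by auto
  have lin: "linear (\<lambda>u. cmp d (dvec c p u))"
    by (intro linearI) (simp_all add: dvec_scale_add[OF c])
  have "gram d p (cmp d (dvec c p u)) (cmp d (dvec c p v)) = gram c p u v" for u v
    using g_gram[OF d T(1) T(1), of u v] by (simp add: gram_def[of c])
  moreover have "\<exists>a. w = (\<Sum>i\<in>UNIV. a i *\<^sub>R cmp d (dvec c p (e i)))" for w
  proof -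
    obtain a where a: "cmp c (dvec d p w) = (\<Sum>i\<in>UNIV. a i *\<^sub>R e i)"
      using e unfolding lorentz_form_def by blast
    have "w = cmp d (dvec d p w)" using cmp_dvec[OF d] by simp
    also have "dvec d p w = dvec c p (cmp c (dvec d p w))" by (rule tangent_dvec[OF c T(2)])
    also have "cmp d (dvec c p (cmp c (dvec d p w))) = (\<Sum>i\<in>UNIV. a i *\<^sub>R cmp d (dvec c p (e i)))"
      unfolding a using linear_sum[OF lin, of "\<lambda>i. a i *\<^sub>R e i" UNIV] linear_scale[OF lin] by simp
    finally show ?thesis by blast
  qed
  moreover have "gram d p u v = gram d p v u" for u v using g_sym[OF T(2) T(2)] by (simp add: gram_def)
  ultimately show ?thesis
    using gram_bilinear[OF d] e unfolding lorentz_form_def by simp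
qed

lemma expansion_chart:
  assumes c: "c \<in> charts" "p \<in> fst c"
  shows "expansion p = ltrace (cov_mat c p)"
proof -
  let ?d = "chart_at A p"
  note d = chart_at_charts[of p] chart_at_in(2)[of p]
  obtain e i0 where e: "lorentz_form (gram c p) e i0" using gram_lorentz[OF c] .
  let ?e = "\<lambda>i. cmp ?d (dvec c p (e i))"
  have eq: "dvec ?d p (?e i) = dvec c p (e i)" for i
    using tangent_dvec[OF d dvec_tangent[OF c]] by simp
  have "gram ?d p (?e i) (?e i) = gram c p (e i) (e i)" for i
    by (simp add: gram_def eq)
  moreover have "gram ?d p (cov_mat ?d p (?e i)) (?e i) = gram c p (cov_mat c p (e i)) (e i)" for i
    by (simp add: gram_cov[OF d] gram_cov[OF c] eq)
  ultimately show ?thesis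
    unfolding expansion_def ltrace_lorentz[OF e cov_mat_linear[OF c]]
      ltrace_lorentz[OF lorentz_form_change_chart[OF c d e] cov_mat_linear[OF d]] by simp
qed

lemma expansion_coord:
  assumes c: "c \<in> charts" "p \<in> fst c"
  shows "expansion p = (\<Sum>i\<in>UNIV. nabla (coord_field A c i) k p (coord_fun c i))"
  by (simp add: expansion_chart[OF c] ltrace_def cov_mat_axis[OF c])

lemma nabla_k_smooth:
  assumes c: "c \<in> charts"
  shows "smooth_vfield A (fst c) (nabla (coord_field A c i) k)"
    "smooth_fun A (fst c) (\<lambda>q. nabla (coord_field A c i) k q (coord_fun c m))"
proof -
  show 1: "smooth_vfield A (fst c) (nabla (coord_field A c i) k)"
    by (rule nabla_smooth[OF open_dom[OF c] smooth_vfield_coord_field[OF c] k_smooth_on])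
  show "smooth_fun A (fst c) (\<lambda>q. nabla (coord_field A c i) k q (coord_fun c m))"
    by (rule smooth_vfield_fun[OF 1 open_dom[OF c] subset_refl smooth_fun_coord[OF c]])
qed

lemma expansion_smooth:
  assumes c: "c \<in> charts"
  shows "smooth_fun A (fst c) expansion"
proof (rule smooth_fun_cong[OF _ open_dom[OF c]])
  show "smooth_fun A (fst c) (\<lambda>q. \<Sum>i\<in>UNIV. nabla (coord_field A c i) k q (coord_fun c i))"
    by (intro smooth_fun_sum nabla_k_smooth c open_dom finite)
qed (rule expansion_coord[OF c, symmetric])

text \<open>Since \<open>\<nabla>\<^sub>k k = 0\<close>, the curvature endomorphism is \<open>R(X,k)k = -(\<nabla>\<^sub>k B)X - B\<^sup>2X\<close> for \<open>B = \<nabla>k\<close>; here its trace is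
  taken in coordinates.\<close>

lemma raychaudhuri:
  fixes p
  defines "c \<equiv> chart_at A p"
  shows "ricci A nabla k k p = - k p expansion - ltrace (\<lambda>u. cov_mat c p (cov_mat c p u))"
proof -
  have c: "c \<in> charts" "p \<in> fst c" using chart_at_charts chart_at_in by (auto simp: c_def)
  let ?D = "coord_field A c" and ?x = "coord_fun c"
  let ?K = "\<lambda>i q. k q (?x i)"
  let ?B = "\<lambda>i m q. nabla (?D i) k q (?x m)"
  let ?d = "\<lambda>i m. ?D i p (?K m)"
  note o = open_dom[OF c(1)]
  note D = D_field[OF c(1)]
  have Bd: "?B l m p - ?d l m = (\<Sum>j\<in>UNIV. ?K j p * christoffel c j l m p)" for l m
  proof -
    have "?B l m p = ?d l m + (\<Sum>i\<in>UNIV. \<Sum>j\<in>UNIV. ?D l p (?x i) * ?K j p * christoffel c i j m p)"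
      by (rule nabla_expand[OF c o c(2) D k_smooth_on])
    also have "(\<Sum>i\<in>UNIV. \<Sum>j\<in>UNIV. ?D l p (?x i) * ?K j p * christoffel c i j m p)
        = (\<Sum>i\<in>UNIV. if i = l then \<Sum>j\<in>UNIV. ?K j p * christoffel c l j m p else 0)"
      by (rule sum.cong) (auto simp: coord_field_coord[OF c])
    finally show ?thesis by (simp add: christoffel_sym[OF c, of l])
  qed
  have t1: "nabla (?D i) (nabla k k) p h = 0" for i h
  proof -
    have "nabla k k = (\<lambda>q. tzero)" using k_geodesic by auto
    then show ?thesis using nabla_tzero_right[OF o D c(2)] by (simp add: tzero_def)
  qed
  have t2: "nabla k (nabla (?D i) k) p (?x m) = k p (?B i m) + (\<Sum>l\<in>UNIV. ?B i l p * (?B l m p - ?d l m))" for i m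
  proof -
    have "nabla k (nabla (?D i) k) p (?x m) = k p (?B i m)
        + (\<Sum>j\<in>UNIV. \<Sum>l\<in>UNIV. ?K j p * ?B i l p * christoffel c j l m p)"
      by (rule nabla_expand[OF c o c(2) k_smooth_on nabla_k_smooth(1)[OF c(1)]])
    also have "(\<Sum>j\<in>UNIV. \<Sum>l\<in>UNIV. ?K j p * ?B i l p * christoffel c j l m p)
        = (\<Sum>l\<in>UNIV. ?B i l p * (\<Sum>j\<in>UNIV. ?K j p * christoffel c j l m p))"
      unfolding sum_distrib_left by (subst sum.swap) (simp add: mult_ac)
    finally show ?thesis by (simp add: Bd)
  qed
  have t3: "nabla (lie_bracket A (?D i) k) k p (?x m) = (\<Sum>j\<in>UNIV. ?d i j * ?B j m p)" for i m
  proof -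
    have "lie_bracket A (?D i) k p (?x j) = ?d i j" for j
    proof -
      have "k p (\<lambda>q. ?D i q (?x j)) = k p (\<lambda>q. if i = j then 1 else 0)"
        by (rule tangent_local[OF k_tangent o c(2)]) (simp add: coord_field_coord[OF c(1)])
      then show ?thesis
        using cmp_lie_bracket[OF o D k_smooth_on c(2) c] tangent_fun_const[OF k_tangent] by simp
    qed
    then show ?thesis
      using nabla_expand_left[OF c o c(2) lie_bracket_smooth[OF o D k_smooth_on] k_smooth_on] by simp
  qed
  have "ricci A nabla k k p = (\<Sum>i\<in>UNIV. - k p (?B i i) - (\<Sum>l\<in>UNIV. ?B i l p * (?B l i p - ?d l i)) - (\<Sum>j\<in>UNIV. ?d i j * ?B j i p))"
    unfolding ricci_def Let_def c_def[symmetric] curvature_def by (simp add: t1 t2 t3)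
  also have "\<dots> = - (\<Sum>i\<in>UNIV. k p (?B i i)) - (\<Sum>i\<in>UNIV. \<Sum>l\<in>UNIV. ?B i l p * ?B l i p)
      + ((\<Sum>i\<in>UNIV. \<Sum>l\<in>UNIV. ?B i l p * ?d l i) - (\<Sum>i\<in>UNIV. \<Sum>j\<in>UNIV. ?B j i p * ?d i j))"
    by (simp add: sum_subtractf sum_negf sum.distrib algebra_simps)
  also have "(\<Sum>i\<in>UNIV. \<Sum>j\<in>UNIV. ?B j i p * ?d i j) = (\<Sum>i\<in>UNIV. \<Sum>l\<in>UNIV. ?B i l p * ?d l i)"
    by (rule sum.swap)
  also have "(\<Sum>i\<in>UNIV. k p (?B i i)) = k p (\<lambda>q. \<Sum>i\<in>UNIV. ?B i i q)"
    by (rule D_sum[OF o c(2) k_tangent, symmetric]) (auto intro: nabla_k_smooth[OF c(1)])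
  also have "\<dots> = k p expansion"
    by (rule D_cong[OF o c(2) k_tangent]) (simp add: expansion_coord[OF c(1)])
  also have "(\<Sum>i\<in>UNIV. \<Sum>l\<in>UNIV. ?B i l p * ?B l i p) = ltrace (\<lambda>u. cov_mat c p (cov_mat c p u))"
  proof -
    have "cov_mat c p (cov_mat c p (axis i 1)) $ m = (\<Sum>l\<in>UNIV. ?B i l p * ?B l m p)" for i m
    proof -
      have L: "linear (cov_mat c p)" by (rule cov_mat_linear[OF c])
      have "cov_mat c p (cov_mat c p (axis i 1)) = cov_mat c p (\<Sum>l\<in>UNIV. (cov_mat c p (axis i 1) $ l) *\<^sub>R axis l 1)"
        by (rule arg_cong[OF vec_axis_expand])
      then show ?thesis by (simp add: linear_sum[OF L] linear_scale[OF L] cov_mat_axis[OF c])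
    qed
    then show ?thesis by (simp add: ltrace_def)
  qed
  finally show ?thesis by simp
qed

text \<open>Without twist the expansion of a complete geodesic congruence would be a global solution of a Riccati
  inequality.\<close>

lemma twisting:
  assumes n: "CARD('n) = 4" and complete: "complete_vfield A k" and ricci: "\<And>p. ricci A nabla k k p > 0"
  shows "\<not> twist_free p"
proof
  assume tf: "twist_free p"
  obtain \<gamma> where \<gamma>: "smooth_curve A UNIV \<gamma>" "\<gamma> 0 = p" "\<And>t. velocity A \<gamma> t = k (\<gamma> t)"
    using complete unfolding complete_vfield_def by blast
  have tw: "twist_free (\<gamma> t)" for t
    using twist_free_propagates[OF \<gamma>(1,3), of 0 t] tf \<gamma>(2) by simp
  show False
  proof (rule riccati_no_global_solution)
    fix t
    define c where "c = chart_at A (\<gamma> t)"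
    have c: "c \<in> charts" "\<gamma> t \<in> fst c" using chart_at_charts chart_at_in by (auto simp: c_def)
    show "((\<lambda>t. expansion (\<gamma> t)) has_real_derivative k (\<gamma> t) expansion) (at t)"
      using smooth_along_curve_has_derivative[OF \<gamma>(1) open_UNIV UNIV_I
          smooth_nearI[OF expansion_smooth[OF c(1)] open_dom[OF c(1)] c(2)]] \<gamma>(3) by simp
    let ?k = "cmp c (k (\<gamma> t))"
    obtain e i0 where e: "lorentz_form (gram c (\<gamma> t)) e i0" using gram_lorentz[OF c] .
    have "(ltrace (cov_mat c (\<gamma> t)))\<^sup>2 \<le> 2 * ltrace (\<lambda>u. cov_mat c (\<gamma> t) (cov_mat c (\<gamma> t) u))"
    proof (rule twist_free_trace_inequality[OF n e cov_mat_linear[OF c], where k = ?k])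
      fix u v w
      show "gram c (\<gamma> t) ?k u * (gram c (\<gamma> t) (cov_mat c (\<gamma> t) v) w - gram c (\<gamma> t) (cov_mat c (\<gamma> t) w) v)
          + gram c (\<gamma> t) ?k v * (gram c (\<gamma> t) (cov_mat c (\<gamma> t) w) u - gram c (\<gamma> t) (cov_mat c (\<gamma> t) u) w)
          + gram c (\<gamma> t) ?k w * (gram c (\<gamma> t) (cov_mat c (\<gamma> t) u) v - gram c (\<gamma> t) (cov_mat c (\<gamma> t) v) u) = 0"
        using tw[of t] dvec_tangent[OF c] by (simp add: twist_free_def gram_k[OF c] gram_cov[OF c] rot_def)
    qed (use k_cmp_nonzero[OF c] gram_k_k[OF c] cov_mat_k[OF c] gram_cov_k[OF c] in auto)
    then have "(expansion (\<gamma> t))\<^sup>2 \<le> 2 * (- k (\<gamma> t) expansion - ricci A nabla k k (\<gamma> t))"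
      using raychaudhuri[of "\<gamma> t"] expansion_chart[OF c] by (simp add: c_def)
    then show "k (\<gamma> t) expansion < - (expansion (\<gamma> t))\<^sup>2 / 2" using ricci[of "\<gamma> t"] by simp
  qed
qed

end


section \<open>Tangent spaces of embedded submanifolds\<close>

context smooth_manifold
begin

lemma tangent_space_subset: "v \<in> tangent_space A S p \<Longrightarrow> v \<in> tangent A p"
  unfolding tangent_space_def by blast

lemma embedded_slice:
  assumes "embedded_submanifold A m S" "p \<in> S"
  obtains c J where "c \<in> charts" "p \<in> fst c" "card (- J) = m"
    "\<And>q. q \<in> fst c \<Longrightarrow> q \<in> S \<longleftrightarrow> (\<forall>i\<in>J. snd c q $ i = 0)"
proof -
  obtain U x J where "(U, x) \<in> charts" "p \<in> U" "card (- J) = m" "\<And>q. q \<in> U \<Longrightarrow> q \<in> S \<longleftrightarrow> (\<forall>i\<in>J. x q $ i = 0)"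
    using assms unfolding embedded_submanifold_def by blast
  then show ?thesis using that[of "(U, x)" J] by simp
qed

text \<open>Vectors tangent to \<open>S\<close> are velocities of curves in \<open>S\<close>, so they do not see functions vanishing on \<open>S\<close>.\<close>

lemma tangent_space_zero:
  assumes v: "v \<in> tangent_space A S p" and V: "open V" "p \<in> V" and h: "smooth_fun A V h"
    "\<And>q. q \<in> V \<Longrightarrow> q \<in> S \<Longrightarrow> h q = 0"
  shows "v h = 0"
proof -
  obtain \<gamma> \<epsilon> where g: "v = velocity A \<gamma> 0" "\<epsilon> > 0" "smooth_curve A {-\<epsilon><..<\<epsilon>} \<gamma>" "\<gamma> ` {-\<epsilon><..<\<epsilon>} \<subseteq> S" "\<gamma> 0 = p"
    using v unfolding tangent_space_def by auto
  have 0: "(0::real) \<in> {-\<epsilon><..<\<epsilon>}" using g by simp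
  have "((\<lambda>s. h (\<gamma> s)) has_real_derivative v h) (at 0)"
    using smooth_along_curve_has_derivative[OF g(3) open_greaterThanLessThan 0] smooth_nearI[OF h(1) V] g by simp
  then have "((\<lambda>s. 0) has_real_derivative v h) (at 0)"
    by (rule has_field_derivative_transform_within_open[OF _ curve_vimage_open[OF g(3) open_greaterThanLessThan V(1)]])
      (use g V h(2) in \<open>auto simp: image_subset_iff\<close>)
  then show ?thesis using DERIV_unique DERIV_const by blast
qed

lemma slice_tangent:
  assumes c: "c \<in> charts" "p \<in> fst c" and S: "\<And>q. q \<in> fst c \<Longrightarrow> q \<in> S \<longleftrightarrow> (\<forall>i\<in>J. snd c q $ i = 0)"
    and v: "v \<in> tangent_space A S p" and i: "i \<in> J"
  shows "cmp c v $ i = 0"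
  using tangent_space_zero[OF v open_dom[OF c(1)] c(2) smooth_fun_coord[OF c(1)], of i] S i
  by (simp add: cmp_def coord_fun_eq)

lemma slice_coord_field:
  assumes c: "c \<in> charts" "p \<in> fst c" and S: "\<And>q. q \<in> fst c \<Longrightarrow> q \<in> S \<longleftrightarrow> (\<forall>i\<in>J. snd c q $ i = 0)"
    and p: "p \<in> S" and l: "l \<notin> J"
  shows "coord_field A c l p \<in> tangent_space A S p"
proof -
  obtain \<gamma> \<epsilon> where g: "\<epsilon> > 0" "smooth_curve A {-\<epsilon><..<\<epsilon>} \<gamma>" "\<gamma> ` {-\<epsilon><..<\<epsilon>} \<subseteq> fst c" "\<gamma> 0 = p"
    "\<And>t. t \<in> {-\<epsilon><..<\<epsilon>} \<Longrightarrow> snd c (\<gamma> t) = snd c p + t *\<^sub>R axis l 1" "velocity A \<gamma> 0 = dvec c p (axis l 1)"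
    using coordinate_line[OF c, of "axis l 1"] by metis
  have "\<gamma> t \<in> S" if t: "t \<in> {-\<epsilon><..<\<epsilon>}" for t
  proof -
    have "\<gamma> t \<in> fst c" using g(3) t by blast
    moreover have "snd c (\<gamma> t) $ i = 0" if "i \<in> J" for i
      using g(5)[OF t] S[OF c(2)] p that l by (auto simp: axis_def)
    ultimately show ?thesis using S by blast
  qed
  then have "\<gamma> ` {-\<epsilon><..<\<epsilon>} \<subseteq> S" by blast
  then show ?thesis
    using g unfolding tangent_space_def coord_field_dvec by (auto intro!: exI[of _ \<gamma>] exI[of _ \<epsilon>])
qed

lemma tangent_fun_exp:
  assumes v: "v \<in> tangent A p" and h: "smooth_fun A UNIV h"
  shows "v (\<lambda>q. exp (h q)) = exp (h p) * v h"
proof -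
  obtain \<gamma> \<epsilon> where g: "v = velocity A \<gamma> 0" "\<epsilon> > 0" "smooth_curve A {-\<epsilon><..<\<epsilon>} \<gamma>" "\<gamma> 0 = p"
    using v unfolding tangent_space_def by auto
  have 0: "(0::real) \<in> {-\<epsilon><..<\<epsilon>}" using g by simp
  note d = smooth_along_curve_has_derivative[OF g(3) open_greaterThanLessThan 0 smooth_nearI[OF _ open_UNIV UNIV_I]]
  have "((\<lambda>s. exp (h (\<gamma> s))) has_real_derivative exp (h (\<gamma> 0)) * v h) (at 0)"
    using DERIV_chain2[OF DERIV_exp d[OF h]] g(1) by simp
  moreover have "((\<lambda>s. exp (h (\<gamma> s))) has_real_derivative v (\<lambda>q. exp (h q))) (at 0)"
    using d[OF smooth_fun_exp[OF h open_UNIV]] g(1) by simp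
  ultimately show ?thesis using DERIV_unique g(4) by blast
qed

end

context null_geodesic_field
begin

text \<open>In a degenerate tangent space containing \<open>k\<close>, the degenerate direction is null and orthogonal to \<open>k\<close>,
  so it is spanned by \<open>k\<close>.\<close>

lemma degenerate_orthogonal_k:
  assumes "induced_degenerate A g S" "tangent_to A k S" "p \<in> S" "w \<in> tangent_space A S p"
  shows "g p (k p) w = 0"
proof -
  obtain v where v: "v \<in> tangent_space A S p" "v \<noteq> tzero" "\<And>w. w \<in> tangent_space A S p \<Longrightarrow> g p v w = 0"
    using assms unfolding induced_degenerate_def by blast
  have kS: "k p \<in> tangent_space A S p" using assms unfolding tangent_to_def by blast
  note T = tangent_space_subset[OF v(1)] tangent_space_subset[OF assms(4)]
  note c = chart_at_charts[of p] chart_at_in(2)[of p]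
  let ?c = "chart_at A p"
  obtain e i0 where e: "lorentz_form (gram ?c p) e i0" using gram_lorentz[OF c] .
  have "gram ?c p (cmp ?c v) (cmp ?c v) = 0" "gram ?c p (cmp ?c (k p)) (cmp ?c v) = 0"
    using g_gram[OF c T(1) T(1)] g_gram[OF c k_tangent T(1)] g_sym[OF T(1) k_tangent] v(1,3) kS by auto
  then obtain a where a: "cmp ?c v = a *\<^sub>R cmp ?c (k p)"
    using lorentz_null_parallel[OF e gram_k_k[OF c] _ _ k_cmp_nonzero[OF c]] by blast
  have "a \<noteq> 0"
    using a v(2) tangent_eqI[OF c T(1) tangent_tzero] by auto
  moreover have "a * g p (k p) w = 0"
    using v(3)[OF assms(4)] g_gram[OF c T] g_gram[OF c k_tangent T(2)] a bilinear_lmul[OF gram_bilinear[OF c]] by simp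
  ultimately show ?thesis by simp
qed

end

section \<open>The symplectic form\<close>

locale twisting_null_field = null_geodesic_field A g nabla k
  for A :: "('a::{t2_space, second_countable_topology}, 'n::finite) chart set" and g nabla k +
  fixes f :: "'a \<Rightarrow> real"
  assumes dim: "CARD('n) = 4"
    and f_smooth: "smooth_fun A UNIV f"
    and kf: "\<And>p. k p f \<noteq> 0"
    and twist: "\<And>p. \<not> twist_free p"
begin

definition kexp :: "'a vfield" where
  "kexp = vf_scale (\<lambda>q. exp (f q)) k"

definition \<omega> :: "'a form2" where
  "\<omega> = ext_deriv1 A (\<lambda>q v. g q (kexp q) v)"

lemma kexp_smooth: "smooth_vfield A W kexp"
  unfolding kexp_def
  by (rule smooth_vfield_scale[OF k_smooth_on smooth_fun_subset[OF smooth_fun_exp[OF f_smooth open_UNIV]]]) simp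

lemma \<omega>_cov: "u \<in> tangent A p \<Longrightarrow> v \<in> tangent A p \<Longrightarrow> \<omega> p u v = g p (cov kexp p u) v - g p (cov kexp p v) u"
  unfolding \<omega>_def by (rule ext_deriv1_cov[OF kexp_smooth])

text \<open>The Leibniz rule \<open>\<nabla>(e\<^sup>f k) = e\<^sup>f (df \<otimes> k + \<nabla>k)\<close>, whose skew part is \<open>d(e\<^sup>f k\<^sup>\<flat>) = e\<^sup>f (df \<and> k\<^sup>\<flat> + dk\<^sup>\<flat>)\<close>.\<close>

lemma cov_kexp:
  assumes u: "u \<in> tangent A p"
  shows "cov kexp p u = tscale (exp (f p)) (tadd (tscale (u f) (k p)) (cov k p u))"
proof
  fix h
  let ?c = "chart_at A p" let ?D = "coord_field A ?c" and ?x = "coord_fun ?c"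
  note c = chart_at_charts[of p] chart_at_in(2)[of p]
  have "nabla (?D i) kexp p = tadd (tscale (?D i p (\<lambda>q. exp (f q))) (k p)) (tscale (exp (f p)) (nabla (?D i) k p))" for i
    unfolding kexp_def
    by (rule nabla_scale[OF open_dom[OF c(1)] D_field[OF c(1)] D_field[OF c(1)] k_smooth_on k_smooth_on
          smooth_fun_subset[OF smooth_fun_exp[OF f_smooth open_UNIV] subset_UNIV] c(2)])
  then have "nabla (?D i) kexp p h = exp (f p) * (?D i p f * k p h + nabla (?D i) k p h)" for i
    using tangent_fun_exp[OF coord_field_tangent[OF c] f_smooth] by (simp add: tadd_def tscale_def algebra_simps)
  then have "cov kexp p u h = exp (f p) * ((\<Sum>i\<in>UNIV. u (?x i) * ?D i p f) * k p h + cov k p u h)"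
    by (simp add: cov_def sum.distrib sum_distrib_left sum_distrib_right algebra_simps)
  then show "cov kexp p u h = tscale (exp (f p)) (tadd (tscale (u f) (k p)) (cov k p u)) h"
    unfolding tangent_expand[OF c u, of f, symmetric] by (simp add: tadd_def tscale_def)
qed

lemma \<omega>_formula:
  assumes u: "u \<in> tangent A p" and v: "v \<in> tangent A p"
  shows "\<omega> p u v = exp (f p) * (u f * g p (k p) v - v f * g p (k p) u + rot p u v)"
proof -
  have "g p (cov kexp p u) v = exp (f p) * (u f * g p (k p) v + g p (cov k p u) v)"
    if "u \<in> tangent A p" "v \<in> tangent A p" for u v
    unfolding cov_kexp[OF that(1)]
    using g_tscale[OF tangent_closed[OF k_tangent k_cov_tangent[OF that(1)]] that(2)]
      g_linear_left[OF k_tangent k_cov_tangent[OF that(1)] that(2)] by simp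
  then show ?thesis using \<omega>_cov[OF u v] u v by (simp add: rot_def algebra_simps)
qed

lemma \<omega>_linear:
  "\<omega> p (tadd (tscale a u) v) w = a * \<omega> p u w + \<omega> p v w"
  "\<omega> p w (tadd (tscale a u) v) = a * \<omega> p w u + \<omega> p w v"
  unfolding \<omega>_def ext_deriv1_def Let_def
  by (simp_all add: tadd_def tscale_def sum_distrib_left sum.distrib[symmetric] algebra_simps)

lemma \<omega>_diag: "u \<in> tangent A p \<Longrightarrow> \<omega> p u u = 0"
  by (simp add: \<omega>_cov)

lemma \<omega>_coord:
  assumes c: "c \<in> charts" "p \<in> fst c"
  shows "\<omega> p (coord_field A c i p) (coord_field A c j p)
    = coord_field A c i p (\<lambda>q. g q (kexp q) (coord_field A c j q)) - coord_field A c j p (\<lambda>q. g q (kexp q) (coord_field A c i q))"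
  unfolding \<omega>_cov[OF coord_field_tangent[OF c] coord_field_tangent[OF c]]
    coord_exterior[OF open_UNIV UNIV_I kexp_smooth c] cov_coord[OF open_UNIV UNIV_I kexp_smooth c] ..

definition \<omega>_mat :: "('a, 'n) chart \<Rightarrow> 'a \<Rightarrow> real ^ 'n \<Rightarrow> real ^ 'n \<Rightarrow> real" where
  "\<omega>_mat c p u v = \<omega> p (dvec c p u) (dvec c p v)"

lemma \<omega>_mat_bilinear:
  assumes c: "c \<in> charts" "p \<in> fst c"
  shows "bilinear (\<omega>_mat c p)"
proof -
  have 0: "\<omega> p tzero w = 0" "\<omega> p w tzero = 0" for w
    using \<omega>_linear[where p = p and a = 1 and u = tzero and v = tzero] by simp_all
  show ?thesis
    unfolding bilinear_def \<omega>_mat_def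
    using \<omega>_linear[where p = p and a = 1] \<omega>_linear[where p = p and v = tzero] 0
    by (intro conjI allI linearI) (simp_all add: dvec_scale_add[OF c])
qed

text \<open>A nonzero kernel vector of \<open>\<omega>\<close> would force the twist of \<open>k\<close> to vanish.\<close>

lemma \<omega>_mat_nondegenerate:
  assumes c: "c \<in> charts" "p \<in> fst c" and u: "\<And>v. \<omega>_mat c p u v = 0"
  shows "u = 0"
proof (rule ccontr)
  assume u0: "u \<noteq> 0"
  let ?k = "cmp c (k p)" and ?a = "\<lambda>w. dvec c p w f"
  note T = dvec_tangent[OF c]
  have lin: "linear ?a"
    by (rule linearI) (simp_all add: dvec_scale_add[OF c] tadd_def tscale_def)
  obtain e i0 where e: "lorentz_form (gram c p) e i0" using gram_lorentz[OF c] .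
  obtain w where w: "gram c p ?k w \<noteq> 0"
    using lorentz_form_nondegenerate[OF e] k_cmp_nonzero[OF c] by blast
  have ak: "?a ?k \<noteq> 0" using kf[of p] tangent_dvec[OF c k_tangent] by simp
  have deg: "?a u * gram c p ?k v - ?a v * gram c p ?k u + rot_mat c p u v = 0" for v
    using u[of v] \<omega>_formula[OF T T, of u v] by (simp add: \<omega>_mat_def gram_k[OF c] rot_mat_eq[OF c])
  note T0 = degenerate_imp_twist_free[OF dim rot_mat_bilinear[OF c] rot_mat_skew[OF c] gram_linear(1)[OF c] lin w
      gram_k_k[OF c] rot_mat_k[OF c] ak u0 deg]
  have "twist_free p"
    unfolding twist_free_def
  proof (intro ballI)
    fix x y z assume "x \<in> tangent A p" "y \<in> tangent A p" "z \<in> tangent A p"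
    then have "x = dvec c p (cmp c x)" "y = dvec c p (cmp c y)" "z = dvec c p (cmp c z)"
      using tangent_dvec[OF c] by auto
    then show "g p (k p) x * rot p y z + g p (k p) y * rot p z x + g p (k p) z * rot p x y = 0"
      using T0[of "cmp c x" "cmp c y" "cmp c z"] by (simp add: gram_k[OF c] rot_mat_eq[OF c])
  qed
  then show False using twist by blast
qed

lemma \<omega>_smooth: "smooth_tensor2 A \<omega>"
  unfolding smooth_tensor2_def bilinear_at_def
proof (intro conjI allI impI ballI)
  fix W X Y assume W: "open W \<and> smooth_vfield A W X \<and> smooth_vfield A W Y"
  show "smooth_fun A W (\<lambda>p. \<omega> p (X p) (Y p))"
  proof (rule smooth_fun_cong)
    show "smooth_fun A W (\<lambda>p. g p (nabla X kexp p) (Y p) - g p (nabla Y kexp p) (X p))"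
      using W by (intro smooth_fun_diff g_smooth nabla_smooth kexp_smooth) auto
    fix q assume q: "q \<in> W"
    show "g q (nabla X kexp q) (Y q) - g q (nabla Y kexp q) (X q) = \<omega> q (X q) (Y q)"
      using W q \<omega>_cov[of "X q" q "Y q"] smooth_vfield_tangent[of W] cov_field[OF _ q _ kexp_smooth] by simp
  qed (use W in simp)
qed (rule \<omega>_linear)+

lemma \<omega>_closed: "ext_deriv2 A \<omega> p u v w = 0"
proof -
  let ?c = "chart_at A p" let ?D = "coord_field A ?c"
  note c = chart_at_charts[of p] chart_at_in(2)[of p]
  note o = open_dom[OF c(1)]
  let ?\<alpha> = "\<lambda>i q. g q (kexp q) (?D i q)"
  have sm: "smooth_fun A (fst ?c) (?\<alpha> i)" for i
    by (rule g_smooth[OF o kexp_smooth D_field[OF c(1)]])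
  have "?D i p (\<lambda>q. \<omega> q (?D j q) (?D l q)) = ?D i p (\<lambda>q. ?D j q (?\<alpha> l) - ?D l q (?\<alpha> j))" for i j l
    by (rule D_cong[OF o c(2) coord_field_tangent[OF c]]) (rule \<omega>_coord[OF c(1)])
  then show ?thesis
    using curl_closed[OF c, of ?\<alpha>, OF sm] by (simp add: ext_deriv2_def Let_def)
qed

lemma \<omega>_symplectic: "symplectic_form A \<omega>"
  unfolding symplectic_form_def
proof (intro conjI allI ballI impI \<omega>_smooth \<omega>_closed \<omega>_diag)
  fix p u assume u: "u \<in> tangent A p" "u \<noteq> tzero"
  note c = chart_at_charts[of p] chart_at_in(2)[of p]
  let ?c = "chart_at A p"
  have "cmp ?c u \<noteq> 0" using u tangent_eqI[OF c u(1) tangent_tzero] by auto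
  then obtain v where "\<omega>_mat ?c p (cmp ?c u) v \<noteq> 0" using \<omega>_mat_nondegenerate[OF c] by blast
  then show "\<exists>v\<in>tangent A p. \<omega> p u v \<noteq> 0"
    using dvec_tangent[OF c] tangent_dvec[OF c u(1)] unfolding \<omega>_mat_def by metis
qed

text \<open>Because \<open>i\<^sub>k \<omega> = e\<^sup>f k(f) k\<^sup>\<flat>\<close>.\<close>

lemma \<omega>_k:
  assumes w: "w \<in> tangent A p" and "g p (k p) w = 0"
  shows "\<omega> p (k p) w = 0"
proof -
  note c = chart_at_charts[of p] chart_at_in(2)[of p]
  have "rot p (k p) w = rot_mat (chart_at A p) p (cmp (chart_at A p) (k p)) (cmp (chart_at A p) w)"
    using rot_mat_eq[OF c] tangent_dvec[OF c k_tangent] tangent_dvec[OF c w] by simp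
  then show ?thesis
    using \<omega>_formula[OF k_tangent w] assms rot_mat_k[OF c] k_null by (simp add: null_vfield_def)
qed

text \<open>On a null hypersurface tangent to \<open>k\<close> the form \<open>k\<^sup>\<flat>\<close> pulls back to zero, hence so does \<open>\<omega>\<close>; but a
  hyperplane is too big to be isotropic.\<close>

lemma no_null_hypersurface:
  assumes H: "null_hypersurface A g H" "tangent_to A k H"
  shows False
proof -
  obtain p where p: "p \<in> H" using H(1) by (auto simp: null_hypersurface_def)
  have deg: "induced_degenerate A g H" and emb: "embedded_submanifold A 3 H"
    using H(1) dim by (auto simp: null_hypersurface_def)
  obtain c J where c: "c \<in> charts" "p \<in> fst c" and J: "card (- J) = 3"
    and slice: "\<And>q. q \<in> fst c \<Longrightarrow> q \<in> H \<longleftrightarrow> (\<forall>i\<in>J. snd c q $ i = 0)"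
    using embedded_slice[OF emb p] by blast
  have "card J = 1"
    using J dim card_Diff_subset[of J UNIV] card_mono[of UNIV J] by (simp add: Compl_eq_Diff_UNIV)
  then obtain j where j: "J = {j}" by (auto simp: card_1_singleton_iff)
  let ?\<alpha> = "\<lambda>i q. g q (kexp q) (coord_field A c i q)"
  have "?\<alpha> i q = 0" if "q \<in> fst c" "q \<in> H" "i \<noteq> j" for i q
  proof -
    have "coord_field A c i q \<in> tangent_space A H q"
      using slice_coord_field[OF c(1) that(1) slice that(2)] that(3) j by simp
    then have "g q (k q) (coord_field A c i q) = 0" by (rule degenerate_orthogonal_k[OF deg H(2) that(2)])
    then show ?thesis
      using g_tscale[OF k_tangent coord_field_tangent[OF c(1) that(1)]] by (simp add: kexp_def vf_scale_def)
  qed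
  then have "coord_field A c l p (?\<alpha> i) = 0" if "l \<noteq> j" "i \<noteq> j" for l i
    using that j
    by (intro tangent_space_zero[OF slice_coord_field[OF c slice p] open_dom[OF c(1)] c(2)]
        g_smooth[OF open_dom[OF c(1)] kexp_smooth D_field[OF c(1)]]) auto
  then have "\<omega>_mat c p (axis l 1) (axis m 1) = 0" if "l \<noteq> j" "m \<noteq> j" for l m
    using that \<omega>_coord[OF c, of l m] by (simp add: \<omega>_mat_def coord_field_dvec)
  then show False
    using isotropic_hyperplane_degenerate[OF dim \<omega>_mat_bilinear[OF c]] \<omega>_mat_nondegenerate[OF c] by metis
qed

text \<open>The tangent plane contains \<open>k\<close>, and \<open>i\<^sub>k \<omega>\<close> vanishes on it because \<open>k\<^sup>\<flat>\<close> does.\<close>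

lemma null_surface_lagrangian:
  assumes S: "null_surface A g S" "tangent_to A k S"
  shows "lagrangian A \<omega> S"
proof -
  have deg: "induced_degenerate A g S" and emb: "embedded_submanifold A 2 S"
    using S(1) by (auto simp: null_surface_def)
  have "\<omega> p u v = 0" if p: "p \<in> S" and u: "u \<in> tangent_space A S p" and v: "v \<in> tangent_space A S p" for p u v
  proof -
    obtain c J where c: "c \<in> charts" "p \<in> fst c" and J: "card (- J) = 2"
      and slice: "\<And>q. q \<in> fst c \<Longrightarrow> q \<in> S \<longleftrightarrow> (\<forall>i\<in>J. snd c q $ i = 0)"
      using embedded_slice[OF emb p] by blast
    have kS: "k p \<in> tangent_space A S p" using S(2) p by (simp add: tangent_to_def)
    have mat: "\<omega>_mat c p (cmp c x) (cmp c y) = \<omega> p x y" if "x \<in> tangent A p" "y \<in> tangent A p" for x y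
      using tangent_dvec[OF c that(1)] tangent_dvec[OF c that(2)] by (simp add: \<omega>_mat_def)
    have k0: "\<omega>_mat c p (cmp c (k p)) (cmp c w) = 0" if "w \<in> tangent_space A S p" for w
      using mat[OF k_tangent tangent_space_subset[OF that]] \<omega>_k[OF tangent_space_subset[OF that]]
        degenerate_orthogonal_k[OF deg S(2) p that] by simp
    have "\<omega>_mat c p (cmp c u) (cmp c v) = 0"
    proof (rule isotropic_plane[OF \<omega>_mat_bilinear[OF c] _ J _ _ _ k_cmp_nonzero[OF c]])
      show "\<omega>_mat c p x x = 0" for x using \<omega>_diag[OF dvec_tangent[OF c]] by (simp add: \<omega>_mat_def)
    qed (use k0[OF u] k0[OF v] slice_tangent[OF c slice] u v kS in auto)
    then show ?thesis using mat[OF tangent_space_subset[OF u] tangent_space_subset[OF v]] by simp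
  qed
  then show ?thesis using dim emb unfolding lagrangian_def by (auto intro!: exI[of _ 2])
qed

end

theorem mainTheorem2:
  fixes A :: "('a::{t2_space, second_countable_topology}, 4) chart set"
    and g :: "'a \<Rightarrow> 'a tvec \<Rightarrow> 'a tvec \<Rightarrow> real"
    and nabla :: "'a vfield \<Rightarrow> 'a vfield \<Rightarrow> 'a vfield"
    and k :: "'a vfield"
    and f :: "'a \<Rightarrow> real"
    and \<omega> :: "'a form2"
  assumes "smooth_atlas A"
    and "lorentzian_metric A g"
    and "levi_civita A g nabla"
    and "smooth_vfield A UNIV k"
    and "null_vfield g k"
    and "complete_vfield A k"
    and "\<forall>p. nabla k k p = tzero"
    and "\<forall>p. ricci A nabla k k p > 0"
    and "smooth_fun A UNIV f"
    and "\<forall>p. k p f \<noteq> 0"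
    and "\<omega> = ext_deriv1 A (\<lambda>p v. g p (vf_scale (\<lambda>q. exp (f q)) k p) v)"
  shows "symplectic_form A \<omega> \<and>
    \<not> (\<exists>H. null_hypersurface A g H \<and> tangent_to A k H) \<and>
    (\<forall>S. null_surface A g S \<and> tangent_to A k S \<longrightarrow> lagrangian A \<omega> S)"
proof -
  interpret F: null_geodesic_field A g nabla k
    using assms by unfold_locales auto
  interpret T: twisting_null_field A g nabla k f
    using assms F.twisting by unfold_locales auto
  have "\<omega> = T.\<omega>"
    unfolding assms(11) T.\<omega>_def T.kexp_def ..
  then show ?thesis
    using T.\<omega>_symplectic T.no_null_hypersurface T.null_surface_lagrangian by blast
qed


end
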